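(* Let $\tau\ge0$, let $M$ be a compact $d$-dimensional manifold and consider the control system $\dot q(t)=X(q(t),u(t))$ on $M$ with control set $U$. For each $q\in M$ there exists a nonempty invariant $\tau$ dwell-time control set ($\tau$-ICS) $D_q$ contained in $\overline{\mathfrak{S}^\tau_{\mathcal{F}}(q)}$. If, moreover, $\mathrm{Lie}_p(\mathcal{F})=T_pM$ for every $p\in M$, then $D_q$ has nonempty interior.
   Context: $U$ is a nonempty set and $X:M\times U\to TM$ is such that $X(\cdot,u)$ is a smooth complete vector field on $M$ for every $u\in U$; $\mathcal{F}=\{X(\cdot,u)\mid u\in U\}$; $\mathrm{Lie}_p(\mathcal{F})$ is the evaluation at $p$ of the Lie algebra of vector fields generated by $\mathcal{F}$; $e^{tY}$ is the flow of a vector field $Y$. Let $$\mathfrak{S}^\tau_{\mathcal{F}}=\{e^{t_mX_m}\circ\dots\circ e^{t_1X_1}\mid m\ge1,\ X_1,\dots,X_m\in\mathcal{F},\ t_1,\dots,t_m\ge\tau\},\quad\mathfrak{S}^\tau_{\mathcal{F}}(q)=\{g(q)\mid g\in\mathfrak{S}^\tau_{\mathcal{F}}\}.$$ Let $\mathcal{U}^\tau$ be the set of $U$-valued functions on compact intervals $[0,T]$ which are finite concatenations of at least one constant piece, all pieces having length $\ge\tau$, and $\mathcal{U}^\tau_\infty$ the set of piecewise constant $u:[0,\infty)\to U$ such that $u|_{[0,T_n]}\in\mathcal{U}^\tau$ for some sequence $T_n\to+\infty$; $\phi(t,q,u)$ is the trajectory from $q$ driven by $u$. Membership of $u|_{[t,+\infty)}$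 is understood after shifting time to start at $0$. A set $D\subset M$ is a $\tau$ dwell-time control set ($\tau$-CS) if (i) for every $q\in D$ there is $u\in\mathcal{U}^\tau_\infty$ such that $\phi(t,q,u)\in D$ for all $t>0$ for which both $u|_{[0,t]}\in\mathcal{U}^\tau$ and $u|_{[t,+\infty)}\in\mathcal{U}^\tau_\infty$; (ii) $D\subset\overline{\mathfrak{S}^\tau_{\mathcal{F}}(q)}$ for every $q\in D$; (iii) $D$ is maximal: if $D'\supset D$ satisfies (i) and (ii) then $D'=D$. A $\tau$-ICS is a $\tau$-CS $D$ with $\overline{D}=\overline{\mathfrak{S}^\tau_{\mathcal{F}}(q)}$ for every $q\in D$. *)

theory Defs
  imports "HOL-Analysis.Analysis"
begin

section \<open>Smooth maps between subsets of Euclidean spaces\<close>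

text \<open>The sets \<open>W\<close> below are open, or consist of a single point in dimension 0; then the
  derivative within \<open>W\<close> is the ordinary one, or is immaterial, respectively.\<close>

primrec Ck_on ::
  "nat \<Rightarrow> 'a::euclidean_space set \<Rightarrow> ('a \<Rightarrow> 'b::euclidean_space) \<Rightarrow> bool" where
  "Ck_on 0 W f \<longleftrightarrow> continuous_on W f"
| "Ck_on (Suc k) W f \<longleftrightarrow>
     (\<forall>x\<in>W. f differentiable (at x within W)) \<and>
     (\<forall>v. Ck_on k W (\<lambda>x. frechet_derivative f (at x within W) v))"

definition smooth_on :: "'a::euclidean_space set \<Rightarrow> ('a \<Rightarrow> 'b::euclidean_space) \<Rightarrow> bool" where
  "smooth_on W f \<longleftrightarrow> (\<forall>k. Ck_on k W f)"


section \<open>Smooth manifolds\<close>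

text \<open>The manifold is the whole type \<open>'m\<close>, whose sort supplies the Hausdorff and second countability
  axioms; its smooth structure is given by an atlas. A chart is a domain together with a
  coordinate map, whose values off the domain are irrelevant.\<close>

type_synonym ('m, 'e) chart = "'m set \<times> ('m \<Rightarrow> 'e)"

abbreviation dom_of :: "('m, 'e) chart \<Rightarrow> 'm set" where
  "dom_of c \<equiv> fst c"

abbreviation coord :: "('m, 'e) chart \<Rightarrow> 'm \<Rightarrow> 'e" where
  "coord c \<equiv> snd c"

definition chart_inv :: "('m, 'e) chart \<Rightarrow> 'e \<Rightarrow> 'm" where
  "chart_inv c = inv_into (dom_of c) (coord c)"

definition transition :: "('m, 'e) chart \<Rightarrow> ('m, 'e) chart \<Rightarrow> 'e \<Rightarrow> 'e" where
  "transition c c' = coord c' \<circ> chart_inv c"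

text \<open>A type of class \<open>euclidean_space\<close> has positive dimension, so dimension 0 is modelled on
  the trivial subspace.\<close>

definition model_space :: "nat \<Rightarrow> 'e::euclidean_space set" where
  "model_space d = (if d = 0 then {0} else UNIV)"

definition smooth_atlas ::
  "nat \<Rightarrow> ('m::{t2_space,second_countable_topology}, 'e::euclidean_space) chart set \<Rightarrow> bool" where
  "smooth_atlas d A \<longleftrightarrow>
     (d = 0 \<or> d = DIM('e)) \<and>
     (\<Union>c\<in>A. dom_of c) = UNIV \<and>
     (\<forall>c\<in>A. open (dom_of c) \<and>
        openin (top_of_set (model_space d)) (coord c ` dom_of c) \<and>
        homeomorphism (dom_of c) (coord c ` dom_of c) (coord c) (chart_inv c)) \<and>
     (\<forall>c\<in>A. \<forall>c'\<in>A. smooth_on (coord c ` (dom_of c \<inter> dom_of c')) (transition c c'))"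


section \<open>Tangent vectors and vector fields\<close>

text \<open>A tangent vector at \<open>p\<close> is the family of its coordinate representations in all charts of the
  atlas around \<open>p\<close>, related by the Jacobians of the transition maps. It is set to 0 on
  all other arguments, so that equality of tangent vectors is equality of functions.\<close>

type_synonym ('m, 'e) tangent = "('m, 'e) chart \<Rightarrow> 'e"

type_synonym ('m, 'e) vfield = "'m \<Rightarrow> ('m, 'e) tangent"

definition tangent_space ::
  "nat \<Rightarrow> ('m, 'e::euclidean_space) chart set \<Rightarrow> 'm \<Rightarrow> ('m, 'e) tangent set" where
  "tangent_space d A p =
     {v. (\<forall>c. c \<in> A \<and> p \<in> dom_of c \<longrightarrow> v c \<in> model_space d) \<and>
         (\<forall>c. \<not> (c \<in> A \<and> p \<in> dom_of c) \<longrightarrow> v c = 0) \<and>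
         (\<forall>c\<in>A. \<forall>c'\<in>A. p \<in> dom_of c \<inter> dom_of c' \<longrightarrow>
            v c' = frechet_derivative (transition c c')
                     (at (coord c p) within coord c ` (dom_of c \<inter> dom_of c')) (v c))}"

definition local_rep :: "('m, 'e) vfield \<Rightarrow> ('m, 'e) chart \<Rightarrow> 'e \<Rightarrow> 'e" where
  "local_rep Y c x = Y (chart_inv c x) c"

definition smooth_vfield ::
  "nat \<Rightarrow> ('m, 'e::euclidean_space) chart set \<Rightarrow> ('m, 'e) vfield \<Rightarrow> bool" where
  "smooth_vfield d A Y \<longleftrightarrow>
     (\<forall>p. Y p \<in> tangent_space d A p) \<and>
     (\<forall>c\<in>A. smooth_on (coord c ` dom_of c) (local_rep Y c))"

text \<open>Coordinate expression of the commutator of derivations, \<open>f \<mapsto> Y (Z f) - Z (Y f)\<close>.\<close>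

definition lie_bracket ::
  "('m, 'e::euclidean_space) chart set \<Rightarrow> ('m, 'e) vfield \<Rightarrow> ('m, 'e) vfield \<Rightarrow> ('m, 'e) vfield" where
  "lie_bracket A Y Z = (\<lambda>p c.
     if c \<in> A \<and> p \<in> dom_of c then
       frechet_derivative (local_rep Z c) (at (coord c p) within coord c ` dom_of c) (Y p c) -
       frechet_derivative (local_rep Y c) (at (coord c p) within coord c ` dom_of c) (Z p c)
     else 0)"

inductive_set lie_algebra ::
  "('m, 'e::euclidean_space) chart set \<Rightarrow> ('m, 'e) vfield set \<Rightarrow> ('m, 'e) vfield set"
  for A F where
  generator: "Y \<in> F \<Longrightarrow> Y \<in> lie_algebra A F"
| zero: "(\<lambda>p c. 0) \<in> lie_algebra A F"
| add: "Y \<in> lie_algebra A F \<Longrightarrow> Z \<in> lie_algebra A F \<Longrightarrow>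
    (\<lambda>p c. Y p c + Z p c) \<in> lie_algebra A F"
| scale: "Y \<in> lie_algebra A F \<Longrightarrow> (\<lambda>p c. r *\<^sub>R Y p c) \<in> lie_algebra A F"
| bracket: "Y \<in> lie_algebra A F \<Longrightarrow> Z \<in> lie_algebra A F \<Longrightarrow>
    lie_bracket A Y Z \<in> lie_algebra A F"

definition lie_at ::
  "('m, 'e::euclidean_space) chart set \<Rightarrow> ('m, 'e) vfield set \<Rightarrow> 'm \<Rightarrow> ('m, 'e) tangent set" where
  "lie_at A F p = {Y p | Y. Y \<in> lie_algebra A F}"


section \<open>Flows\<close>

definition integral_curve ::
  "('m::topological_space, 'e::euclidean_space) chart set \<Rightarrow> ('m, 'e) vfield \<Rightarrow> (real \<Rightarrow> 'm) \<Rightarrow> bool"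
  where
  "integral_curve A Y \<gamma> \<longleftrightarrow>
     continuous_on UNIV \<gamma> \<and>
     (\<forall>t. \<forall>c\<in>A. \<gamma> t \<in> dom_of c \<longrightarrow>
        ((\<lambda>s. coord c (\<gamma> s)) has_vector_derivative Y (\<gamma> t) c) (at t))"

definition complete_vfield ::
  "('m::topological_space, 'e::euclidean_space) chart set \<Rightarrow> ('m, 'e) vfield \<Rightarrow> bool" where
  "complete_vfield A Y \<longleftrightarrow> (\<forall>p. \<exists>\<gamma>. integral_curve A Y \<gamma> \<and> \<gamma> 0 = p)"

definition flow ::
  "('m::topological_space, 'e::euclidean_space) chart set \<Rightarrow> ('m, 'e) vfield \<Rightarrow> real \<Rightarrow> 'm \<Rightarrow> 'm"
  where
  "flow A Y t p = (THE \<gamma>. integral_curve A Y \<gamma> \<and> \<gamma> 0 = p) t"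


section \<open>Control systems with dwell time\<close>

definition fields :: "('m \<Rightarrow> 'u \<Rightarrow> ('m, 'e) tangent) \<Rightarrow> 'u set \<Rightarrow> ('m, 'e) vfield set" where
  "fields X U = {(\<lambda>p. X p u) | u. u \<in> U}"

definition dwell_semigroup ::
  "('m::topological_space, 'e::euclidean_space) chart set \<Rightarrow> ('m, 'e) vfield set \<Rightarrow> real \<Rightarrow>
    ('m \<Rightarrow> 'm) set" where
  "dwell_semigroup A F \<tau> =
     {fold (\<lambda>(t, Y) g. flow A Y t \<circ> g) ps id | ps.
        ps \<noteq> [] \<and> (\<forall>(t, Y)\<in>set ps. Y \<in> F \<and> t \<ge> \<tau>)}"

definition dwell_orbit ::
  "('m::topological_space, 'e::euclidean_space) chart set \<Rightarrow> ('m, 'e) vfield set \<Rightarrow> real \<Rightarrow>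
    'm \<Rightarrow> 'm set" where
  "dwell_orbit A F \<tau> q = {g q | g. g \<in> dwell_semigroup A F \<tau>}"

text \<open>\<open>dwell_control U \<tau> T u\<close> says that the restriction of \<open>u\<close> to \<open>[0, T]\<close> is a concatenation of
  constant pieces of length at least \<open>\<tau>\<close>. A switching time belongs to the piece that it
  starts. The value at the final time \<open>T\<close> is an arbitrary element of \<open>U\<close>, because a restriction to
  \<open>[0, T]\<close> of a longer control may switch at \<open>T\<close>. For \<open>\<tau> = 0\<close> pieces of length 0 are allowed.\<close>

definition dwell_control :: "'u set \<Rightarrow> real \<Rightarrow> real \<Rightarrow> (real \<Rightarrow> 'u) \<Rightarrow> bool" where
  "dwell_control U \<tau> T u \<longleftrightarrow>
     (\<forall>t\<in>{0..T}. u t \<in> U) \<and>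
     (\<exists>m s. m \<ge> (1::nat) \<and> s 0 = 0 \<and> s m = T \<and>
        (\<forall>i<m. s i \<le> s (Suc i) \<and> s (Suc i) - s i \<ge> \<tau> \<and>
           (\<exists>a\<in>U. \<forall>t\<in>{s i..<s (Suc i)}. u t = a)))"

definition dwell_control_inf :: "'u set \<Rightarrow> real \<Rightarrow> (real \<Rightarrow> 'u) \<Rightarrow> bool" where
  "dwell_control_inf U \<tau> u \<longleftrightarrow>
     (\<exists>T. filterlim T at_top sequentially \<and> (\<forall>n. dwell_control U \<tau> (T n) u))"

text \<open>The curve \<open>\<xi>\<close> solves the system driven by \<open>u\<close>; the exceptional set \<open>S\<close> accommodates the
  switching times.\<close>

definition is_trajectory ::
  "('m::topological_space, 'e::euclidean_space) chart set \<Rightarrow> ('m \<Rightarrow> 'u \<Rightarrow> ('m, 'e) tangent) \<Rightarrow>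
    'm \<Rightarrow> (real \<Rightarrow> 'u) \<Rightarrow> (real \<Rightarrow> 'm) \<Rightarrow> bool" where
  "is_trajectory A X q u \<xi> \<longleftrightarrow>
     \<xi> 0 = q \<and> continuous_on {0..} \<xi> \<and>
     (\<exists>S. (\<forall>T. finite (S \<inter> {0..T})) \<and>
        (\<forall>t>0. t \<notin> S \<longrightarrow> (\<forall>c\<in>A. \<xi> t \<in> dom_of c \<longrightarrow>
           ((\<lambda>s. coord c (\<xi> s)) has_vector_derivative X (\<xi> t) (u t) c) (at t))))"

definition trajectory ::
  "('m::topological_space, 'e::euclidean_space) chart set \<Rightarrow> ('m \<Rightarrow> 'u \<Rightarrow> ('m, 'e) tangent) \<Rightarrow>
    real \<Rightarrow> 'm \<Rightarrow> (real \<Rightarrow> 'u) \<Rightarrow> 'm" where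
  "trajectory A X t q u = (THE r. \<exists>\<xi>. is_trajectory A X q u \<xi> \<and> \<xi> t = r)"

definition weakly_invariant ::
  "('m::topological_space, 'e::euclidean_space) chart set \<Rightarrow> ('m \<Rightarrow> 'u \<Rightarrow> ('m, 'e) tangent) \<Rightarrow>
    'u set \<Rightarrow> real \<Rightarrow> 'm set \<Rightarrow> bool" where
  "weakly_invariant A X U \<tau> D \<longleftrightarrow>
     (\<forall>q\<in>D. \<exists>u. dwell_control_inf U \<tau> u \<and>
        (\<forall>t>0. dwell_control U \<tau> t u \<and> dwell_control_inf U \<tau> (\<lambda>s. u (t + s)) \<longrightarrow>
           trajectory A X t q u \<in> D))"

definition approx_controllable ::
  "('m::topological_space, 'e::euclidean_space) chart set \<Rightarrow> ('m \<Rightarrow> 'u \<Rightarrow> ('m, 'e) tangent) \<Rightarrow>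
    'u set \<Rightarrow> real \<Rightarrow> 'm set \<Rightarrow> bool" where
  "approx_controllable A X U \<tau> D \<longleftrightarrow>
     (\<forall>q\<in>D. D \<subseteq> closure (dwell_orbit A (fields X U) \<tau> q))"

definition dwell_control_set ::
  "('m::topological_space, 'e::euclidean_space) chart set \<Rightarrow> ('m \<Rightarrow> 'u \<Rightarrow> ('m, 'e) tangent) \<Rightarrow>
    'u set \<Rightarrow> real \<Rightarrow> 'm set \<Rightarrow> bool" where
  "dwell_control_set A X U \<tau> D \<longleftrightarrow>
     weakly_invariant A X U \<tau> D \<and> approx_controllable A X U \<tau> D \<and>
     (\<forall>D'. D \<subseteq> D' \<and> weakly_invariant A X U \<tau> D' \<and> approx_controllable A X U \<tau> D' \<longrightarrow> D' = D)"

definition invariant_dwell_control_set ::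
  "('m::topological_space, 'e::euclidean_space) chart set \<Rightarrow> ('m \<Rightarrow> 'u \<Rightarrow> ('m, 'e) tangent) \<Rightarrow>
    'u set \<Rightarrow> real \<Rightarrow> 'm set \<Rightarrow> bool" where
  "invariant_dwell_control_set A X U \<tau> D \<longleftrightarrow>
     dwell_control_set A X U \<tau> D \<and>
     (\<forall>q\<in>D. closure D = closure (dwell_orbit A (fields X U) \<tau> q))"

end

theory Submission
  imports Defs
begin

text \<open>Existence of the invariant control set is a compactness argument. The elements of the dwell-time
semigroup are continuous maps of \<open>M\<close>, so the closure of an orbit is mapped into itself by the
semigroup. By Zorn's lemma and compactness, the orbit closure of \<open>q\<close> contains a minimal nonempty
closed invariant set \<open>D\<close>, and minimality makes \<open>D\<close> the orbit closure of each of its points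
(\<open>exists_minimal_orbit_closure\<close>). This is approximate controllability and the invariance property in
one equation, and it forces maximality: a larger approximately controllable set is contained in the
orbit closure of a point of \<open>D\<close>, which is \<open>D\<close>. Weak invariance is witnessed by constant controls,
because their trajectories at admissible times are orbit points.

This needs uniqueness of trajectories and continuity of the flows. Both come from estimates in
charts over short times, during which the distance of two solutions at most doubles
(\<open>short_time_bound\<close>). Integral curves exist by completeness, so only their dependence on the
initial value is at stake. The same estimate, applied to linear combinations of differences of
solutions, shows that difference quotients converge, and the flow is \<open>C\<^sup>1\<close> jointly in time and
position (\<open>short_flow.C1_deriv_flow\<close>). Compactness of \<open>M\<close> provides a common short time for all
points, and the flow over a long time is a composition of flows over short times.

The interior is treated by Krener's argument. Among all \<open>C\<^sup>1\<close> maps \<open>\<Psi>\<close> with values in \<open>D\<close>, written in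
charts, one has a derivative of maximal rank \<open>k\<close> at some point, and after a change of variables it
has rank \<open>k\<close> on an open set (\<open>constant_rank_normal_form\<close>). There every field \<open>Y\<close> of the system takes
values in the range of the derivative of \<open>\<Psi>\<close>: otherwise the map that sends \<open>x\<close> to the point reached
from \<open>\<Psi> x\<close> along \<open>Y\<close> at time \<open>\<tau> + 1 + l x\<close>, with a suitable linear form \<open>l\<close>, would have values in \<open>D\<close>
and rank \<open>k + 1\<close> (\<open>flowing_out_increases_rank\<close>). The dwell time does no harm, because the flow of \<open>Y\<close>
over the time \<open>\<tau> + 1\<close> is a local diffeomorphism and preserves \<open>Y\<close>. Tangency to \<open>\<Psi>\<close> is inherited by
Lie brackets (\<open>bracket_tangent_to_constant_rank_map\<close>). Hence, if the Lie algebra spans every tangent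
space, then \<open>k\<close> is the dimension and the image of \<open>\<Psi>\<close> contains an open set.

A manifold of dimension 0 is discrete, and all flows are the identity.\<close>

section \<open>Continuously differentiable maps\<close>

definition C1_deriv ::
  "'a::real_normed_vector set \<Rightarrow> ('a \<Rightarrow> 'b::real_normed_vector) \<Rightarrow> ('a \<Rightarrow> 'a \<Rightarrow>\<^sub>L 'b) \<Rightarrow> bool" where
  "C1_deriv S f f' \<longleftrightarrow> (\<forall>x\<in>S. (f has_derivative f' x) (at x)) \<and> continuous_on S f'"

lemma C1_derivD:
  assumes "C1_deriv S f f'"
  shows "x \<in> S \<Longrightarrow> (f has_derivative f' x) (at x)" "continuous_on S f'"
  using assms unfolding C1_deriv_def by auto

lemma C1_deriv_subset: "C1_deriv S f f' \<Longrightarrow> T \<subseteq> S \<Longrightarrow> C1_deriv T f f'"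
  unfolding C1_deriv_def by (meson continuous_on_subset subset_iff)

lemma C1_deriv_imp_continuous_on: "C1_deriv S f f' \<Longrightarrow> continuous_on S f"
  unfolding C1_deriv_def
  by (meson continuous_at_imp_continuous_on has_derivative_continuous)

lemma C1_deriv_cong:
  assumes "C1_deriv S f f'" "open S" "\<And>x. x \<in> S \<Longrightarrow> f x = g x"
  shows "C1_deriv S g f'"
  using assms unfolding C1_deriv_def by (metis has_derivative_transform_within_open)

lemma C1_deriv_compose:
  assumes g: "C1_deriv T g g'" and f: "C1_deriv S f f'" and sub: "f ` S \<subseteq> T"
  shows "C1_deriv S (g \<circ> f) (\<lambda>x. g' (f x) o\<^sub>L f' x)"
  unfolding C1_deriv_def
proof (intro conjI ballI)
  fix x assume "x \<in> S"
  then have "(g has_derivative g' (f x)) (at (f x))" "(f has_derivative f' x) (at x)"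
    using g f sub by (auto simp: C1_deriv_def)
  from diff_chain_at[OF this(2,1)]
  show "(g \<circ> f has_derivative blinfun_apply (g' (f x) o\<^sub>L f' x)) (at x)"
    by (simp add: blinfun_compose.rep_eq)
next
  have "continuous_on S (\<lambda>x. g' (f x))"
    using continuous_on_compose2[OF C1_derivD(2)[OF g] C1_deriv_imp_continuous_on[OF f] sub] .
  then show "continuous_on S (\<lambda>x. g' (f x) o\<^sub>L f' x)"
    using C1_derivD(2)[OF f] by (intro continuous_intros)
qed

section \<open>Estimates over short times\<close>

text \<open>A substitute for Gronwall's inequality over an interval so short that \<open>L * (b - a) \<le> 1/2\<close>. If the
norm of \<open>w\<close> is maximal at \<open>t\<close>, then integrating \<open>w'\<close> from \<open>t0\<close> to \<open>t\<close> bounds this maximum by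
\<open>norm (w t0)\<close>, half of itself, and the contribution of \<open>e\<close>. The finite exceptional set is there for
switching times.\<close>

lemma short_time_bound:
  fixes w :: "real \<Rightarrow> 'a::banach"
  assumes t0: "t0 \<in> {a..b}" and t: "t \<in> {a..b}"
    and cont: "continuous_on {a..b} w" and fin: "finite S"
    and der: "\<And>t. t \<in> {a<..<b} - S \<Longrightarrow> (w has_vector_derivative w' t) (at t)"
    and bound: "\<And>t. t \<in> {a<..<b} - S \<Longrightarrow> norm (w' t) \<le> L * norm (w t) + e"
    and L: "0 \<le> L" and e: "0 \<le> e" and short: "L * (b - a) \<le> 1/2"
  shows "norm (w t) \<le> 2 * norm (w t0) + 2 * (b - a) * e"
proof -
  have "a \<le> b" using t0 by auto
  have "continuous_on {a..b} (\<lambda>t. norm (w t))" using cont by (intro continuous_intros)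
  then obtain tm where tm: "tm \<in> {a..b}" and max: "\<And>t. t \<in> {a..b} \<Longrightarrow> norm (w t) \<le> norm (w tm)"
    using continuous_attains_sup[of "{a..b}" "\<lambda>t. norm (w t)"] t0 by auto
  let ?M = "norm (w tm)"
  have incr: "norm (w q - w p) \<le> (L * ?M + e) * (b - a)" if pq: "a \<le> p" "p \<le> q" "q \<le> b" for p q
  proof -
    have "(w' has_integral (w q - w p)) {p..q}"
      using pq by (intro fundamental_theorem_of_calculus_interior_strong[OF fin])
        (auto intro!: der continuous_on_subset[OF cont])
    moreover have "norm (w' t) \<le> L * ?M + e" if "t \<in> {p..q} - (S \<union> {p,q})" for t
    proof -
      have "t \<in> {a<..<b} - S" "t \<in> {a..b}" using that pq by auto
      then show ?thesis using bound[of t] mult_left_mono[OF max[of t] L] by simp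
    qed
    moreover have nonneg: "0 \<le> L * ?M + e" using L e by simp
    moreover have "finite (S \<union> {p,q})" using fin by simp
    ultimately have "norm (w q - w p) \<le> (L * ?M + e) * measure lborel {p..q}"
      using has_integral_bound_real by blast
    also have "\<dots> \<le> (L * ?M + e) * (b - a)"
      using pq nonneg by (intro mult_left_mono) auto
    finally show ?thesis .
  qed
  have "norm (w tm - w t0) \<le> (L * ?M + e) * (b - a)"
  proof (cases "t0 \<le> tm")
    case True then show ?thesis using incr[of t0 tm] t0 tm by auto
  next
    case False then show ?thesis using incr[of tm t0] t0 tm by (auto simp: norm_minus_commute)
  qed
  also have "\<dots> = (L * (b - a)) * ?M + e * (b - a)" by (simp add: algebra_simps)
  also have "\<dots> \<le> 1/2 * ?M + e * (b - a)" using short by (intro add_right_mono mult_right_mono) auto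
  finally have "?M \<le> norm (w t0) + 1/2 * ?M + e * (b - a)"
    using norm_triangle_ineq[of "w t0" "w tm - w t0"] by simp
  then have "?M \<le> 2 * norm (w t0) + 2 * (b - a) * e" by (simp add: algebra_simps)
  then show ?thesis using max[OF t] by simp
qed

section \<open>Differentiability from near additivity\<close>

text \<open>A condition for differentiability that mentions no candidate for the derivative: linear relations
between small increments are satisfied by the increments of \<open>G\<close>, up to a small relative error.
Three increments suffice to express additivity, homogeneity and the comparison of difference
quotients.\<close>

definition nearly_additive ::
  "('a::real_normed_vector \<Rightarrow> 'b::real_normed_vector) \<Rightarrow> 'a \<Rightarrow> real \<Rightarrow> real \<Rightarrow> bool" where
  "nearly_additive G x \<epsilon> \<rho> \<longleftrightarrow>
    (\<forall>y1\<in>ball x \<rho>. \<forall>z1\<in>ball x \<rho>. \<forall>y2\<in>ball x \<rho>. \<forall>z2\<in>ball x \<rho>. \<forall>y3\<in>ball x \<rho>. \<forall>z3\<in>ball x \<rho>.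
     \<forall>a b c. a *\<^sub>R (y1 - z1) + b *\<^sub>R (y2 - z2) + c *\<^sub>R (y3 - z3) = 0 \<longrightarrow>
       norm (a *\<^sub>R (G y1 - G z1) + b *\<^sub>R (G y2 - G z2) + c *\<^sub>R (G y3 - G z3)) \<le>
       \<epsilon> * (\<bar>a\<bar> * norm (y1 - z1) + \<bar>b\<bar> * norm (y2 - z2) + \<bar>c\<bar> * norm (y3 - z3)))"

lemmas nearly_additiveD = nearly_additive_def[THEN iffD1, rule_format]

text \<open>The derivative in the direction \<open>u\<close> is the limit of the difference quotients along \<open>u / (n + 1)\<close>, which
form a Cauchy sequence because any two of them are in a linear relation. The choice of \<open>V\<close> comes
before that of \<open>\<epsilon>\<close> and \<open>\<rho>\<close>, so that for a family of maps a common \<open>\<rho>\<close> yields a uniform approximation.\<close>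

lemma nearly_additive_imp_strict_derivative:
  fixes G :: "'a::euclidean_space \<Rightarrow> 'b::banach"
  assumes NA: "\<And>\<epsilon>. \<epsilon> > 0 \<Longrightarrow> \<exists>\<rho>>0. nearly_additive G x \<epsilon> \<rho>"
  shows "\<exists>V :: 'a \<Rightarrow>\<^sub>L 'b. \<forall>\<epsilon> \<rho> y z. \<epsilon> > 0 \<longrightarrow> \<rho> > 0 \<longrightarrow> nearly_additive G x \<epsilon> \<rho> \<longrightarrow>
     y \<in> ball x \<rho> \<longrightarrow> z \<in> ball x \<rho> \<longrightarrow> norm (G y - G z - V (y - z)) \<le> 2 * \<epsilon> * norm (y - z)"
proof -
  \<comment> \<open>The points \<open>p u n\<close> tend to \<open>x\<close>, and \<open>q u n\<close> is the difference quotient at \<open>p u n\<close>.\<close>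
  define p where "p u n = x + (1 / real (Suc n)) *\<^sub>R u" for u :: 'a and n
  define q where "q u n = real (Suc n) *\<^sub>R (G (p u n) - G x)" for u n
  have p_lim: "p u \<longlonglongrightarrow> x" for u
  proof -
    have "(\<lambda>n. x + (1 / real (Suc n)) *\<^sub>R u) \<longlonglongrightarrow> x + 0 *\<^sub>R u"
      by (intro tendsto_intros LIMSEQ_Suc lim_1_over_n)
    then show ?thesis unfolding p_def by simp
  qed
  have p_ev: "\<forall>\<^sub>F n in sequentially. p u n \<in> ball x \<rho>" if "\<rho> > 0" for u \<rho>
    using tendstoD[OF p_lim that, of u] by (simp add: dist_commute)
  have px: "real (Suc n) *\<^sub>R (p u n - x) = u" for u n
    unfolding p_def by (simp del: of_nat_Suc)
  have npx: "real (Suc n) * norm (p u n - x) = norm u" for u n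
    using px[of n u] by (metis abs_of_nat norm_scaleR)
  have cauchy: "Cauchy (q u)" for u
  proof (rule CauchyI)
    fix e :: real assume "e > 0"
    define \<epsilon> where "\<epsilon> = e / (2 * norm u + 1)"
    have "2 * norm u + 1 > 0" by (simp add: add_nonneg_pos)
    then have "\<epsilon> > 0" "\<epsilon> * (2 * norm u) < e"
      using \<open>e > 0\<close> by (auto simp: \<epsilon>_def field_simps)
    obtain \<rho> where \<rho>: "\<rho> > 0" "nearly_additive G x \<epsilon> \<rho>" using NA[OF \<open>\<epsilon> > 0\<close>] by auto
    obtain N where N: "\<And>n. n \<ge> N \<Longrightarrow> p u n \<in> ball x \<rho>"
      using p_ev[OF \<rho>(1)] unfolding eventually_sequentially by blast
    have "norm (q u m - q u n) < e" if "m \<ge> N" "n \<ge> N" for m n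
    proof -
      have x: "x \<in> ball x \<rho>" using \<rho> by simp
      have "norm (real (Suc m) *\<^sub>R (G (p u m) - G x) + (- real (Suc n)) *\<^sub>R (G (p u n) - G x) + 0 *\<^sub>R (G x - G x))
        \<le> \<epsilon> * (\<bar>real (Suc m)\<bar> * norm (p u m - x) + \<bar>- real (Suc n)\<bar> * norm (p u n - x) + \<bar>0\<bar> * norm (x - x))"
        using N that x
        by (intro nearly_additiveD[OF \<rho>(2)]) (auto simp: px scaleR_minus_left simp del: of_nat_Suc)
      then have "norm (q u m - q u n) \<le> \<epsilon> * (2 * norm u)"
        by (simp add: q_def npx del: of_nat_Suc)
      then show ?thesis using \<open>\<epsilon> * (2 * norm u) < e\<close> by simp
    qed
    then show "\<exists>M. \<forall>m\<ge>M. \<forall>n\<ge>M. norm (q u m - q u n) < e" by blast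
  qed
  define V where "V u = lim (q u)" for u
  have V: "q u \<longlonglongrightarrow> V u" for u
    using Cauchy_convergent[OF cauchy] unfolding V_def convergent_LIMSEQ_iff .
  have lin_comb: "a *\<^sub>R V u + b *\<^sub>R V v + c *\<^sub>R V w = 0" if rel: "a *\<^sub>R u + b *\<^sub>R v + c *\<^sub>R w = 0"
    for a b c u v w
  proof -
    let ?C = "\<bar>a\<bar> * norm u + \<bar>b\<bar> * norm v + \<bar>c\<bar> * norm w"
    have lim: "(\<lambda>n. norm (a *\<^sub>R q u n + b *\<^sub>R q v n + c *\<^sub>R q w n)) \<longlonglongrightarrow>
       norm (a *\<^sub>R V u + b *\<^sub>R V v + c *\<^sub>R V w)"
      by (intro tendsto_intros V)
    have le: "norm (a *\<^sub>R V u + b *\<^sub>R V v + c *\<^sub>R V w) \<le> \<epsilon> * ?C" if "\<epsilon> > 0" for \<epsilon>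
    proof -
      obtain \<rho> where \<rho>: "\<rho> > 0" "nearly_additive G x \<epsilon> \<rho>" using NA[OF \<open>\<epsilon> > 0\<close>] by auto
      have "\<forall>\<^sub>F n in sequentially. norm (a *\<^sub>R q u n + b *\<^sub>R q v n + c *\<^sub>R q w n) \<le> \<epsilon> * ?C"
        using p_ev[OF \<rho>(1), of u] p_ev[OF \<rho>(1), of v] p_ev[OF \<rho>(1), of w]
      proof eventually_elim
        case (elim n)
        have x: "x \<in> ball x \<rho>" using \<rho> by simp
        have rel': "(a * real (Suc n)) *\<^sub>R (p u n - x) + (b * real (Suc n)) *\<^sub>R (p v n - x) +
            (c * real (Suc n)) *\<^sub>R (p w n - x) = 0"
          using rel by (simp only: scaleR_scaleR[symmetric] px)
        have np: "\<bar>r * real (Suc n)\<bar> * norm (p u' n - x) = \<bar>r\<bar> * norm u'" for r u'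
          using npx[of n u'] by (simp add: abs_mult mult.assoc del: of_nat_Suc)
        show ?case
          using nearly_additiveD[OF \<rho>(2) elim(1) x elim(2) x elim(3) x rel'] 
          unfolding q_def np scaleR_scaleR .
      qed
      then show ?thesis using tendsto_upperbound[OF lim] by simp
    qed
    have "((\<lambda>\<epsilon>. \<epsilon> * ?C) \<longlongrightarrow> 0 * ?C) (at_right (0::real))"
      by (intro tendsto_intros)
    moreover have "\<forall>\<^sub>F \<epsilon> in at_right (0::real). norm (a *\<^sub>R V u + b *\<^sub>R V v + c *\<^sub>R V w) \<le> \<epsilon> * ?C"
      using le by (auto simp: eventually_at_right_field intro: exI[of _ 1])
    ultimately have "norm (a *\<^sub>R V u + b *\<^sub>R V v + c *\<^sub>R V w) \<le> 0 * ?C"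
      by (rule tendsto_lowerbound) simp
    then show ?thesis by simp
  qed
  have "linear V"
  proof (rule linearI)
    fix u v show "V (u + v) = V u + V v"
      using lin_comb[of "-1" "u + v" 1 u 1 v] by (simp add: algebra_simps)
  next
    fix r u show "V (r *\<^sub>R u) = r *\<^sub>R V u"
      using lin_comb[of "-1" "r *\<^sub>R u" r u 0 0] by simp
  qed
  then have bl: "bounded_linear V" by (simp add: linear_linear)
  show ?thesis
  proof (intro exI[of _ "Blinfun V"] allI impI)
    fix \<epsilon> \<rho> y z
    assume \<rho>: "\<epsilon> > 0" "\<rho> > 0" "nearly_additive G x \<epsilon> \<rho>" and yz: "y \<in> ball x \<rho>" "z \<in> ball x \<rho>"
    have lim: "(\<lambda>n. norm (G y - G z - q (y - z) n)) \<longlonglongrightarrow> norm (G y - G z - V (y - z))"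
      by (intro tendsto_intros V)
    have "\<forall>\<^sub>F n in sequentially. norm (G y - G z - q (y - z) n) \<le> 2 * \<epsilon> * norm (y - z)"
      using p_ev[OF \<rho>(2), of "y - z"]
    proof eventually_elim
      case (elim n)
      have x: "x \<in> ball x \<rho>" using \<rho> by simp
      have "1 *\<^sub>R (y - z) + (- real (Suc n)) *\<^sub>R (p (y - z) n - x) + 0 *\<^sub>R (x - x) = 0"
        by (simp add: px scaleR_minus_left del: of_nat_Suc)
      from nearly_additiveD[OF \<rho>(3) yz elim x x x this]
      show ?case by (simp add: npx q_def scaleR_minus_left del: of_nat_Suc)
    qed
    then have "norm (G y - G z - V (y - z)) \<le> 2 * \<epsilon> * norm (y - z)"
      using tendsto_upperbound[OF lim] by simp
    then show "norm (G y - G z - blinfun_apply (Blinfun V) (y - z)) \<le> 2 * \<epsilon> * norm (y - z)"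
      by (simp add: bounded_linear_Blinfun_apply[OF bl])
  qed
qed

text \<open>On a compact convex set the derivative is uniformly continuous, so a single \<open>\<eta>\<close> serves all base
points \<open>c\<close>. The mean value inequality is applied to \<open>f\<close> minus its linear part at \<open>c\<close>.\<close>

lemma C1_uniform_linearization:
  fixes f :: "'a::euclidean_space \<Rightarrow> 'b::real_normed_vector"
  assumes f: "C1_deriv W f f'" and K: "compact K" "convex K" "K \<subseteq> W" and "e > 0"
  obtains \<eta> where "\<eta> > 0" "\<And>a b c. a \<in> K \<Longrightarrow> b \<in> K \<Longrightarrow> c \<in> K \<Longrightarrow> norm (a - c) < \<eta> \<Longrightarrow> norm (b - c) < \<eta> \<Longrightarrow>
    norm (f a - f b - f' c (a - b)) \<le> e * norm (a - b)"
proof -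
  have "uniformly_continuous_on K f'"
    using compact_uniformly_continuous C1_derivD(2)[OF f] K continuous_on_subset by blast
  then obtain \<eta> where \<eta>: "\<eta> > 0" "\<And>x y. x \<in> K \<Longrightarrow> y \<in> K \<Longrightarrow> dist x y < \<eta> \<Longrightarrow> dist (f' x) (f' y) < e"
    unfolding uniformly_continuous_on_def using \<open>e > 0\<close> by meson
  show ?thesis
  proof (rule that[OF \<eta>(1)])
    fix a b c assume abc: "a \<in> K" "b \<in> K" "c \<in> K" "norm (a - c) < \<eta>" "norm (b - c) < \<eta>"
    let ?S = "K \<inter> ball c \<eta>"
    have "norm ((f a - f' c a) - (f b - f' c b)) \<le> e * norm (a - b)"
    proof (rule differentiable_bound[where S = ?S and f' = "\<lambda>x. blinfun_apply (f' x - f' c)"])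
      show "convex ?S" using K by (intro convex_Int) auto
      show "a \<in> ?S" "b \<in> ?S" using abc by (auto simp: dist_norm norm_minus_commute)
      fix x assume x: "x \<in> ?S"
      then have "(f has_derivative f' x) (at x within ?S)"
        using C1_derivD(1)[OF f] K by (meson Int_iff has_derivative_at_withinI subset_iff)
      then show "((\<lambda>x. f x - f' c x) has_derivative blinfun_apply (f' x - f' c)) (at x within ?S)"
        by (auto intro!: derivative_eq_intros simp: blinfun.diff_left)
      have "norm (f' x - f' c) \<le> e"
        using \<eta>(2)[of x c] x abc by (auto simp: dist_norm norm_minus_commute)
      then show "onorm (blinfun_apply (f' x - f' c)) \<le> e"
        by (simp add: norm_blinfun.rep_eq)
    qed
    then show "norm (f a - f b - f' c (a - b)) \<le> e * norm (a - b)"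
      by (simp add: blinfun.diff_right algebra_simps)
  qed
qed

lemma C1_lipschitz_on_convex:
  assumes f: "C1_deriv W f f'" and K: "convex K" "K \<subseteq> W" and L: "\<And>y. y \<in> K \<Longrightarrow> norm (f' y) \<le> L"
    and ab: "a \<in> K" "b \<in> K"
  shows "norm (f a - f b) \<le> L * norm (a - b)"
proof (rule differentiable_bound[where S = K and f' = "\<lambda>x. blinfun_apply (f' x)"])
  fix x assume x: "x \<in> K"
  then show "(f has_derivative blinfun_apply (f' x)) (at x within K)"
    using C1_derivD(1)[OF f] K by (meson has_derivative_at_withinI subset_iff)
  show "onorm (blinfun_apply (f' x)) \<le> L" using L[OF x] by (simp add: norm_blinfun.rep_eq)
qed (use K ab in auto)

lemma norm_blinfun_le_if_near_0:
  fixes A :: "'a::real_normed_vector \<Rightarrow>\<^sub>L 'b::real_normed_vector"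
  assumes "C \<ge> 0"
    and le: "\<And>e. e > 0 \<Longrightarrow> \<exists>\<rho>>0. \<forall>u. norm u < \<rho> \<longrightarrow> norm (A u) \<le> (C + e) * norm u"
  shows "norm A \<le> C"
proof (rule norm_blinfun_bound[OF \<open>C \<ge> 0\<close>])
  fix u
  have bound: "norm (A u) \<le> (C + e) * norm u" if pos: "e > 0" for e
  proof -
    obtain \<rho> where \<rho>: "\<rho> > 0" "\<And>u. norm u < \<rho> \<Longrightarrow> norm (A u) \<le> (C + e) * norm u"
      using le[OF pos] by blast
    define s where "s = \<rho> / (norm u + 1)"
    have "norm u + 1 > 0" by (simp add: add_nonneg_pos)
    then have s: "s > 0" "s * norm u < \<rho>" using \<rho> by (auto simp: s_def field_simps)
    have "norm (A (s *\<^sub>R u)) \<le> (C + e) * norm (s *\<^sub>R u)" using s by (intro \<rho>) simp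
    then have "s * norm (A u) \<le> s * ((C + e) * norm u)"
      using s by (simp add: blinfun.scaleR_right mult.left_commute)
    then show ?thesis using s by (simp add: mult_le_cancel_left_pos)
  qed
  have "((\<lambda>e. (C + e) * norm u) \<longlongrightarrow> (C + 0) * norm u) (at_right (0::real))"
    by (intro tendsto_intros)
  moreover have "\<forall>\<^sub>F e in at_right (0::real). norm (A u) \<le> (C + e) * norm u"
    using bound by (auto simp: eventually_at_right_field intro: exI[of _ 1])
  ultimately have "norm (A u) \<le> (C + 0) * norm u"
    by (rule tendsto_lowerbound) simp
  then show "norm (A u) \<le> C * norm u" by simp
qed

section \<open>Differentiable dependence on the initial value\<close>

text \<open>Solutions \<open>\<phi> t x\<close> of the autonomous equation with right-hand side \<open>f\<close>, for initial values \<open>x\<close> in \<open>B\<close>,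
that remain in the compact convex set \<open>K\<close> up to the time \<open>T\<close>. The bound on \<open>L * T\<close> makes the estimate
over short times applicable on both sides of 0.\<close>

locale short_flow =
  fixes W K B :: "'a::euclidean_space set" and f f' and \<phi> :: "real \<Rightarrow> 'a \<Rightarrow> 'a" and L T :: real
  assumes f: "C1_deriv W f f'" and K: "compact K" "convex K" "K \<subseteq> W"
    and B: "open B" and T: "T > 0"
    and L: "\<And>y. y \<in> K \<Longrightarrow> norm (f' y) \<le> L" "L \<ge> 0" and short: "L * T \<le> 1/2"
    and \<phi>_in: "\<And>x t. x \<in> B \<Longrightarrow> \<bar>t\<bar> < T \<Longrightarrow> \<phi> t x \<in> K"
    and \<phi>_0: "\<And>x. x \<in> B \<Longrightarrow> \<phi> 0 x = x"
    and \<phi>_der: "\<And>x t. x \<in> B \<Longrightarrow> \<bar>t\<bar> < T \<Longrightarrow> ((\<lambda>s. \<phi> s x) has_vector_derivative f (\<phi> t x)) (at t)"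
begin

lemma bound_from_0:
  fixes w :: "real \<Rightarrow> 'b::banach"
  assumes der: "\<And>t. \<bar>t\<bar> < T \<Longrightarrow> (w has_vector_derivative w' t) (at t)"
    and bound: "\<And>t. \<bar>t\<bar> < T \<Longrightarrow> norm (w' t) \<le> L * norm (w t) + e"
    and "e \<ge> 0" "\<bar>t\<bar> < T"
  shows "norm (w t) \<le> 2 * norm (w 0) + 2 * T * e"
proof -
  let ?a = "min 0 t" and ?b = "max 0 t"
  have ab: "?b - ?a = \<bar>t\<bar>" by (auto simp: min_def max_def)
  have sub: "\<bar>s\<bar> < T" if "s \<in> {?a..?b}" for s using that \<open>\<bar>t\<bar> < T\<close> by (auto simp: min_def max_def split: if_splits)
  have "continuous_on {?a..?b} w"
    using sub der by (meson continuous_at_imp_continuous_on has_vector_derivative_continuous)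
  moreover have "L * (?b - ?a) \<le> 1/2"
    unfolding ab using mult_left_mono[of "\<bar>t\<bar>" T L] L(2) short \<open>\<bar>t\<bar> < T\<close> by linarith
  ultimately have "norm (w t) \<le> 2 * norm (w 0) + 2 * (?b - ?a) * e"
    using L(2) \<open>e \<ge> 0\<close> sub
    by (intro short_time_bound[where S = "{}" and L = L and w' = w']) (auto intro!: der bound)
  moreover have "2 * (?b - ?a) * e \<le> 2 * T * e" unfolding ab using assms by (intro mult_right_mono) auto
  ultimately show ?thesis by linarith
qed

lemma f_lipschitz: "a \<in> K \<Longrightarrow> b \<in> K \<Longrightarrow> norm (f a - f b) \<le> L * norm (a - b)"
  using C1_lipschitz_on_convex[OF f K(2,3)] L by blast

lemma \<phi>_lipschitz:
  assumes "x \<in> B" "y \<in> B" "\<bar>t\<bar> < T"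
  shows "norm (\<phi> t x - \<phi> t y) \<le> 2 * norm (x - y)"
proof -
  have "norm (\<phi> t x - \<phi> t y) \<le> 2 * norm (\<phi> 0 x - \<phi> 0 y) + 2 * T * 0"
    using assms f_lipschitz \<phi>_in
    by (intro bound_from_0[where w = "\<lambda>t. \<phi> t x - \<phi> t y" and w' = "\<lambda>t. f (\<phi> t x) - f (\<phi> t y)"])
      (auto intro!: has_vector_derivative_diff \<phi>_der)
  then show ?thesis using \<phi>_0 assms by simp
qed

text \<open>A linear combination \<open>w\<close> of differences of solutions satisfies \<open>w' = f' (\<phi> t x) w\<close> up to an error that
is small relative to the increments, as \<open>f\<close> is differentiable uniformly on \<open>K\<close>. If the increments
satisfy the linear relation initially, then \<open>w 0 = 0\<close> and \<open>w\<close> stays small. The radius does not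
depend on the time.\<close>

lemma \<phi>_nearly_additive:
  assumes x: "x \<in> B" and "e > 0"
  shows "\<exists>\<rho>>0. ball x \<rho> \<subseteq> B \<and> (\<forall>t. \<bar>t\<bar> < T \<longrightarrow> nearly_additive (\<phi> t) x e \<rho>)"
proof -
  \<comment> \<open>The error \<open>2 * e'\<close> in the linear equation is multiplied by \<open>2 * T\<close> in the estimate over short times.\<close>
  define e' where "e' = e / (4 * T)"
  have "e' > 0" using \<open>e > 0\<close> T by (simp add: e'_def)
  obtain \<eta> where \<eta>: "\<eta> > 0" "\<And>a b c. a \<in> K \<Longrightarrow> b \<in> K \<Longrightarrow> c \<in> K \<Longrightarrow> norm (a - c) < \<eta> \<Longrightarrow> norm (b - c) < \<eta> \<Longrightarrow>
      norm (f a - f b - f' c (a - b)) \<le> e' * norm (a - b)"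
    using C1_uniform_linearization[OF f K \<open>e' > 0\<close>] by blast
  obtain \<rho>0 where \<rho>0: "\<rho>0 > 0" "ball x \<rho>0 \<subseteq> B" using B x open_contains_ball by blast
  define \<rho> where "\<rho> = min \<rho>0 (\<eta>/2)"
  have \<rho>: "\<rho> > 0" "ball x \<rho> \<subseteq> B" using \<rho>0 \<eta> by (auto simp: \<rho>_def)
  have lin: "norm (f (\<phi> t y) - f (\<phi> t z) - f' (\<phi> t x) (\<phi> t y - \<phi> t z)) \<le> 2 * e' * norm (y - z)"
    if yz: "y \<in> ball x \<rho>" "z \<in> ball x \<rho>" and t: "\<bar>t\<bar> < T" for y z t
  proof -
    have B': "y \<in> B" "z \<in> B" using yz \<rho> by auto
    have near: "norm (\<phi> t v - \<phi> t x) < \<eta>" if "v \<in> ball x \<rho>" for v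
    proof -
      have "v \<in> B" using that \<rho> by auto
      then have "norm (\<phi> t v - \<phi> t x) \<le> 2 * norm (v - x)" using \<phi>_lipschitz x t by blast
      moreover have "norm (v - x) < \<eta>/2" using that by (auto simp: \<rho>_def dist_norm norm_minus_commute)
      ultimately show ?thesis by linarith
    qed
    have "norm (f (\<phi> t y) - f (\<phi> t z) - f' (\<phi> t x) (\<phi> t y - \<phi> t z)) \<le> e' * norm (\<phi> t y - \<phi> t z)"
      using yz B' x t by (intro \<eta>) (auto intro: \<phi>_in near)
    also have "\<dots> \<le> e' * (2 * norm (y - z))"
      using \<phi>_lipschitz[OF B' t] \<open>e' > 0\<close> by (intro mult_left_mono) auto
    finally show ?thesis by simp
  qed
  show ?thesis
  proof (intro exI[of _ \<rho>] conjI allI impI \<rho>)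
    fix t assume t: "\<bar>t\<bar> < T"
    show "nearly_additive (\<phi> t) x e \<rho>"
      unfolding nearly_additive_def
    proof (intro ballI allI impI)
      fix y1 z1 y2 z2 y3 z3 a b c
      assume in_ball: "y1 \<in> ball x \<rho>" "z1 \<in> ball x \<rho>" "y2 \<in> ball x \<rho>" "z2 \<in> ball x \<rho>" "y3 \<in> ball x \<rho>" "z3 \<in> ball x \<rho>"
        and rel: "a *\<^sub>R (y1 - z1) + b *\<^sub>R (y2 - z2) + c *\<^sub>R (y3 - z3) = 0"
      have in_B: "y1 \<in> B" "z1 \<in> B" "y2 \<in> B" "z2 \<in> B" "y3 \<in> B" "z3 \<in> B" using in_ball \<rho> by auto
      let ?S = "\<bar>a\<bar> * norm (y1 - z1) + \<bar>b\<bar> * norm (y2 - z2) + \<bar>c\<bar> * norm (y3 - z3)"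
      define w where "w t = a *\<^sub>R (\<phi> t y1 - \<phi> t z1) + b *\<^sub>R (\<phi> t y2 - \<phi> t z2) + c *\<^sub>R (\<phi> t y3 - \<phi> t z3)" for t
      define w' where "w' t = a *\<^sub>R (f (\<phi> t y1) - f (\<phi> t z1)) + b *\<^sub>R (f (\<phi> t y2) - f (\<phi> t z2)) +
        c *\<^sub>R (f (\<phi> t y3) - f (\<phi> t z3))" for t
      have "norm (w t) \<le> 2 * norm (w 0) + 2 * T * (2 * e' * ?S)"
      proof (rule bound_from_0[OF _ _ _ t])
        fix t assume t: "\<bar>t\<bar> < T"
        show "(w has_vector_derivative w' t) (at t)"
          unfolding w_def w'_def using in_B t
          by (intro has_vector_derivative_add has_vector_derivative_diff
              bounded_linear.has_vector_derivative[OF bounded_linear_scaleR_right] \<phi>_der)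
        define r where "r y z = f (\<phi> t y) - f (\<phi> t z) - f' (\<phi> t x) (\<phi> t y - \<phi> t z)" for y z
        have r: "norm (k *\<^sub>R r y z) \<le> 2 * e' * (\<bar>k\<bar> * norm (y - z))" if "y \<in> ball x \<rho>" "z \<in> ball x \<rho>" for k y z
          using mult_left_mono[OF lin[OF that t], of "\<bar>k\<bar>"] unfolding r_def by (simp add: mult_ac)
        have w': "w' t = f' (\<phi> t x) (w t) + (a *\<^sub>R r y1 z1 + b *\<^sub>R r y2 z2 + c *\<^sub>R r y3 z3)"
          unfolding w'_def w_def r_def
          by (simp add: blinfun.diff_right blinfun.add_right blinfun.scaleR_right algebra_simps)
        have "norm (f' (\<phi> t x) (w t)) \<le> L * norm (w t)"
          using norm_blinfun[of "f' (\<phi> t x)" "w t"] mult_right_mono[OF L(1)[OF \<phi>_in[OF x t]], of "norm (w t)"]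
          by simp
        moreover have "norm (a *\<^sub>R r y1 z1 + b *\<^sub>R r y2 z2 + c *\<^sub>R r y3 z3) \<le> 2 * e' * ?S"
        proof -
          have "norm (a *\<^sub>R r y1 z1 + b *\<^sub>R r y2 z2 + c *\<^sub>R r y3 z3)
            \<le> norm (a *\<^sub>R r y1 z1) + norm (b *\<^sub>R r y2 z2) + norm (c *\<^sub>R r y3 z3)"
            by (meson norm_triangle_mono order_refl)
          then show ?thesis
            using r[OF in_ball(1,2), of a] r[OF in_ball(3,4), of b] r[OF in_ball(5,6), of c]
            unfolding distrib_left by linarith
        qed
        ultimately show "norm (w' t) \<le> L * norm (w t) + 2 * e' * ?S"
          unfolding w' by (rule norm_triangle_mono)
      next
        show "0 \<le> 2 * e' * ?S" using \<open>e' > 0\<close> by simp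
      qed
      moreover have "w 0 = 0" unfolding w_def using rel in_B by (simp add: \<phi>_0)
      moreover have "2 * T * (2 * e' * ?S) = e * ?S" using T by (simp add: e'_def)
      ultimately show "norm (a *\<^sub>R (\<phi> t y1 - \<phi> t z1) + b *\<^sub>R (\<phi> t y2 - \<phi> t z2) + c *\<^sub>R (\<phi> t y3 - \<phi> t z3)) \<le> e * ?S"
        unfolding w_def by simp
    qed
  qed
qed

definition D\<phi> :: "real \<Rightarrow> 'a \<Rightarrow> 'a \<Rightarrow>\<^sub>L 'a" where
  "D\<phi> t x = (SOME V. \<forall>e \<rho> y z. e > 0 \<longrightarrow> \<rho> > 0 \<longrightarrow> nearly_additive (\<phi> t) x e \<rho> \<longrightarrow>
     y \<in> ball x \<rho> \<longrightarrow> z \<in> ball x \<rho> \<longrightarrow>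
     norm (\<phi> t y - \<phi> t z - blinfun_apply V (y - z)) \<le> 2 * e * norm (y - z))"

lemma D\<phi>_nearly_additive:
  assumes "x \<in> B" "\<bar>t\<bar> < T" "e > 0" "\<rho> > 0" "nearly_additive (\<phi> t) x e \<rho>" "y \<in> ball x \<rho>" "z \<in> ball x \<rho>"
  shows "norm (\<phi> t y - \<phi> t z - D\<phi> t x (y - z)) \<le> 2 * e * norm (y - z)"
proof -
  have "\<exists>\<rho>>0. nearly_additive (\<phi> t) x e \<rho>" if "e > 0" for e
    using \<phi>_nearly_additive[OF assms(1) that] assms(2) by blast
  from someI_ex[OF nearly_additive_imp_strict_derivative[OF this]]
  have "\<forall>e \<rho> y z. e > 0 \<longrightarrow> \<rho> > 0 \<longrightarrow> nearly_additive (\<phi> t) x e \<rho> \<longrightarrow>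
     y \<in> ball x \<rho> \<longrightarrow> z \<in> ball x \<rho> \<longrightarrow>
     norm (\<phi> t y - \<phi> t z - blinfun_apply (D\<phi> t x) (y - z)) \<le> 2 * e * norm (y - z)"
    unfolding D\<phi>_def .
  from this[rule_format, OF assms(3-7)] show ?thesis .
qed

lemma D\<phi>_strict:
  assumes "x \<in> B" "e > 0"
  shows "\<exists>\<rho>>0. ball x \<rho> \<subseteq> B \<and> (\<forall>t y z. \<bar>t\<bar> < T \<longrightarrow> y \<in> ball x \<rho> \<longrightarrow> z \<in> ball x \<rho> \<longrightarrow>
      norm (\<phi> t y - \<phi> t z - D\<phi> t x (y - z)) \<le> e * norm (y - z))"
proof -
  have "e/2 > 0" using assms by simp
  obtain \<rho> where \<rho>: "\<rho> > 0" "ball x \<rho> \<subseteq> B" "\<And>t. \<bar>t\<bar> < T \<Longrightarrow> nearly_additive (\<phi> t) x (e/2) \<rho>"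
    using \<phi>_nearly_additive[OF assms(1) \<open>e/2 > 0\<close>] by blast
  show ?thesis
  proof (intro exI[of _ \<rho>] conjI allI impI \<rho>(1,2))
    fix t y z assume *: "\<bar>t\<bar> < T" "y \<in> ball x \<rho>" "z \<in> ball x \<rho>"
    have "norm (\<phi> t y - \<phi> t z - D\<phi> t x (y - z)) \<le> 2 * (e/2) * norm (y - z)"
      by (rule D\<phi>_nearly_additive[OF assms(1) *(1) \<open>e/2 > 0\<close> \<rho>(1) \<rho>(3)[OF *(1)] *(2,3)])
    then show "norm (\<phi> t y - \<phi> t z - D\<phi> t x (y - z)) \<le> e * norm (y - z)"
      by simp
  qed
qed

lemma D\<phi>_has_derivative:
  assumes "x \<in> B" "\<bar>t\<bar> < T"
  shows "(\<phi> t has_derivative D\<phi> t x) (at x)"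
  unfolding has_derivative_at_alt
proof (intro conjI allI impI)
  fix e :: real assume "e > 0"
  obtain \<rho> where \<rho>: "\<rho> > 0" "ball x \<rho> \<subseteq> B"
    "\<And>t y z. \<bar>t\<bar> < T \<Longrightarrow> y \<in> ball x \<rho> \<Longrightarrow> z \<in> ball x \<rho> \<Longrightarrow>
      norm (\<phi> t y - \<phi> t z - D\<phi> t x (y - z)) \<le> e * norm (y - z)"
    using D\<phi>_strict[OF assms(1) \<open>e > 0\<close>] by blast
  then show "\<exists>d>0. \<forall>y. norm (y - x) < d \<longrightarrow> norm (\<phi> t y - \<phi> t x - D\<phi> t x (y - x)) \<le> e * norm (y - x)"
    using assms(2) by (intro exI[of _ \<rho>]) (auto simp: dist_norm norm_minus_commute)
qed (rule blinfun.bounded_linear_right)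

lemma D\<phi>_near:
  assumes "x0 \<in> B" "e > 0"
  shows "\<exists>\<rho>>0. ball x0 \<rho> \<subseteq> B \<and> (\<forall>t x. \<bar>t\<bar> < T \<longrightarrow> x \<in> ball x0 \<rho> \<longrightarrow> norm (D\<phi> t x - D\<phi> t x0) \<le> e)"
proof -
  obtain \<rho> where \<rho>: "\<rho> > 0" "ball x0 \<rho> \<subseteq> B"
    "\<And>t y z. \<bar>t\<bar> < T \<Longrightarrow> y \<in> ball x0 \<rho> \<Longrightarrow> z \<in> ball x0 \<rho> \<Longrightarrow>
      norm (\<phi> t y - \<phi> t z - D\<phi> t x0 (y - z)) \<le> e * norm (y - z)"
    using D\<phi>_strict[OF assms] by blast
  show ?thesis
  proof (intro exI[of _ \<rho>] conjI allI impI \<rho>(1,2))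
    fix t x assume t: "\<bar>t\<bar> < T" and x: "x \<in> ball x0 \<rho>"
    then have "x \<in> B" using \<rho> by auto
    show "norm (D\<phi> t x - D\<phi> t x0) \<le> e"
    proof (rule norm_blinfun_le_if_near_0)
      fix e' :: real assume "e' > 0"
      obtain \<rho>' where \<rho>': "\<rho>' > 0" "ball x \<rho>' \<subseteq> B"
        "\<And>t y z. \<bar>t\<bar> < T \<Longrightarrow> y \<in> ball x \<rho>' \<Longrightarrow> z \<in> ball x \<rho>' \<Longrightarrow> norm (\<phi> t y - \<phi> t z - D\<phi> t x (y - z)) \<le> e' * norm (y - z)"
        using D\<phi>_strict[OF \<open>x \<in> B\<close> \<open>e' > 0\<close>] by blast
      obtain r where r: "r > 0" "ball x r \<subseteq> ball x0 \<rho>" using x open_contains_ball[of "ball x0 \<rho>"] by (meson open_ball)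
      have "norm ((D\<phi> t x - D\<phi> t x0) u) \<le> (e + e') * norm u" if u: "norm u < min r \<rho>'" for u
      proof -
        have in_r: "x + u \<in> ball x r" using u by (simp add: dist_norm)
        have "x + u \<in> ball x0 \<rho>" "x \<in> ball x0 \<rho>" using in_r r x by blast+
        from \<rho>(3)[OF t this] have 1: "norm (\<phi> t (x + u) - \<phi> t x - D\<phi> t x0 u) \<le> e * norm u" by simp
        have 2: "norm (\<phi> t (x + u) - \<phi> t x - D\<phi> t x u) \<le> e' * norm u"
          using \<rho>'(3)[OF t, of "x + u" x] \<rho>'(1) u by (simp add: dist_norm)
        have "(D\<phi> t x - D\<phi> t x0) u = (\<phi> t (x + u) - \<phi> t x - D\<phi> t x0 u) - (\<phi> t (x + u) - \<phi> t x - D\<phi> t x u)"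
          by (simp add: blinfun.diff_left)
        then show ?thesis using 1 2 norm_triangle_ineq4[of "\<phi> t (x + u) - \<phi> t x - D\<phi> t x0 u" "\<phi> t (x + u) - \<phi> t x - D\<phi> t x u"]
          by (simp add: distrib_right)
      qed
      then show "\<exists>\<rho>>0. \<forall>u. norm u < \<rho> \<longrightarrow> norm ((D\<phi> t x - D\<phi> t x0) u) \<le> (e + e') * norm u"
        using r \<rho>' by (intro exI[of _ "min r \<rho>'"]) auto
    qed (use assms in simp)
  qed
qed

text \<open>The increment \<open>\<phi> t (x + u) - \<phi> t x\<close> changes with \<open>t\<close> at a speed of at most \<open>2 * L * norm u\<close>, and the
derivative inherits this bound from the increments that it approximates.\<close>

lemma D\<phi>_lipschitz_time:
  assumes x: "x \<in> B" and t: "\<bar>t\<bar> < T" and s: "\<bar>s\<bar> < T"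
  shows "norm (D\<phi> t x - D\<phi> s x) \<le> 2 * L * \<bar>t - s\<bar>"
proof (rule norm_blinfun_le_if_near_0)
  fix e :: real assume "e > 0"
  then have "e/2 > 0" by simp
  obtain \<rho> where \<rho>: "\<rho> > 0" "ball x \<rho> \<subseteq> B"
    "\<And>t y z. \<bar>t\<bar> < T \<Longrightarrow> y \<in> ball x \<rho> \<Longrightarrow> z \<in> ball x \<rho> \<Longrightarrow>
      norm (\<phi> t y - \<phi> t z - D\<phi> t x (y - z)) \<le> e/2 * norm (y - z)"
    using D\<phi>_strict[OF x \<open>e/2 > 0\<close>] by blast
  have "norm ((D\<phi> t x - D\<phi> s x) u) \<le> (2 * L * \<bar>t - s\<bar> + e) * norm u" if u: "norm u < \<rho>" for u
  proof -
    have xu: "x + u \<in> ball x \<rho>" "x \<in> ball x \<rho>" using u \<rho> by (auto simp: dist_norm)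
    then have xuB: "x + u \<in> B" using \<rho> by auto
    define w where "w t = \<phi> t (x + u) - \<phi> t x" for t
    have "norm (w t - w s) \<le> (L * (2 * norm u)) * norm (t - s)"
    proof (rule differentiable_bound[where S = "{-T<..<T}" and f' = "\<lambda>t h. h *\<^sub>R (f (\<phi> t (x + u)) - f (\<phi> t x))"])
      fix r assume "r \<in> {-T<..<T}"
      then have r: "\<bar>r\<bar> < T" by auto
      have "(w has_vector_derivative (f (\<phi> r (x + u)) - f (\<phi> r x))) (at r)"
        unfolding w_def using x xuB r by (intro has_vector_derivative_diff \<phi>_der)
      then show "(w has_derivative (\<lambda>h. h *\<^sub>R (f (\<phi> r (x + u)) - f (\<phi> r x)))) (at r within {-T<..<T})"
        unfolding has_vector_derivative_def by (rule has_derivative_at_withinI)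
      have "norm (f (\<phi> r (x + u)) - f (\<phi> r x)) \<le> L * norm (\<phi> r (x + u) - \<phi> r x)"
        using x xuB r by (intro f_lipschitz \<phi>_in)
      also have "\<dots> \<le> L * (2 * norm u)"
        using \<phi>_lipschitz[OF xuB x r] L(2) by (intro mult_left_mono) auto
      finally have "norm (f (\<phi> r (x + u)) - f (\<phi> r x)) \<le> L * (2 * norm u)" .
      then show "onorm (\<lambda>h. h *\<^sub>R (f (\<phi> r (x + u)) - f (\<phi> r x))) \<le> L * (2 * norm u)"
        using L(2) by (intro onorm_bound) (auto simp: mult.commute intro: mult_left_mono)
    qed (use t s in auto)
    then have w: "norm (w t - w s) \<le> 2 * L * \<bar>t - s\<bar> * norm u" by (simp add: mult_ac)
    have 1: "norm (w t - D\<phi> t x u) \<le> e/2 * norm u" using \<rho>(3)[OF t xu] by (simp add: w_def)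
    have 2: "norm (w s - D\<phi> s x u) \<le> e/2 * norm u" using \<rho>(3)[OF s xu] by (simp add: w_def)
    have "(D\<phi> t x - D\<phi> s x) u = (w t - w s) - (w t - D\<phi> t x u) + (w s - D\<phi> s x u)"
      by (simp add: blinfun.diff_left)
    also have "norm \<dots> \<le> norm (w t - w s) + norm (w t - D\<phi> t x u) + norm (w s - D\<phi> s x u)"
      by (meson norm_triangle_ineq norm_triangle_ineq4 norm_triangle_le add_right_mono order_trans)
    also have "\<dots> \<le> 2 * L * \<bar>t - s\<bar> * norm u + e/2 * norm u + e/2 * norm u"
      by (intro add_mono w 1 2)
    finally show ?thesis by (simp add: distrib_right)
  qed
  then show "\<exists>\<rho>>0. \<forall>u. norm u < \<rho> \<longrightarrow> norm ((D\<phi> t x - D\<phi> s x) u) \<le> (2 * L * \<bar>t - s\<bar> + e) * norm u"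
    using \<rho> by blast
qed (use L in simp)

lemma continuous_on_D\<phi>: "continuous_on (B \<times> {-T<..<T}) (\<lambda>(x, t). D\<phi> t x)"
proof (rule continuous_on_TimesI)
  show "local_lipschitz B {-T<..<T} (\<lambda>x t. D\<phi> t x)"
  proof (rule local_lipschitzI)
    fix x t assume "x \<in> B" "t \<in> {-T<..<T}"
    have "(2 * L)-lipschitz_on (cball t 1 \<inter> {-T<..<T}) (\<lambda>t. D\<phi> t y)" if "y \<in> B" for y
      using L(2) D\<phi>_lipschitz_time[OF that]
      by (intro lipschitz_onI) (auto simp: dist_norm)
    then show "\<exists>u>0. \<exists>K. \<forall>y\<in>cball x u \<inter> B. K-lipschitz_on (cball t u \<inter> {-T<..<T}) (\<lambda>t. D\<phi> t y)"
      by (intro exI[of _ "1::real"] conjI exI[of _ "2 * L"]) auto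
  qed
  show "continuous_on B (\<lambda>x. D\<phi> t x)" if t: "t \<in> {-T<..<T}" for t
  proof (rule continuous_onI)
    fix x0 and e :: real assume "x0 \<in> B" "e > 0"
    then obtain \<rho> where "\<rho> > 0" "\<forall>t x. \<bar>t\<bar> < T \<longrightarrow> x \<in> ball x0 \<rho> \<longrightarrow> norm (D\<phi> t x - D\<phi> t x0) \<le> e"
      using D\<phi>_near by blast
    then show "\<exists>d>0. \<forall>x\<in>B. dist x x0 < d \<longrightarrow> dist (D\<phi> t x) (D\<phi> t x0) \<le> e"
      using t by (intro exI[of _ \<rho>]) (auto simp: dist_norm norm_minus_commute)
  qed
qed

lemma continuous_on_\<phi>: "continuous_on (B \<times> {-T<..<T}) (\<lambda>(x, t). \<phi> t x)"
proof -
  have "continuous_on ({-T<..<T} \<times> B) (\<lambda>(t, x). \<phi> t x)"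
  proof (rule continuous_on_TimesI)
    show "local_lipschitz {-T<..<T} B \<phi>"
    proof (rule local_lipschitzI)
      fix t x assume "t \<in> {-T<..<T}" "x \<in> B"
      have "2-lipschitz_on (cball x 1 \<inter> B) (\<phi> s)" if "s \<in> {-T<..<T}" for s
        using \<phi>_lipschitz that by (intro lipschitz_onI) (auto simp: dist_norm)
      then show "\<exists>u>0. \<exists>K. \<forall>s\<in>cball t u \<inter> {-T<..<T}. K-lipschitz_on (cball x u \<inter> B) (\<phi> s)"
        by (intro exI[of _ "1::real"] conjI exI[of _ "2::real"]) auto
    qed
    show "continuous_on {-T<..<T} (\<lambda>t. \<phi> t x)" if "x \<in> B" for x
      using has_vector_derivative_continuous[OF \<phi>_der[OF that]]
      by (intro continuous_at_imp_continuous_on ballI) auto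
  qed
  from continuous_on_compose2[OF this continuous_on_swap, of "B \<times> {-T<..<T}"]
  show ?thesis by (simp add: case_prod_unfold image_subset_iff)
qed

text \<open>The partial derivative in position is \<open>D\<phi>\<close>, the one in time is the right-hand side \<open>f\<close>. Both are
jointly continuous, so they combine to a total derivative.\<close>

lemma C1_deriv_flow:
  shows "\<exists>\<Phi>'. C1_deriv (B \<times> {-T<..<T}) (\<lambda>(x, t). \<phi> t x) \<Phi>' \<and>
    (\<forall>x\<in>B. \<forall>v s. blinfun_apply (\<Phi>' (x, 0)) (v, s) = v + s *\<^sub>R f x)"
proof -
  let ?I = "{-T<..<T}"
  define \<Phi>' where "\<Phi>' p = (D\<phi> (snd p) (fst p) o\<^sub>L fst_blinfun) + (blinfun_scaleR_left (f (\<phi> (snd p) (fst p))) o\<^sub>L snd_blinfun)" for p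
  have app: "blinfun_apply (\<Phi>' p) (v, s) = blinfun_apply (D\<phi> (snd p) (fst p)) v + s *\<^sub>R f (\<phi> (snd p) (fst p))" for p v s
    unfolding \<Phi>'_def by (simp add: blinfun.add_left)
  have f_cont: "continuous_on (B \<times> ?I) (\<lambda>p. f (\<phi> (snd p) (fst p)))"
    using continuous_on_compose2[OF C1_deriv_imp_continuous_on[OF f] continuous_on_\<phi>] \<phi>_in K(3)
    by (fastforce simp: case_prod_unfold)
  have open': "open (B \<times> ?I)" using B by (intro open_Times) auto
  show ?thesis
  proof (intro exI[of _ \<Phi>'] conjI ballI allI)
    show "C1_deriv (B \<times> ?I) (\<lambda>(x, t). \<phi> t x) \<Phi>'"
      unfolding C1_deriv_def
    proof (intro conjI ballI)
      show "continuous_on (B \<times> ?I) \<Phi>'"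
        unfolding \<Phi>'_def by (intro continuous_intros continuous_on_D\<phi>[unfolded case_prod_unfold] f_cont
            bounded_linear.continuous_on[OF bounded_linear_blinfun_scaleR_left])
      fix p assume p: "p \<in> B \<times> ?I"
      obtain x t where p_eq: "p = (x, t)" by (cases p)
      with p have x: "x \<in> B" and t: "t \<in> ?I" by auto
      have "((\<lambda>(x, t). \<phi> t x) has_derivative
          (\<lambda>(tx, ty). D\<phi> t x tx + blinfun_scaleR_left (f (\<phi> t x)) ty)) (at (x, t) within B \<times> ?I)"
      proof (rule has_derivative_partialsI[where fy = "\<lambda>x t. blinfun_scaleR_left (f (\<phi> t x))"])
        show "((\<lambda>x. \<phi> t x) has_derivative blinfun_apply (D\<phi> t x)) (at x within B)"
          using D\<phi>_has_derivative x t by (auto intro: has_derivative_at_withinI)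
        show "((\<lambda>t. \<phi> t x) has_derivative blinfun_apply (blinfun_scaleR_left (f (\<phi> t x)))) (at t within ?I)"
          if "x \<in> B" "t \<in> ?I" for x t
          using \<phi>_der[of x t] that by (auto simp: has_vector_derivative_def intro: has_derivative_at_withinI)
        have "continuous_on (B \<times> ?I) (\<lambda>p. blinfun_scaleR_left (f (\<phi> (snd p) (fst p))))"
          by (intro f_cont bounded_linear.continuous_on[OF bounded_linear_blinfun_scaleR_left])
        then show "continuous (at (x, t) within B \<times> ?I) (\<lambda>(x, y). blinfun_scaleR_left (f (\<phi> y x)))"
          using x t by (simp add: continuous_on_eq_continuous_within case_prod_unfold)
      qed (use t in auto)
      moreover have "(\<lambda>(tx, ty). D\<phi> t x tx + blinfun_scaleR_left (f (\<phi> t x)) ty) = blinfun_apply (\<Phi>' p)"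
        by (rule ext) (auto simp: app p_eq)
      ultimately show "((\<lambda>(x, t). \<phi> t x) has_derivative blinfun_apply (\<Phi>' p)) (at p)"
        using at_within_open[OF p open'] by (simp add: p_eq)
    qed
  next
    fix x v s assume x: "x \<in> B"
    have "(\<phi> 0 has_derivative D\<phi> 0 x) (at x)" using D\<phi>_has_derivative x T by simp
    then have "((\<lambda>x. x) has_derivative D\<phi> 0 x) (at x)"
      by (rule has_derivative_transform_within_open[OF _ B x]) (rule \<phi>_0)
    then have "D\<phi> 0 x = id_blinfun"
      using has_derivative_unique[OF _ has_derivative_ident, of "blinfun_apply (D\<phi> 0 x)" x]
      by (intro blinfun_eqI) simp
    then show "blinfun_apply (\<Phi>' (x, 0)) (v, s) = v + s *\<^sub>R f x" using x by (simp add: app \<phi>_0)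
  qed
qed

end

section \<open>Commutators of fields along a continuously differentiable map\<close>

lemma eq_0_if_norm_le_eps:
  fixes x :: "'a::real_normed_vector"
  assumes "\<And>e::real. e > 0 \<Longrightarrow> norm x \<le> e * C"
  shows "x = 0"
proof -
  have "((\<lambda>e. e * C) \<longlongrightarrow> 0 * C) (at_right (0::real))"
    by (intro tendsto_intros)
  moreover have "\<forall>\<^sub>F e in at_right (0::real). norm x \<le> e * C"
    using assms by (auto simp: eventually_at_right_field intro: exI[of _ 1])
  ultimately have "norm x \<le> 0 * C"
    by (rule tendsto_lowerbound) simp
  then show ?thesis by simp
qed

text \<open>The curve \<open>t \<mapsto> \<sigma> s t\<close> is a quadratic substitute for the integral curve of \<open>\<eta>\<close> that starts near
\<open>y0 + s *\<^sub>R w\<close>: its velocity agrees with \<open>\<eta>\<close> up to \<open>o(s)\<close>, for \<open>t\<close> up to \<open>s\<close>. As \<open>g\<close> has the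
derivative \<open>a\<close> along \<open>\<eta>\<close>, integrating the first-order expansion of \<open>a\<close> along this curve gives the increment
of \<open>g\<close> to second order, although \<open>g\<close> itself need not be twice differentiable.\<close>

lemma second_order_expansion_along_field:
  fixes g :: "'a::real_normed_vector \<Rightarrow> 'b::real_normed_vector" and \<eta> :: "'a \<Rightarrow> 'a" and w c y0 :: "'a"
    and A :: "'a \<Rightarrow>\<^sub>L 'a" and \<alpha> :: "'a \<Rightarrow>\<^sub>L 'b"
  assumes V: "open V" "y0 \<in> V"
    and g: "\<forall>y\<in>V. (g has_derivative blinfun_apply (g' y)) (at y)"
    and C: "\<forall>y\<in>V. norm (g' y) \<le> C"
    and a: "\<forall>y\<in>V. g' y (\<eta> y) = a y"
    and \<eta>: "(\<eta> has_derivative A) (at y0)" and a': "(a has_derivative \<alpha>) (at y0)"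
    and "e > 0"
  defines "\<sigma> \<equiv> \<lambda>s t. y0 + s *\<^sub>R w + s\<^sup>2 *\<^sub>R c + t *\<^sub>R (\<eta> y0 + s *\<^sub>R A w) + (t\<^sup>2/2) *\<^sub>R A (\<eta> y0)"
  shows "\<forall>\<^sub>F s in at_right 0. norm (g (\<sigma> s s) - g (\<sigma> s 0) -
      (s *\<^sub>R a y0 + s\<^sup>2 *\<^sub>R \<alpha> w + (s\<^sup>2/2) *\<^sub>R \<alpha> (\<eta> y0))) \<le> e * s\<^sup>2"
proof -
  note g = g[rule_format] and C = C[rule_format] and a = a[rule_format]
  have C0: "C \<ge> 0" using C[OF V(2)] norm_ge_zero order_trans by blast
  \<comment> \<open>The curve stays within \<open>s * M\<close> of \<open>y0\<close>. The constant \<open>Q\<close> bounds the terms of order \<open>s\<^sup>2\<close> in the error \<open>F'\<close>, and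
    \<open>e'\<close> and \<open>s0\<close> are chosen so that the terms of order \<open>o(s)\<close> and \<open>s\<^sup>2\<close> contribute \<open>e * s / 2\<close> each.\<close>
  define M where "M = norm w + norm c + norm (\<eta> y0) + norm (A w) + norm (A (\<eta> y0)) + 1"
  have M: "M > 0" unfolding M_def by (simp add: add_nonneg_pos)
  define Q where "Q = C * norm A + norm \<alpha>"
  have Q: "Q \<ge> 0" unfolding Q_def using C0 by simp
  define e' where "e' = e / (2 * M * (C + 1))"
  have e': "e' > 0" unfolding e'_def using \<open>e > 0\<close> M C0 by simp
  obtain r1 where r1: "r1 > 0" "ball y0 r1 \<subseteq> V" using V open_contains_ball by blast
  obtain r2 where r2: "r2 > 0" "\<forall>y. norm (y - y0) < r2 \<longrightarrow> norm (\<eta> y - \<eta> y0 - A (y - y0)) \<le> e' * norm (y - y0)"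
    using \<eta> e' unfolding has_derivative_at_alt by blast
  obtain r3 where r3: "r3 > 0" "\<forall>y. norm (y - y0) < r3 \<longrightarrow> norm (a y - a y0 - \<alpha> (y - y0)) \<le> e' * norm (y - y0)"
    using a' e' unfolding has_derivative_at_alt by blast
  define r where "r = min r1 (min r2 r3)"
  have r: "r > 0" using r1 r2 r3 by (simp add: r_def)
  define s0 where "s0 = min 1 (min (r / M) (e / (2 * M * (Q + 1))))"
  have s0: "s0 > 0" unfolding s0_def using r M Q \<open>e > 0\<close> by simp
  have main: "norm (g (\<sigma> s s) - g (\<sigma> s 0) - (s *\<^sub>R a y0 + s\<^sup>2 *\<^sub>R \<alpha> w + (s\<^sup>2/2) *\<^sub>R \<alpha> (\<eta> y0))) \<le> e * s\<^sup>2"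
    if s: "0 < s" "s < s0" for s
  proof -
    have s1: "s \<le> 1" "s < r / M" "s \<le> e / (2 * M * (Q + 1))" using s by (auto simp: s0_def)
    define F where "F t = g (\<sigma> s t) - (t *\<^sub>R a y0 + (t * s) *\<^sub>R \<alpha> w + (t\<^sup>2/2) *\<^sub>R \<alpha> (\<eta> y0))" for t
    define \<sigma>' where "\<sigma>' t = \<eta> y0 + s *\<^sub>R A w + t *\<^sub>R A (\<eta> y0)" for t
    define F' where "F' t = g' (\<sigma> s t) (\<sigma>' t) - (a y0 + s *\<^sub>R \<alpha> w + t *\<^sub>R \<alpha> (\<eta> y0))" for t
    have est: "\<sigma> s t \<in> V" "norm (F' t) \<le> e * s" if t: "t \<in> {0..s}" for t
    proof -
      define h where "h = \<sigma> s t - y0"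
      define R where "R = s\<^sup>2 *\<^sub>R c + (t * s) *\<^sub>R A w + (t\<^sup>2/2) *\<^sub>R A (\<eta> y0)"
      have h: "h = s *\<^sub>R w + t *\<^sub>R \<eta> y0 + R"
        unfolding h_def \<sigma>_def R_def by (simp add: algebra_simps)
      have ts: "t * s \<le> s\<^sup>2" "t\<^sup>2/2 \<le> s\<^sup>2" "0 \<le> t * s"
        using t s by (auto simp: power2_eq_square intro: mult_right_mono) (smt (verit) mult_mono mult_nonneg_nonneg)
      have "norm R \<le> s\<^sup>2 * norm c + (t * s) * norm (A w) + (t\<^sup>2/2) * norm (A (\<eta> y0))"
        unfolding R_def using ts by (intro norm_triangle_le add_mono) (auto intro: norm_triangle_le)
      also have "\<dots> \<le> s\<^sup>2 * norm c + s\<^sup>2 * norm (A w) + s\<^sup>2 * norm (A (\<eta> y0))"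
        using ts by (intro add_mono mult_right_mono) auto
      also have "\<dots> = s\<^sup>2 * (norm c + norm (A w) + norm (A (\<eta> y0)))"
        by (simp add: algebra_simps)
      finally have R1: "norm R \<le> s\<^sup>2 * (norm c + norm (A w) + norm (A (\<eta> y0)))" .
      also have "\<dots> \<le> s\<^sup>2 * M" by (intro mult_left_mono) (auto simp: M_def)
      finally have R: "norm R \<le> s\<^sup>2 * M" .
      have s2: "s\<^sup>2 \<le> s" using s s1 by (simp add: power2_eq_square mult_left_le)
      have "norm h \<le> s * norm w + t * norm (\<eta> y0) + norm R"
        unfolding h using s t by (intro norm_triangle_le add_mono) (auto intro: norm_triangle_le)
      also have "\<dots> \<le> s * norm w + s * norm (\<eta> y0) + s * (norm c + norm (A w) + norm (A (\<eta> y0)))"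
        using t R1 mult_right_mono[OF s2, of "norm c + norm (A w) + norm (A (\<eta> y0))"]
        by (intro add_mono mult_right_mono) auto
      also have "\<dots> \<le> s * M" using s by (simp add: M_def algebra_simps)
      finally have hM: "norm h \<le> s * M" .
      also have "\<dots> < r" using s1 M by (simp add: field_simps)
      finally have hr: "norm h < r" .
      have h_eq: "\<sigma> s t = y0 + h" by (simp add: h_def)
      show V': "\<sigma> s t \<in> V" using hr r1 by (auto simp: r_def h_eq dist_norm subset_eq)
      have e\<eta>: "norm (\<eta> (\<sigma> s t) - \<eta> y0 - A h) \<le> e' * (s * M)"
        using r2(2) hr hM e' order_trans[OF _ mult_left_mono[OF hM, of e']] by (auto simp: r_def h_def)
      have ea: "norm (a (\<sigma> s t) - a y0 - \<alpha> h) \<le> e' * (s * M)"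
        using r3(2) hr hM e' order_trans[OF _ mult_left_mono[OF hM, of e']] by (auto simp: r_def h_def)
      have AR: "norm (A R) \<le> norm A * (s\<^sup>2 * M)"
        using norm_blinfun[of A R] mult_left_mono[OF R, of "norm A"] by simp
      have \<alpha>R: "norm (\<alpha> R) \<le> norm \<alpha> * (s\<^sup>2 * M)"
        using norm_blinfun[of \<alpha> R] mult_left_mono[OF R, of "norm \<alpha>"] by simp
      define D where "D = (\<eta> (\<sigma> s t) - \<eta> y0 - A h) + A R"
      have D: "norm D \<le> e' * (s * M) + norm A * (s\<^sup>2 * M)"
        unfolding D_def by (rule norm_triangle_mono[OF e\<eta> AR])
      have gD: "norm (g' (\<sigma> s t) D) \<le> C * (e' * (s * M) + norm A * (s\<^sup>2 * M))"
        using norm_blinfun[of "g' (\<sigma> s t)" D] mult_mono[OF C[OF V'] D C0 norm_ge_zero] by simp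
      have \<sigma>': "\<sigma>' t = \<eta> (\<sigma> s t) - D"
        unfolding D_def \<sigma>'_def h by (simp add: blinfun.add_right blinfun.scaleR_right)
      have "F' t = (a (\<sigma> s t) - a y0 - \<alpha> h) + \<alpha> R - g' (\<sigma> s t) D"
        unfolding F'_def \<sigma>' blinfun.diff_right a[OF V'] h by (simp add: blinfun.add_right blinfun.scaleR_right)
      also have "norm \<dots> \<le> (e' * (s * M) + norm \<alpha> * (s\<^sup>2 * M)) + C * (e' * (s * M) + norm A * (s\<^sup>2 * M))"
        by (intro norm_triangle_le_diff add_mono norm_triangle_mono ea \<alpha>R gD)
      also have "\<dots> = s * (e' * M * (C + 1) + s * (M * Q))"
        unfolding Q_def by (simp add: algebra_simps power2_eq_square)
      also have "\<dots> \<le> s * (e/2 + e/2)"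
      proof -
        have "M * (C + 1) \<noteq> 0" using M C0 by simp
        then have "e' * M * (C + 1) = e/2"
          unfolding mult.assoc by (subst nonzero_eq_divide_eq[symmetric]) (simp_all add: e'_def mult.assoc)
        moreover have "s * (M * Q) \<le> e/2"
        proof -
          have "s * (M * Q) \<le> s * (M * (Q + 1))" using s M Q by (intro mult_left_mono) auto
          also have "\<dots> \<le> e / (2 * M * (Q + 1)) * (M * (Q + 1))" using s1 M Q by (intro mult_right_mono) auto
          also have "\<dots> = e/2"
          proof -
            have "M * (Q + 1) \<noteq> 0" using M Q by simp
            then show ?thesis by (subst nonzero_eq_divide_eq[symmetric]) (simp_all add: mult.assoc)
          qed
          finally show ?thesis .
        qed
        ultimately show ?thesis using s by (intro mult_left_mono) auto
      qed
      finally show "norm (F' t) \<le> e * s" by (simp add: mult.commute)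
    qed
    have "norm (F s - F 0) \<le> (e * s) * norm (s - 0)"
    proof (rule differentiable_bound[where S = "{0..s}" and f' = "\<lambda>t h. h *\<^sub>R F' t"])
      fix t assume t: "t \<in> {0..s}"
      have "((\<lambda>t. \<sigma> s t) has_derivative (\<lambda>h. h *\<^sub>R \<sigma>' t)) (at t)"
        unfolding \<sigma>_def \<sigma>'_def
        by (auto intro!: derivative_eq_intros simp: scaleR_add_right algebra_simps)
      from diff_chain_at[OF this g[OF est(1)[OF t]]]
      have "((\<lambda>t. g (\<sigma> s t)) has_derivative (\<lambda>h. h *\<^sub>R g' (\<sigma> s t) (\<sigma>' t))) (at t)"
        by (simp add: o_def blinfun.scaleR_right)
      then have "(F has_derivative (\<lambda>h. h *\<^sub>R F' t)) (at t)"
        unfolding F_def F'_def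
        by (auto intro!: derivative_eq_intros simp: scaleR_add_right scaleR_diff_right algebra_simps)
      then show "(F has_derivative (\<lambda>h. h *\<^sub>R F' t)) (at t within {0..s})"
        by (rule has_derivative_at_withinI)
      show "onorm (\<lambda>h. h *\<^sub>R F' t) \<le> e * s"
        using est(2)[OF t] s \<open>e > 0\<close> by (intro onorm_bound) (auto simp: mult.commute intro: mult_left_mono)
    qed (use s in auto)
    moreover have "F s - F 0 = g (\<sigma> s s) - g (\<sigma> s 0) - (s *\<^sub>R a y0 + s\<^sup>2 *\<^sub>R \<alpha> w + (s\<^sup>2/2) *\<^sub>R \<alpha> (\<eta> y0))"
      unfolding F_def by (simp add: power2_eq_square)
    ultimately show ?thesis using s by (simp add: power2_eq_square mult.assoc)
  qed
  then show ?thesis using s0 by (auto simp: eventually_at_right_field)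
qed

text \<open>The identity \<open>\<xi> (\<eta> g) - \<eta> (\<xi> g) = [\<xi>, \<eta>] g\<close> for a map \<open>g\<close> that is only \<open>C\<^sup>1\<close>, but whose derivatives \<open>a\<close> along \<open>\<xi>\<close>
and \<open>b\<close> along \<open>\<eta>\<close> are differentiable. Following \<open>\<xi>\<close> and then \<open>\<eta>\<close> for the time \<open>s\<close> leads to a point \<open>E1\<close>,
the opposite order to \<open>E2\<close>, and \<open>E1 - E2\<close> is \<open>s\<^sup>2\<close> times the commutator. The difference of the values
of \<open>g\<close> is computed in two ways: from the second-order expansions along the sides, and from the
derivative of \<open>g\<close> at \<open>y0\<close>.\<close>

lemma derivative_along_commutator:
  fixes g :: "'a::euclidean_space \<Rightarrow> 'b::real_normed_vector" and \<xi> \<eta> :: "'a \<Rightarrow> 'a"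
    and A B :: "'a \<Rightarrow>\<^sub>L 'a" and \<alpha> \<beta> :: "'a \<Rightarrow>\<^sub>L 'b"
  assumes V: "open V" "y0 \<in> V" and g: "C1_deriv V g g'"
    and a: "\<And>y. y \<in> V \<Longrightarrow> g' y (\<xi> y) = a y" and b: "\<And>y. y \<in> V \<Longrightarrow> g' y (\<eta> y) = b y"
    and \<xi>: "(\<xi> has_derivative A) (at y0)" and \<eta>: "(\<eta> has_derivative B) (at y0)"
    and a': "(a has_derivative \<alpha>) (at y0)" and b': "(b has_derivative \<beta>) (at y0)"
  shows "\<beta> (\<xi> y0) - \<alpha> (\<eta> y0) = g' y0 (B (\<xi> y0) - A (\<eta> y0))"
proof -
  obtain R where R: "R > 0" "cball y0 R \<subseteq> V" using V open_contains_cball by blast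
  let ?V = "ball y0 R"
  have "compact (g' ` cball y0 R)"
    using continuous_on_subset[OF C1_derivD(2)[OF g] R(2)] by (intro compact_continuous_image) auto
  then obtain C where C: "\<And>y. y \<in> cball y0 R \<Longrightarrow> norm (g' y) \<le> C"
    using compact_imp_bounded bounded_iff by (metis imageI)
  have V': "open ?V" "y0 \<in> ?V" "\<forall>y\<in>?V. (g has_derivative blinfun_apply (g' y)) (at y)"
    "\<forall>y\<in>?V. norm (g' y) \<le> C" "\<forall>y\<in>?V. g' y (\<xi> y) = a y" "\<forall>y\<in>?V. g' y (\<eta> y) = b y"
    using R C C1_derivD(1)[OF g] a b by (auto simp: subset_iff)
  let ?u = "\<xi> y0" and ?v = "\<eta> y0"
  \<comment> \<open>The corners \<open>P1\<close> and \<open>P2\<close> are reached after the first leg, along \<open>\<xi>\<close> and \<open>\<eta>\<close> respectively.\<close>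
  define E1 where "E1 s = y0 + s *\<^sub>R ?u + (s\<^sup>2/2) *\<^sub>R A ?u + s *\<^sub>R (?v + s *\<^sub>R B ?u) + (s\<^sup>2/2) *\<^sub>R B ?v" for s :: real
  define E2 where "E2 s = y0 + s *\<^sub>R ?v + (s\<^sup>2/2) *\<^sub>R B ?v + s *\<^sub>R (?u + s *\<^sub>R A ?v) + (s\<^sup>2/2) *\<^sub>R A ?u" for s :: real
  define P1 where "P1 s = y0 + s *\<^sub>R ?u + (s\<^sup>2/2) *\<^sub>R A ?u" for s :: real
  define P2 where "P2 s = y0 + s *\<^sub>R ?v + (s\<^sup>2/2) *\<^sub>R B ?v" for s :: real
  let ?K = "B ?u - A ?v"
  have "norm (\<beta> ?u - \<alpha> ?v - g' y0 ?K) \<le> e * (4 + norm ?K)" if "e > 0" for e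
  proof -
    note expand_\<xi> = second_order_expansion_along_field[OF V'(1,2,3,4,5) \<xi> a' \<open>e > 0\<close>]
      and expand_\<eta> = second_order_expansion_along_field[OF V'(1,2,3,4,6) \<eta> b' \<open>e > 0\<close>]
    have 1: "\<forall>\<^sub>F s in at_right 0. norm (g (P1 s) - g y0 - (s *\<^sub>R a y0 + (s\<^sup>2/2) *\<^sub>R \<alpha> ?u)) \<le> e * s\<^sup>2"
      using expand_\<xi>[of 0 0] by (rule eventually_mono) (simp add: P1_def)
    have 2: "\<forall>\<^sub>F s in at_right 0. norm (g (P2 s) - g y0 - (s *\<^sub>R b y0 + (s\<^sup>2/2) *\<^sub>R \<beta> ?v)) \<le> e * s\<^sup>2"
      using expand_\<eta>[of 0 0] by (rule eventually_mono) (simp add: P2_def)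
    have 3: "\<forall>\<^sub>F s in at_right 0. norm (g (E1 s) - g (P1 s) - (s *\<^sub>R b y0 + s\<^sup>2 *\<^sub>R \<beta> ?u + (s\<^sup>2/2) *\<^sub>R \<beta> ?v)) \<le> e * s\<^sup>2"
      using expand_\<eta>[of ?u "(1/2) *\<^sub>R A ?u"] by (rule eventually_mono) (simp add: E1_def P1_def)
    have 4: "\<forall>\<^sub>F s in at_right 0. norm (g (E2 s) - g (P2 s) - (s *\<^sub>R a y0 + s\<^sup>2 *\<^sub>R \<alpha> ?v + (s\<^sup>2/2) *\<^sub>R \<alpha> ?u)) \<le> e * s\<^sup>2"
      using expand_\<xi>[of ?v "(1/2) *\<^sub>R B ?v"] by (rule eventually_mono) (simp add: E2_def P2_def)
    obtain \<rho> where \<rho>: "\<rho> > 0" "\<And>p q c. p \<in> cball y0 R \<Longrightarrow> q \<in> cball y0 R \<Longrightarrow> c \<in> cball y0 R \<Longrightarrow> norm (p - c) < \<rho> \<Longrightarrow>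
        norm (q - c) < \<rho> \<Longrightarrow> norm (g p - g q - g' c (p - q)) \<le> e * norm (p - q)"
      using C1_uniform_linearization[OF g compact_cball convex_cball R(2) \<open>e > 0\<close>] by blast
    have lim: "(E1 \<longlongrightarrow> y0) (at_right 0)" "(E2 \<longlongrightarrow> y0) (at_right 0)"
    proof -
      have "continuous_on UNIV E1" "continuous_on UNIV E2"
        unfolding E1_def E2_def by (intro continuous_intros; simp)+
      then have "(E1 \<longlongrightarrow> E1 0) (at_right 0)" "(E2 \<longlongrightarrow> E2 0) (at_right 0)"
        by (auto simp: continuous_on_def intro: tendsto_within_subset)
      then show "(E1 \<longlongrightarrow> y0) (at_right 0)" "(E2 \<longlongrightarrow> y0) (at_right 0)"
        by (simp_all add: E1_def E2_def)
    qed
    have "min \<rho> R > 0" using \<rho> R by simp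
    have "\<forall>\<^sub>F s in at_right (0::real). s > 0" by (simp add: eventually_at_right_less)
    then have "\<forall>\<^sub>F s in at_right (0::real). norm (\<beta> ?u - \<alpha> ?v - g' y0 ?K) \<le> e * (4 + norm ?K)"
      using 1 2 3 4 tendstoD[OF lim(1) \<open>min \<rho> R > 0\<close>] tendstoD[OF lim(2) \<open>min \<rho> R > 0\<close>]
    proof eventually_elim
      case (elim s)
      have EE: "E1 s - E2 s = s\<^sup>2 *\<^sub>R ?K"
        unfolding E1_def E2_def by (simp add: algebra_simps power2_eq_square)
      have "norm (g (E1 s) - g (E2 s) - g' y0 (E1 s - E2 s)) \<le> e * norm (E1 s - E2 s)"
        using elim(6,7) R by (intro \<rho>(2)) (auto simp: dist_norm norm_minus_commute)
      then have 5: "norm (g (E1 s) - g (E2 s) - s\<^sup>2 *\<^sub>R g' y0 ?K) \<le> e * (s\<^sup>2 * norm ?K)"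
        unfolding EE by (simp add: blinfun.scaleR_right)
      have tri: "norm (p - q - r + x + y) \<le> norm p + norm q + norm r + norm x + norm y" for p q r x y :: 'b
        using norm_triangle_ineq4[of p q] norm_triangle_ineq4[of "p - q" r]
          norm_triangle_ineq[of "p - q - r" x] norm_triangle_ineq[of "p - q - r + x" y] by linarith
      let ?r1 = "g (P1 s) - g y0 - (s *\<^sub>R a y0 + (s\<^sup>2/2) *\<^sub>R \<alpha> ?u)"
      let ?r2 = "g (P2 s) - g y0 - (s *\<^sub>R b y0 + (s\<^sup>2/2) *\<^sub>R \<beta> ?v)"
      let ?r3 = "g (E1 s) - g (P1 s) - (s *\<^sub>R b y0 + s\<^sup>2 *\<^sub>R \<beta> ?u + (s\<^sup>2/2) *\<^sub>R \<beta> ?v)"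
      let ?r4 = "g (E2 s) - g (P2 s) - (s *\<^sub>R a y0 + s\<^sup>2 *\<^sub>R \<alpha> ?v + (s\<^sup>2/2) *\<^sub>R \<alpha> ?u)"
      let ?r5 = "g (E1 s) - g (E2 s) - s\<^sup>2 *\<^sub>R g' y0 ?K"
      have telescope: "X - Y - Z = (G1 - G2 - Z) - (p1 - g0 - (a + u)) - (G1 - p1 - (b + X + v)) +
          (p2 - g0 - (b + v)) + (G2 - p2 - (a + Y + u))" for X Y Z G1 G2 p1 p2 g0 a b u v :: 'b
        by simp
      have eq: "s\<^sup>2 *\<^sub>R (\<beta> ?u - \<alpha> ?v - g' y0 ?K) = ?r5 - ?r1 - ?r3 + ?r2 + ?r4"
        unfolding scaleR_diff_right by (rule telescope)
      have "norm (s\<^sup>2 *\<^sub>R (\<beta> ?u - \<alpha> ?v - g' y0 ?K)) \<le> norm ?r5 + norm ?r1 + norm ?r3 + norm ?r2 + norm ?r4"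
        unfolding eq by (rule tri)
      also have "\<dots> \<le> e * (s\<^sup>2 * norm ?K) + e * s\<^sup>2 + e * s\<^sup>2 + e * s\<^sup>2 + e * s\<^sup>2"
        by (rule add_mono[OF add_mono[OF add_mono[OF add_mono[OF 5 elim(2)] elim(4)] elim(3)] elim(5)])
      also have "\<dots> = s\<^sup>2 * (e * (4 + norm ?K))" by (simp add: algebra_simps)
      finally have "s\<^sup>2 * norm (\<beta> ?u - \<alpha> ?v - g' y0 ?K) \<le> s\<^sup>2 * (e * (4 + norm ?K))"
        by (simp only: norm_scaleR abs_power2)
      moreover have "s\<^sup>2 > 0" using elim(1) by simp
      ultimately show ?case by (simp only: mult_le_cancel_left_pos)
    qed
    from eventually_happens'[OF _ this] show ?thesis by (simp only: trivial_limit_at_right_real) blast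
  qed
  then have "\<beta> ?u - \<alpha> ?v - g' y0 ?K = 0" by (rule eq_0_if_norm_le_eps)
  then show ?thesis by simp
qed

section \<open>Rank and the inverse function theorem\<close>

text \<open>A map that misses \<open>v\<close> has a nonzero kernel vector \<open>w\<close>. The form \<open>\<lambda>x. x \<bullet> w\<close> is nonzero on \<open>w\<close>, so the
perturbed map reaches \<open>v\<close> from a multiple of \<open>w\<close>, and by correcting along \<open>w\<close> it still reaches all
old values.\<close>

lemma rank_one_perturbation_increases_rank:
  fixes f :: "'a::euclidean_space \<Rightarrow> 'a"
  assumes f: "linear f" and v: "v \<notin> range f"
  obtains w where "dim (range f) < dim (range (\<lambda>x. f x + (x \<bullet> w) *\<^sub>R v))"
proof -
  have "\<not> surj f" using v by blast
  then have "\<not> inj f" using linear_injective_imp_surjective[OF f] by blast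
  then obtain w where w: "w \<noteq> 0" "f w = 0" using linear_injective_0[OF f] by blast
  let ?h = "\<lambda>x. f x + (x \<bullet> w) *\<^sub>R v"
  have h: "linear ?h"
    by (rule linearI) (simp_all add: linear_add[OF f] linear_scale[OF f] inner_add_left scaleR_add_left scaleR_add_right)
  have ww: "w \<bullet> w \<noteq> 0" using w by simp
  have v_in: "v \<in> range ?h"
    by (rule range_eqI[of _ _ "(1 / (w \<bullet> w)) *\<^sub>R w"]) (use ww in \<open>simp add: linear_scale[OF f] w\<close>)
  have f_in: "f x \<in> range ?h" for x
    by (rule range_eqI[of _ _ "x - ((x \<bullet> w) / (w \<bullet> w)) *\<^sub>R w"])
      (use ww in \<open>simp add: linear_diff[OF f] linear_scale[OF f] w inner_diff_left\<close>)
  have "span (range f) = range f" using linear_subspace_image[OF f subspace_UNIV] by (simp only: span_eq_iff)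
  then have "dim (insert v (range f)) = dim (range f) + 1" using v by (simp only: dim_insert if_False)
  moreover have "dim (insert v (range f)) \<le> dim (range ?h)"
    using v_in f_in by (intro dim_subset) auto
  ultimately have "dim (range f) < dim (range ?h)" by linarith
  then show ?thesis by (rule that)
qed

text \<open>The restriction of \<open>f\<close> to the orthogonal complement of its kernel is injective and has the same range.\<close>

lemma rank_nullity:
  fixes f :: "'a::euclidean_space \<Rightarrow> 'b::euclidean_space"
  assumes f: "linear f"
  shows "dim {x. f x = 0} + dim (range f) = DIM('a)"
proof -
  let ?N = "{x. f x = 0}" and ?O = "{y. \<forall>x\<in>{x. f x = 0}. orthogonal x y}"
  have N: "subspace ?N" using linear_subspace_kernel[OF f] by simp
  have O: "subspace ?O" by (auto simp: subspace_def orthogonal_clauses)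
  have decomp: "\<exists>y z. y \<in> ?N \<and> z \<in> ?O \<and> x = y + z" for x
  proof -
    have span: "span ?N = ?N" using N by (simp only: span_eq_iff)
    obtain y z where yz: "y \<in> span ?N" "\<And>w. w \<in> span ?N \<Longrightarrow> orthogonal z w" "x = y + z"
      using orthogonal_subspace_decomp_exists[of ?N x] by blast
    then have "z \<in> ?O" unfolding span by (simp add: orthogonal_commute)
    then show ?thesis using yz(1,3) unfolding span by blast
  qed
  have img: "range f = f ` ?O"
  proof -
    have "f x \<in> f ` ?O" for x
    proof -
      obtain y z where yz: "y \<in> ?N" "z \<in> ?O" "x = y + z" using decomp by blast
      then have "f x = f z" by (simp add: linear_add[OF f])
      then show ?thesis using yz(2) by (rule image_eqI)
    qed
    then show ?thesis by blast
  qed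
  have inj: "inj_on f ?O"
  proof (rule inj_onI)
    fix x y assume xy: "x \<in> ?O" "y \<in> ?O" "f x = f y"
    then have "x - y \<in> ?O" "x - y \<in> ?N" using subspace_diff[OF O] by (auto simp: linear_diff[OF f])
    then have "orthogonal (x - y) (x - y)" by blast
    then show "x = y" by (simp add: orthogonal_self)
  qed
  have "dim (range f) = dim ?O"
    unfolding img by (rule dim_image_eq[OF f]) (use inj in \<open>simp only: span_eq_iff[THEN iffD2, OF O]\<close>)
  moreover have "dim ?O + dim ?N = DIM('a)"
    using dim_subspace_orthogonal_to_vectors[OF N subspace_UNIV subset_UNIV] by simp
  ultimately show ?thesis by simp
qed

lemma exists_linear_projection:
  fixes S :: "'a::euclidean_space set"
  assumes "subspace S"
  obtains P where "linear P" "\<And>v. P v \<in> S" "\<And>v. v \<in> S \<Longrightarrow> P v = v"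
proof -
  have "\<exists>P. P ` UNIV \<subseteq> S \<and> linear P \<and> (\<forall>v\<in>S. P (id v) = v)"
    using linear_exists_left_inverse_on[of id S] assms by (simp add: linear_id)
  then show ?thesis using that by auto
qed

text \<open>A linear right inverse of \<open>f\<close> on \<open>f ` S\<close> maps into \<open>S\<close> and preserves the dimension, so it is onto \<open>S\<close>
and hence also a left inverse.\<close>

lemma linear_inj_on_if_dim_image_eq:
  fixes f :: "'a::euclidean_space \<Rightarrow> 'b::euclidean_space"
  assumes f: "linear f" and S: "subspace S" and dim: "dim (f ` S) = dim S"
  shows "inj_on f S"
proof -
  obtain g where g: "range g \<subseteq> S" "linear g" "\<forall>v\<in>f ` S. f (g v) = v"
    using linear_exists_right_inverse_on[OF f S] by blast
  have fS: "subspace (f ` S)" by (rule linear_subspace_image[OF f S])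
  have inj: "inj_on g (span (f ` S))"
    unfolding span_eq_iff[THEN iffD2, OF fS] using g(3) by (intro inj_on_inverseI[where g = f]) blast
  then have "dim (g ` f ` S) = dim S"
    using dim dim_image_eq[OF g(2) inj] by simp
  then have "g ` f ` S = S"
    using g(1) by (intro subspace_dim_equal linear_subspace_image[OF g(2)] fS S) auto
  then have "\<And>x. x \<in> S \<Longrightarrow> g (f x) = x" using g(3) by (metis imageE imageI)
  then show ?thesis by (rule inj_on_inverseI)
qed

lemma norm_lower_bound_stable:
  fixes A B :: "'a::real_normed_vector \<Rightarrow>\<^sub>L 'b::real_normed_vector"
  assumes "\<And>v. norm v \<le> c * norm (A v)" "c > 0" "c * norm (B - A) \<le> 1/2"
  shows "norm v \<le> 2 * c * norm (B v)"
proof -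
  have "norm (A v) \<le> norm (B v) + norm ((B - A) v)"
    using norm_triangle_ineq4[of "B v" "(B - A) v"] by (simp add: blinfun.diff_left)
  also have "\<dots> \<le> norm (B v) + norm (B - A) * norm v" by (intro add_left_mono norm_blinfun)
  finally have "c * norm (A v) \<le> c * (norm (B v) + norm (B - A) * norm v)"
    using assms by (intro mult_left_mono) auto
  then have "norm v \<le> c * norm (B v) + (c * norm (B - A)) * norm v"
    using assms(1)[of v] by (simp add: algebra_simps)
  also have "\<dots> \<le> c * norm (B v) + 1/2 * norm v" using assms by (intro add_left_mono mult_right_mono) auto
  finally show ?thesis by simp
qed

text \<open>From \<open>F y \<circ> (G y - G x) = (F x - F y) \<circ> G x\<close>, where \<open>F y\<close> is bounded below uniformly for \<open>y\<close> near
\<open>x\<close>.\<close>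

lemma continuous_on_inverse_blinfun:
  fixes F :: "'c::metric_space \<Rightarrow> 'a::real_normed_vector \<Rightarrow>\<^sub>L 'b::real_normed_vector"
    and G :: "'c \<Rightarrow> 'b \<Rightarrow>\<^sub>L 'a"
  assumes F: "continuous_on S F"
    and GF: "\<And>x v. x \<in> S \<Longrightarrow> G x (F x v) = v" and FG: "\<And>x v. x \<in> S \<Longrightarrow> F x (G x v) = v"
  shows "continuous_on S G"
proof (rule continuous_onI)
  fix x and e :: real assume x: "x \<in> S" and e: "e > 0"
  define c where "c = norm (G x) + 1"
  have c: "c > 0" by (simp add: c_def add_nonneg_pos)
  have lower: "norm v \<le> c * norm (F x v)" for v
    using norm_blinfun[of "G x" "F x v"] GF[OF x, of v]
    by (simp add: c_def distrib_right) (meson add_increasing2 norm_ge_zero)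
  define r where "r = min (1 / (2 * c)) (e / (2 * c * c))"
  have r: "r > 0" using c e by (simp add: r_def)
  obtain d where d: "d > 0" "\<And>y. y \<in> S \<Longrightarrow> dist y x < d \<Longrightarrow> dist (F y) (F x) < r"
    using F x r unfolding continuous_on_iff by blast
  have "dist (G y) (G x) \<le> e" if y: "y \<in> S" "dist y x < d" for y
  proof -
    have n: "norm (F y - F x) \<le> r" using d(2)[OF y] by (simp add: dist_norm)
    have "c * norm (F y - F x) \<le> c * (1 / (2 * c))" using n c by (intro mult_left_mono) (auto simp: r_def)
    then have n1: "c * norm (F y - F x) \<le> 1/2" using c by simp
    have "norm (G y - G x) \<le> e"
    proof (rule norm_blinfun_bound)
      fix w
      have "F y ((G y - G x) w) = (F x - F y) (G x w)"
        using FG[OF y(1)] FG[OF x] by (simp add: blinfun.diff_left blinfun.diff_right)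
      then have "norm ((G y - G x) w) \<le> 2 * c * norm ((F x - F y) (G x w))"
        using norm_lower_bound_stable[OF lower c n1, of "(G y - G x) w"] by simp
      also have "\<dots> \<le> 2 * c * (r * (c * norm w))"
      proof (intro mult_left_mono)
        have "norm ((F x - F y) (G x w)) \<le> norm (F x - F y) * norm (G x w)" by (rule norm_blinfun)
        also have "\<dots> \<le> r * (c * norm w)"
          using n norm_blinfun[of "G x" w] r c
          by (intro mult_mono) (auto simp: norm_minus_commute c_def distrib_right intro: add_increasing2)
        finally show "norm ((F x - F y) (G x w)) \<le> r * (c * norm w)" .
      qed (use c in simp)
      also have "\<dots> = (2 * c * c) * r * norm w" by simp
      also have "\<dots> \<le> (2 * c * c) * (e / (2 * c * c)) * norm w"
        using c by (intro mult_right_mono mult_left_mono) (auto simp: r_def)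
      also have "\<dots> = e * norm w" using c by simp
      finally show "norm ((G y - G x) w) \<le> e * norm w" .
    qed (use e in simp)
    then show ?thesis by (simp add: dist_norm)
  qed
  then show "\<exists>d>0. \<forall>x'\<in>S. dist x' x < d \<longrightarrow> dist (G x') (G x) \<le> e" using d by blast
qed

text \<open>Adds to \<open>inverse_function_theorem\<close> the continuity of the derivative of the inverse.\<close>

lemma C1_inverse_function_theorem:
  fixes f :: "'a::euclidean_space \<Rightarrow> 'a"
  assumes U: "open U" "x0 \<in> U" and f: "C1_deriv U f f'" and inj: "inj (f' x0)"
  shows "\<exists>V h h'. open V \<and> f x0 \<in> V \<and> h (f x0) = x0 \<and> h ` V \<subseteq> U \<and> C1_deriv V h h' \<and>
    (\<forall>y\<in>V. f (h y) = y) \<and> (\<forall>y\<in>V. \<forall>v. f' (h y) (h' y v) = v \<and> h' y (f' (h y) v) = v)"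
proof -
  have lin: "linear (f' x0)" by (simp add: blinfun.bounded_linear_right bounded_linear.linear)
  obtain i where i: "linear i" "i \<circ> f' x0 = id"
    using linear_injective_left_inverse[OF lin inj] by blast
  have bl: "bounded_linear i" using i(1) by (simp add: linear_linear)
  have "Blinfun i o\<^sub>L f' x0 = id_blinfun"
    by (rule blinfun_eqI) (use i(2) in \<open>simp add: bounded_linear_Blinfun_apply[OF bl] fun_eq_iff\<close>)
  then obtain U' V h k where *: "open U'" "U' \<subseteq> U" "x0 \<in> U'" "open V" "f x0 \<in> V" "homeomorphism U' V f h"
    "\<And>y. y \<in> V \<Longrightarrow> (h has_derivative k y) (at y)"
    "\<And>y. y \<in> V \<Longrightarrow> k y = inv (blinfun_apply (f' (h y)))"
    "\<And>y. y \<in> V \<Longrightarrow> bij (blinfun_apply (f' (h y)))"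
    using inverse_function_theorem[OF U(1) C1_derivD(1)[OF f] C1_derivD(2)[OF f] U(2)] by metis
  define h' where "h' y = Blinfun (k y)" for y
  have h': "blinfun_apply (h' y) = k y" if "y \<in> V" for y
    unfolding h'_def using has_derivative_bounded_linear[OF *(7)[OF that]] by (rule bounded_linear_Blinfun_apply)
  have hV: "h ` V \<subseteq> U" using *(2,6) by (auto simp: homeomorphism_def)
  have 1: "f' (h y) (h' y v) = v" "h' y (f' (h y) v) = v" if "y \<in> V" for y v
    unfolding h'[OF that] *(8)[OF that] using *(9)[OF that]
    by (simp_all add: bij_is_surj surj_f_inv_f bij_is_inj)
  have hc: "continuous_on V h" using *(6) by (simp add: homeomorphism_def)
  have "continuous_on V (\<lambda>y. f' (h y))"
    using continuous_on_compose2[OF C1_derivD(2)[OF f] hc hV] .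
  then have "continuous_on V h'"
    by (rule continuous_on_inverse_blinfun) (use 1 in auto)
  then have "C1_deriv V h h'" unfolding C1_deriv_def using *(7) h' by auto
  moreover have "h (f x0) = x0" "\<forall>y\<in>V. f (h y) = y"
    using *(3,6) by (auto simp: homeomorphism_def)
  ultimately show ?thesis
    using *(4,5) hV 1 by (intro exI[of _ V] exI[of _ h] exI[of _ h'] conjI) simp_all
qed

text \<open>Up to a change of variables, a map of locally maximal rank parametrizes a graph over the range of its
derivative at \<open>x0\<close>. In the new variables its component in this range is the projection \<open>P\<close>, which is the
first equation for \<open>D\<close>. As the rank does not exceed that of \<open>P\<close>, the map does not vary along the kernel
of \<open>P\<close>, which is the second.\<close>

lemma constant_rank_normal_form:
  fixes \<Psi> :: "'a::euclidean_space \<Rightarrow> 'a"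
  assumes V: "open V" "x0 \<in> V" and \<Psi>: "C1_deriv V \<Psi> \<Psi>'"
    and rank: "\<And>x. x \<in> V \<Longrightarrow> dim (range (\<Psi>' x)) \<le> dim (range (\<Psi>' x0))"
  shows "\<exists>V' h D P. open V' \<and> V' \<noteq> {} \<and> h ` V' \<subseteq> V \<and> C1_deriv V' (\<Psi> \<circ> h) D \<and> linear P \<and>
    (\<forall>y\<in>V'. \<forall>v. P (D y v) = P v \<and> D y (P v) = D y v) \<and>
    (\<forall>y\<in>V'. dim (range (D y)) = dim (range (\<Psi>' x0)))"
proof -
  let ?D = "\<Psi>' x0" and ?E = "range (\<Psi>' x0)"
  have lin: "linear (blinfun_apply A)" for A :: "'a \<Rightarrow>\<^sub>L 'a" by (simp add: blinfun.bounded_linear_right bounded_linear.linear)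
  have E: "subspace ?E" using linear_subspace_image[OF lin subspace_UNIV] .
  obtain P where P: "linear P" "\<And>v. P v \<in> ?E" "\<And>v. v \<in> ?E \<Longrightarrow> P v = v"
    using exists_linear_projection[OF E] by blast
  have rP: "range P = ?E" using P(2,3) by (metis (no_types, lifting) image_subset_iff rangeI subsetI subset_antisym)
  let ?N = "{x. ?D x = 0}" and ?K = "{x. P x = 0}"
  have N: "subspace ?N" using linear_subspace_kernel[OF lin] by simp
  have K: "subspace ?K" using linear_subspace_kernel[OF P(1)] by simp
  obtain Q where Q: "linear Q" "\<And>v. Q v \<in> ?N" "\<And>v. v \<in> ?N \<Longrightarrow> Q v = v"
    using exists_linear_projection[OF N] by blast
  have "dim ?N = dim ?K" using rank_nullity[OF lin, of ?D] rank_nullity[OF P(1)] rP by simp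
  then obtain i where i: "linear i" "i ` ?N = ?K" "\<And>x. x \<in> ?N \<Longrightarrow> norm (i x) = norm x"
    using isometry_subspaces[OF N K] by blast
  have T: "linear (i \<circ> Q)" using i(1) Q(1) by (rule linear_compose[rotated])
  define T where "T = Blinfun (i \<circ> Q)"
  have T_app: "T v = i (Q v)" for v
    unfolding T_def using T by (simp add: linear_linear bounded_linear_Blinfun_apply)
  have PT: "P (T v) = 0" for v unfolding T_app using i(2) Q(2)[of v] by blast
  define p where "p = Blinfun P"
  have p_app: "p v = P v" for v
    unfolding p_def using P(1) by (simp add: linear_linear bounded_linear_Blinfun_apply)
  \<comment> \<open>As \<open>T\<close> maps the kernel of the derivative isomorphically onto the kernel of \<open>P\<close>, the map \<open>\<theta>\<close> completes the
    component \<open>P \<circ> \<Psi>\<close> to a local diffeomorphism at \<open>x0\<close>.\<close>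
  define \<theta> where "\<theta> x = p (\<Psi> x) + T x" for x
  define \<theta>' where "\<theta>' x = (p o\<^sub>L \<Psi>' x) + T" for x
  have \<theta>: "C1_deriv V \<theta> \<theta>'"
    unfolding C1_deriv_def \<theta>_def \<theta>'_def
  proof (intro conjI ballI)
    fix x assume "x \<in> V"
    then have "(\<Psi> has_derivative \<Psi>' x) (at x)" using C1_derivD[OF \<Psi>] by simp
    then show "((\<lambda>x. p (\<Psi> x) + T x) has_derivative blinfun_apply ((p o\<^sub>L \<Psi>' x) + T)) (at x)"
      by (auto intro!: derivative_eq_intros simp: blinfun.add_left)
  qed (intro continuous_intros C1_derivD(2)[OF \<Psi>])
  have inj: "inj (\<theta>' x0)"
  proof (subst linear_injective_0[OF lin], intro allI impI)
    fix v assume v: "\<theta>' x0 v = 0"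
    then have eq: "P (?D v) + T v = 0" by (simp add: \<theta>'_def blinfun.add_left p_app)
    then have "?D v + T v = 0" using P(3) by simp
    moreover have "P (?D v + T v) = P (?D v)" by (simp add: linear_add[OF P(1)] PT)
    ultimately have "P (?D v) = 0" by (simp add: linear_0[OF P(1)])
    then have Dv: "?D v = 0" using P(3) by simp
    then have "T v = 0" using eq by (simp add: linear_0[OF P(1)])
    then have "i v = 0" using Dv Q(3) by (simp add: T_app)
    then show "v = 0" using i(3)[of v] Dv by simp
  qed
  obtain V' h h' where h: "open V'" "\<theta> x0 \<in> V'" "h ` V' \<subseteq> V" "C1_deriv V' h h'"
    "\<And>y v. y \<in> V' \<Longrightarrow> \<theta>' (h y) (h' y v) = v" "\<And>y v. y \<in> V' \<Longrightarrow> h' y (\<theta>' (h y) v) = v"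
    using C1_inverse_function_theorem[OF V \<theta> inj] by blast
  define D where "D y = \<Psi>' (h y) o\<^sub>L h' y" for y
  have C1: "C1_deriv V' (\<Psi> \<circ> h) D" unfolding D_def by (rule C1_deriv_compose[OF \<Psi> h(4,3)])
  have PP: "P (P v) = P v" for v using P(2,3) by blast
  have PD: "P (D y v) = P v" if y: "y \<in> V'" for y v
  proof -
    have "P v = P (\<theta>' (h y) (h' y v))" using h(5)[OF y] by simp
    also have "\<dots> = P (D y v)" by (simp add: \<theta>'_def D_def blinfun.add_left p_app linear_add[OF P(1)] PT PP)
    finally show ?thesis by simp
  qed
  have rank_eq: "dim (range (D y)) = dim ?E" and DP: "D y (P v) = D y v" if y: "y \<in> V'" for y v
  proof -
    have "?E \<subseteq> P ` range (D y)" using PD[OF y] P(3) by (metis (no_types, lifting) image_eqI rangeI subsetI)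
    then have PE: "P ` range (D y) = ?E" using P(2) by blast
    have sub: "subspace (range (D y))" using linear_subspace_image[OF lin subspace_UNIV] .
    have "dim ?E \<le> dim (range (D y))" unfolding PE[symmetric] by (rule dim_image_le[OF P(1)])
    moreover have "range (D y) \<subseteq> range (\<Psi>' (h y))" by (auto simp: D_def)
    then have "dim (range (D y)) \<le> dim (range (\<Psi>' (h y)))" by (rule dim_subset)
    then have "dim (range (D y)) \<le> dim ?E" using rank[of "h y"] h(3) y by fastforce
    ultimately show eq: "dim (range (D y)) = dim ?E" by simp
    have inj: "inj_on P (range (D y))"
      by (rule linear_inj_on_if_dim_image_eq[OF P(1) sub]) (simp add: PE eq)
    have "D y (v - P v) = 0"
    proof -
      have "P (D y (v - P v)) = P 0" unfolding PD[OF y] by (simp add: linear_diff[OF P(1)] PP linear_0[OF P(1)])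
      then show ?thesis using inj subspace_0[OF sub] by (meson inj_onD rangeI)
    qed
    then show "D y (P v) = D y v" by (simp add: blinfun.diff_right)
  qed
  have "V' \<noteq> {}" using h(2) by blast
  then show ?thesis
    using h(1,3) C1 P(1) PD DP rank_eq
    by (intro exI[of _ V'] exI[of _ h] exI[of _ D] exI[of _ P] conjI) simp_all
qed

text \<open>In the normal form a field tangent to \<open>g\<close> is lifted by \<open>P\<close>: the lift \<open>P (Y (g z))\<close> is differentiable
although \<open>D\<close> is merely continuous, so the commutator identity applies to the lifts of \<open>Y\<close> and \<open>Z\<close>, and
its left-hand side is the bracket of \<open>Y\<close> and \<open>Z\<close> at \<open>g y\<close>.\<close>

lemma bracket_tangent_to_constant_rank_map:
  fixes g :: "'a::euclidean_space \<Rightarrow> 'a" and Y' Z' :: "'a \<Rightarrow>\<^sub>L 'a"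
  assumes V: "open V" "y \<in> V" and g: "C1_deriv V g D" and P: "linear P"
    and PD: "\<And>y v. y \<in> V \<Longrightarrow> P (D y v) = P v" and DP: "\<And>y v. y \<in> V \<Longrightarrow> D y (P v) = D y v"
    and Y: "\<And>y. y \<in> V \<Longrightarrow> Y (g y) \<in> range (D y)" and Z: "\<And>y. y \<in> V \<Longrightarrow> Z (g y) \<in> range (D y)"
    and Y': "(Y has_derivative Y') (at (g y))" and Z': "(Z has_derivative Z') (at (g y))"
  shows "Z' (Y (g y)) - Y' (Z (g y)) \<in> range (D y)"
proof -
  have lift: "D z (P u) = u" if z: "z \<in> V" and u: "u \<in> range (D z)" for z u
  proof -
    obtain v where "u = D z v" using u by blast
    then show ?thesis using PD[OF z] DP[OF z] by metis
  qed
  define p where "p = Blinfun P"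
  have p: "p v = P v" for v
    unfolding p_def using P by (simp add: linear_linear bounded_linear_Blinfun_apply)
  have gy: "(g has_derivative D y) (at y)" using C1_derivD(1)[OF g V(2)] .
  have a': "((\<lambda>z. Y (g z)) has_derivative blinfun_apply (Y' o\<^sub>L D y)) (at y)"
    using diff_chain_at[OF gy Y'] by (simp add: o_def blinfun_compose.rep_eq)
  have b': "((\<lambda>z. Z (g z)) has_derivative blinfun_apply (Z' o\<^sub>L D y)) (at y)"
    using diff_chain_at[OF gy Z'] by (simp add: o_def blinfun_compose.rep_eq)
  have \<xi>: "((\<lambda>z. p (Y (g z))) has_derivative blinfun_apply (p o\<^sub>L (Y' o\<^sub>L D y))) (at y)"
    using bounded_linear.has_derivative[OF blinfun.bounded_linear_right a', of p] by (simp add: o_def blinfun_compose.rep_eq)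
  have \<eta>: "((\<lambda>z. p (Z (g z))) has_derivative blinfun_apply (p o\<^sub>L (Z' o\<^sub>L D y))) (at y)"
    using bounded_linear.has_derivative[OF blinfun.bounded_linear_right b', of p] by (simp add: o_def blinfun_compose.rep_eq)
  have aY: "D z (p (Y (g z))) = Y (g z)" and bZ: "D z (p (Z (g z))) = Z (g z)" if "z \<in> V" for z
    using lift[OF that] Y[OF that] Z[OF that] by (simp_all add: p)
  from derivative_along_commutator[OF V g aY bZ \<xi> \<eta> a' b']
  have "Z' (Y (g y)) - Y' (Z (g y)) =
      D y ((p o\<^sub>L (Z' o\<^sub>L D y)) (p (Y (g y))) - (p o\<^sub>L (Y' o\<^sub>L D y)) (p (Z (g y))))"
    using aY[OF V(2)] bZ[OF V(2)] by simp
  then show ?thesis by simp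
qed

section \<open>Minimal closed invariant sets\<close>

lemma exists_minimal_closed_invariant_set:
  fixes G :: "('m::topological_space \<Rightarrow> 'm) set"
  assumes "compact (UNIV :: 'm set)" and K: "closed K" "K \<noteq> {}" "\<And>g. g \<in> G \<Longrightarrow> g ` K \<subseteq> K"
  obtains C where "C \<subseteq> K" "closed C" "C \<noteq> {}" "\<And>g. g \<in> G \<Longrightarrow> g ` C \<subseteq> C"
    "\<And>C'. C' \<subseteq> C \<Longrightarrow> closed C' \<Longrightarrow> C' \<noteq> {} \<Longrightarrow> (\<And>g. g \<in> G \<Longrightarrow> g ` C' \<subseteq> C') \<Longrightarrow> C' = C"
proof -
  \<comment> \<open>Zorn's lemma is applied to the complements of the closed invariant subsets of \<open>K\<close>, ordered by inclusion.\<close>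
  define \<A> where "\<A> = {B. open B \<and> -K \<subseteq> B \<and> B \<noteq> UNIV \<and> (\<forall>g\<in>G. g ` (-B) \<subseteq> -B)}"
  have "-K \<in> \<A>" using K by (auto simp: \<A>_def)
  then have "\<A> \<noteq> {}" by blast
  have "\<exists>M\<in>\<A>. \<forall>X\<in>\<A>. M \<subseteq> X \<longrightarrow> X = M"
  proof (rule subset_Zorn_nonempty[OF \<open>\<A> \<noteq> {}\<close>])
    fix \<C> assume ne: "\<C> \<noteq> {}" and chain: "subset.chain \<A> \<C>"
    have sub: "\<C> \<subseteq> \<A>" using chain by (auto simp: subset.chain_def)
    \<comment> \<open>If the chain covered the space, then so would one of its members, by compactness.\<close>
    have "\<Union>\<C> \<noteq> UNIV"
    proof
      assume cover: "\<Union>\<C> = UNIV"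
      have "\<And>B. B \<in> \<C> \<Longrightarrow> open B" using sub by (auto simp: \<A>_def)
      then obtain \<D> where \<D>: "\<D> \<subseteq> \<C>" "finite \<D>" "UNIV \<subseteq> \<Union>\<D>"
        using compactE[OF assms(1), of \<C>] cover by (metis subset_UNIV)
      have "\<D> \<noteq> {}" using \<D>(3) by auto
      moreover have "subset.chain \<A> \<D>" using chain \<D>(1) by (meson subset_chain_def subset_trans subsetD)
      ultimately have "\<Union>\<D> \<in> \<D>" using \<D>(2) by (intro Union_in_chain)
      then have "UNIV \<in> \<A>" using \<D>(1,3) sub by (metis subset_UNIV subset_antisym subsetD)
      then show False by (simp add: \<A>_def)
    qed
    moreover have "open (\<Union>\<C>)" using sub by (auto simp: \<A>_def)
    moreover have "-K \<subseteq> \<Union>\<C>" using ne sub unfolding \<A>_def by blast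
    moreover have "\<forall>g\<in>G. g ` (-\<Union>\<C>) \<subseteq> -\<Union>\<C>" using sub by (fastforce simp: \<A>_def)
    ultimately show "\<Union>\<C> \<in> \<A>" by (simp add: \<A>_def)
  qed
  then obtain M where M: "M \<in> \<A>" "\<And>X. X \<in> \<A> \<Longrightarrow> M \<subseteq> X \<Longrightarrow> X = M" by blast
  show ?thesis
  proof (rule that[of "-M"])
    fix C' assume C': "C' \<subseteq> -M" "closed C'" "C' \<noteq> {}" "\<And>g. g \<in> G \<Longrightarrow> g ` C' \<subseteq> C'"
    then have "-C' \<in> \<A>" using M(1) by (auto simp: \<A>_def)
    then show "C' = -M" using M(2)[of "-C'"] C'(1) by auto
  qed (use M(1) in \<open>auto simp: \<A>_def\<close>)
qed

text \<open>Each orbit closure is invariant, since \<open>G\<close> is closed under composition and its elements are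
continuous. Inside a minimal invariant set every orbit closure is therefore the whole set.\<close>

lemma exists_minimal_orbit_closure:
  fixes G :: "('m::topological_space \<Rightarrow> 'm) set"
  assumes comp: "compact (UNIV :: 'm set)" and ne: "G \<noteq> {}"
    and cont: "\<And>g. g \<in> G \<Longrightarrow> continuous_on UNIV g"
    and semi: "\<And>g h. g \<in> G \<Longrightarrow> h \<in> G \<Longrightarrow> g \<circ> h \<in> G"
  shows "\<exists>C. closed C \<and> C \<noteq> {} \<and> C \<subseteq> closure {g q | g. g \<in> G} \<and> (\<forall>p\<in>C. closure {g p | g. g \<in> G} = C)"
proof -
  let ?K = "\<lambda>p. closure {g p | g. g \<in> G}"
  have inv: "h ` ?K p \<subseteq> ?K p" if h: "h \<in> G" for h p
  proof (rule image_closure_subset)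
    show "continuous_on (?K p) h" using cont[OF h] continuous_on_subset by blast
    have "h (g p) \<in> {g p | g. g \<in> G}" if "g \<in> G" for g
      using semi[OF h that] by (metis (mono_tags, lifting) comp_apply mem_Collect_eq)
    then have "h ` {g p | g. g \<in> G} \<subseteq> {g p | g. g \<in> G}" by blast
    then show "h ` {g p | g. g \<in> G} \<subseteq> ?K p" using closure_subset by blast
  qed simp
  have Kne: "?K p \<noteq> {}" for p using ne by auto
  obtain C where C: "C \<subseteq> ?K q" "closed C" "C \<noteq> {}" "\<And>g. g \<in> G \<Longrightarrow> g ` C \<subseteq> C"
    "\<And>C'. C' \<subseteq> C \<Longrightarrow> closed C' \<Longrightarrow> C' \<noteq> {} \<Longrightarrow> (\<And>g. g \<in> G \<Longrightarrow> g ` C' \<subseteq> C') \<Longrightarrow> C' = C"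
    by (rule exists_minimal_closed_invariant_set[OF comp, of "?K q" G]) (use Kne inv in auto)
  have "?K p = C" if "p \<in> C" for p
  proof (rule C(5))
    show "?K p \<subseteq> C" using C(2,4) that by (intro closure_minimal) auto
  qed (use Kne inv in auto)
  then show ?thesis using C(1-3) by blast
qed

section \<open>Smooth functions\<close>

lemma frechet_derivative_cong_open:
  assumes "open W" "x \<in> W" "\<And>y. y \<in> W \<Longrightarrow> f y = g y"
  shows "frechet_derivative f (at x) = frechet_derivative g (at x)"
proof -
  have "(f has_derivative F) (at x) \<longleftrightarrow> (g has_derivative F) (at x)" for F
    using has_derivative_transform_within_open[OF _ assms(1,2)] assms(3) by metis
  then show ?thesis by (simp add: frechet_derivative_def)
qed

lemma Ck_on_cong:
  fixes f g :: "'a::euclidean_space \<Rightarrow> 'b::euclidean_space"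
  assumes "open W" "\<And>x. x \<in> W \<Longrightarrow> f x = g x" "Ck_on k W f"
  shows "Ck_on k W g"
  using assms(2,3)
proof (induction k arbitrary: f g)
  case 0
  then show ?case by (auto intro: continuous_on_eq)
next
  case (Suc k)
  note at = at_within_open[OF _ assms(1)]
  show ?case unfolding Ck_on.simps
  proof (intro conjI ballI allI)
    fix x assume x: "x \<in> W"
    then obtain F where "(f has_derivative F) (at x)"
      using Suc.prems(2) at by (auto simp: differentiable_def)
    then have "(g has_derivative F) (at x)"
      using has_derivative_transform_within_open[OF _ assms(1) x] Suc.prems(1) by metis
    then show "g differentiable at x within W" using x by (auto simp: at differentiable_def)
  next
    fix v
    show "Ck_on k W (\<lambda>x. frechet_derivative g (at x within W) v)"
    proof (rule Suc.IH)
      show "Ck_on k W (\<lambda>x. frechet_derivative f (at x within W) v)" using Suc.prems(2) by simp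
      fix x assume "x \<in> W"
      then show "frechet_derivative f (at x within W) v = frechet_derivative g (at x within W) v"
        using frechet_derivative_cong_open[OF assms(1) _ Suc.prems(1)] by (simp add: at)
    qed
  qed
qed

lemma smooth_on_cong:
  assumes "open W" "\<And>x. x \<in> W \<Longrightarrow> f x = g x" "smooth_on W f"
  shows "smooth_on W g"
  using assms Ck_on_cong unfolding smooth_on_def by blast

lemma smooth_on_has_derivative:
  assumes "smooth_on W f" "open W" "x \<in> W"
  shows "(f has_derivative frechet_derivative f (at x)) (at x)"
proof -
  have "Ck_on (Suc 0) W f" using assms by (simp only: smooth_on_def)
  then show ?thesis using assms(2,3) by (simp add: at_within_open[OF _ assms(2)] frechet_derivative_works)
qed

lemma smooth_on_derivative:
  assumes "smooth_on W f" "open W"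
  shows "smooth_on W (\<lambda>x. frechet_derivative f (at x) v)"
proof -
  have "smooth_on W (\<lambda>x. frechet_derivative f (at x within W) v)"
    unfolding smooth_on_def
  proof
    fix k have "Ck_on (Suc k) W f" using assms by (simp only: smooth_on_def)
    then show "Ck_on k W (\<lambda>x. frechet_derivative f (at x within W) v)" by simp
  qed
  then show ?thesis by (rule smooth_on_cong[OF assms(2), rotated]) (simp add: at_within_open[OF _ assms(2)])
qed

lemma smooth_on_imp_continuous_on: "smooth_on W f \<Longrightarrow> continuous_on W f"
  unfolding smooth_on_def by (metis Ck_on.simps(1))

lemma smooth_on_imp_C1_deriv:
  assumes "smooth_on W f" "open W"
  shows "C1_deriv W f (\<lambda>x. Blinfun (frechet_derivative f (at x)))"
proof -
  have app: "blinfun_apply (Blinfun (frechet_derivative f (at x))) = frechet_derivative f (at x)" if "x \<in> W" for x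
    using smooth_on_has_derivative[OF assms that] by (intro bounded_linear_Blinfun_apply has_derivative_bounded_linear)
  have "continuous_on W (\<lambda>x. Blinfun (frechet_derivative f (at x)))"
  proof (rule continuous_on_blinfun_componentwise)
    fix i
    show "continuous_on W (\<lambda>x. blinfun_apply (Blinfun (frechet_derivative f (at x))) i)"
      using smooth_on_imp_continuous_on[OF smooth_on_derivative[OF assms, of i]]
      by (rule continuous_on_eq) (simp add: app)
  qed
  then show ?thesis
    unfolding C1_deriv_def using smooth_on_has_derivative[OF assms] app by auto
qed

text \<open>Applied to the class \<open>\<S>\<close> of all functions of a given form, this replaces an induction on the order of
differentiability.\<close>

lemma smooth_on_coinduct:
  fixes \<S> :: "('a::euclidean_space \<Rightarrow> 'b::euclidean_space) set"
  assumes W: "open W" and "f \<in> \<S>"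
    and step: "\<And>f. f \<in> \<S> \<Longrightarrow> \<exists>F. (\<forall>x\<in>W. (f has_derivative F x) (at x)) \<and> (\<forall>v. (\<lambda>x. F x v) \<in> \<S>)"
  shows "smooth_on W f"
proof -
  have "Ck_on k W f" if "f \<in> \<S>" for k f
    using that
  proof (induction k arbitrary: f)
    case 0
    then show ?case using step[OF 0]
      by (auto intro!: continuous_at_imp_continuous_on dest: has_derivative_continuous)
  next
    case (Suc k)
    obtain F where F: "\<And>x. x \<in> W \<Longrightarrow> (f has_derivative F x) (at x)" "\<And>v. (\<lambda>x. F x v) \<in> \<S>"
      using step[OF Suc.prems] by blast
    show ?case unfolding Ck_on.simps
    proof (intro conjI ballI allI)
      fix x assume "x \<in> W"
      then show "f differentiable at x within W" using F(1) W by (auto simp: at_within_open[OF _ W] differentiable_def)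
    next
      fix v
      show "Ck_on k W (\<lambda>x. frechet_derivative f (at x within W) v)"
      proof (rule Ck_on_cong[OF W _ Suc.IH[OF F(2)[of v]]])
        fix x assume "x \<in> W"
        then show "F x v = frechet_derivative f (at x within W) v"
          using frechet_derivative_at[OF F(1)] W by (simp add: at_within_open[OF _ W])
      qed
    qed
  qed
  then show ?thesis unfolding smooth_on_def using assms(2) by blast
qed

lemma smooth_on_const: "open W \<Longrightarrow> smooth_on W (\<lambda>x. c)"
  by (rule smooth_on_coinduct[of _ _ "range (\<lambda>c x. c)"])
    (auto intro!: exI[of _ "\<lambda>x v. 0"])

lemma smooth_on_linear:
  assumes W: "open W" and f: "smooth_on W f" and l: "bounded_linear l"
  shows "smooth_on W (\<lambda>x. l (f x))"
proof (rule smooth_on_coinduct[OF W, of _ "{\<lambda>x. l (f x) | f. smooth_on W f}"])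
  fix h assume "h \<in> {\<lambda>x. l (f x) | f. smooth_on W f}"
  then obtain f where f: "h = (\<lambda>x. l (f x))" "smooth_on W f" by blast
  have "(h has_derivative (\<lambda>v. l (frechet_derivative f (at x) v))) (at x)" if "x \<in> W" for x
    unfolding f(1) by (rule bounded_linear.has_derivative[OF l smooth_on_has_derivative[OF f(2) W that]])
  moreover have "(\<lambda>x. l (frechet_derivative f (at x) v)) \<in> {\<lambda>x. l (f x) | f. smooth_on W f}" for v
    using smooth_on_derivative[OF f(2) W, of v] by (intro CollectI exI[of _ "\<lambda>x. frechet_derivative f (at x) v"]) simp
  ultimately show "\<exists>F. (\<forall>x\<in>W. (h has_derivative F x) (at x)) \<and> (\<forall>v. (\<lambda>x. F x v) \<in> {\<lambda>x. l (f x) | f. smooth_on W f})"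
    by (intro exI[of _ "\<lambda>x v. l (frechet_derivative f (at x) v)"]) simp
qed (use f in blast)

text \<open>The products alone are not closed under differentiation, by the Leibniz rule.\<close>

inductive_set sums_of_products :: "'a::euclidean_space set \<Rightarrow> ('a \<Rightarrow> 'b::euclidean_space) set" for W where
  product: "smooth_on W r \<Longrightarrow> smooth_on W f \<Longrightarrow> (\<lambda>x. (r x :: real) *\<^sub>R f x) \<in> sums_of_products W"
| sum: "f \<in> sums_of_products W \<Longrightarrow> g \<in> sums_of_products W \<Longrightarrow> (\<lambda>x. f x + g x) \<in> sums_of_products W"

lemma smooth_on_sums_of_products:
  assumes W: "open W" and "f \<in> sums_of_products W"
  shows "smooth_on W f"
proof (rule smooth_on_coinduct[OF assms])
  fix f :: "'a \<Rightarrow> 'b" assume "f \<in> sums_of_products W"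
  then show "\<exists>F. (\<forall>x\<in>W. (f has_derivative F x) (at x)) \<and> (\<forall>v. (\<lambda>x. F x v) \<in> sums_of_products W)"
  proof induction
    case (product r f)
    let ?F = "\<lambda>x v. r x *\<^sub>R frechet_derivative f (at x) v + frechet_derivative r (at x) v *\<^sub>R f x"
    have "\<forall>x\<in>W. ((\<lambda>x. r x *\<^sub>R f x) has_derivative ?F x) (at x)"
      using has_derivative_scaleR smooth_on_has_derivative[OF product(1) W] smooth_on_has_derivative[OF product(2) W]
      by blast
    moreover have "(\<lambda>x. ?F x v) \<in> sums_of_products W" for v
      by (intro sums_of_products.intros smooth_on_derivative product W)
    ultimately show ?case by (intro exI[of _ ?F]) simp
  next
    case (sum f g)
    then obtain F G where F: "\<forall>x\<in>W. (f has_derivative F x) (at x)" "\<forall>v. (\<lambda>x. F x v) \<in> sums_of_products W"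
      and G: "\<forall>x\<in>W. (g has_derivative G x) (at x)" "\<forall>v. (\<lambda>x. G x v) \<in> sums_of_products W"
      by blast
    then show ?case
      by (intro exI[of _ "\<lambda>x v. F x v + G x v"]) (simp add: has_derivative_add sums_of_products.sum)
  qed
qed

lemma smooth_on_scaleR:
  "open W \<Longrightarrow> smooth_on W r \<Longrightarrow> smooth_on W f \<Longrightarrow> smooth_on W (\<lambda>x. r x *\<^sub>R f x)"
  by (rule smooth_on_sums_of_products[OF _ sums_of_products.product])

lemma smooth_on_add:
  assumes W: "open W" and "smooth_on W f" "smooth_on W g"
  shows "smooth_on W (\<lambda>x. f x + g x)"
proof -
  have "(\<lambda>x. 1 *\<^sub>R f x + 1 *\<^sub>R g x) \<in> sums_of_products W"
    by (intro sums_of_products.intros smooth_on_const assms)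
  from smooth_on_sums_of_products[OF W this] show ?thesis by simp
qed

lemma smooth_on_sum:
  assumes W: "open W" and "\<And>i. i \<in> I \<Longrightarrow> smooth_on W (f i)"
  shows "smooth_on W (\<lambda>x. \<Sum>i\<in>I. f i x)"
  using assms(2)
proof (induction I rule: infinite_finite_induct)
  case (insert i I)
  then have "smooth_on W (\<lambda>x. f i x + (\<Sum>i\<in>I. f i x))" by (intro smooth_on_add[OF W]) simp_all
  then show ?case using insert by simp
qed (simp_all add: smooth_on_const[OF W])

text \<open>Differentiability is known only for the derivative in a fixed direction, so the variable direction is
expanded in the basis.\<close>

lemma smooth_on_directional_derivative:
  fixes f :: "'a::euclidean_space \<Rightarrow> 'b::euclidean_space"
  assumes W: "open W" and f: "smooth_on W f" and y: "smooth_on W y"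
  shows "smooth_on W (\<lambda>x. frechet_derivative f (at x) (y x))"
proof (rule smooth_on_cong[OF W])
  show "smooth_on W (\<lambda>x. \<Sum>b\<in>Basis. (y x \<bullet> b) *\<^sub>R frechet_derivative f (at x) b)"
    by (intro smooth_on_sum smooth_on_scaleR smooth_on_derivative W f
        smooth_on_linear[OF W y bounded_linear_inner_left])
  fix x assume "x \<in> W"
  then have lin: "linear (frechet_derivative f (at x))"
    using smooth_on_has_derivative[OF f W] has_derivative_linear by blast
  show "(\<Sum>b\<in>Basis. (y x \<bullet> b) *\<^sub>R frechet_derivative f (at x) b) = frechet_derivative f (at x) (y x)"
    using linear_sum[OF lin, of "\<lambda>b. (y x \<bullet> b) *\<^sub>R b" Basis]
    by (simp add: linear_scale[OF lin] euclidean_representation)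
qed

section \<open>Charts and uniqueness of solutions\<close>

text \<open>In positive dimension the images of the charts are open, so that derivatives within them are ordinary
derivatives.\<close>

locale positive_dim_manifold =
  fixes d :: nat and A :: "('m::{t2_space,second_countable_topology}, 'e::euclidean_space) chart set"
  assumes atlas: "smooth_atlas d A" and pos: "d \<noteq> 0"
begin

abbreviation img :: "('m, 'e) chart \<Rightarrow> 'e set" where "img c \<equiv> coord c ` dom_of c"

lemma chart_at: "\<exists>c\<in>A. p \<in> dom_of c"
  using atlas unfolding smooth_atlas_def by blast

lemma open_dom: "c \<in> A \<Longrightarrow> open (dom_of c)"
  and homeo: "c \<in> A \<Longrightarrow> homeomorphism (dom_of c) (img c) (coord c) (chart_inv c)"
  using atlas unfolding smooth_atlas_def by auto

lemma open_img: "c \<in> A \<Longrightarrow> open (img c)"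
  using atlas pos unfolding smooth_atlas_def model_space_def by auto

lemma chart_inv_coord [simp]: "c \<in> A \<Longrightarrow> p \<in> dom_of c \<Longrightarrow> chart_inv c (coord c p) = p"
  and coord_chart_inv: "c \<in> A \<Longrightarrow> x \<in> img c \<Longrightarrow> coord c (chart_inv c x) = x"
  and chart_inv_in_dom: "c \<in> A \<Longrightarrow> x \<in> img c \<Longrightarrow> chart_inv c x \<in> dom_of c"
  and continuous_on_coord: "c \<in> A \<Longrightarrow> continuous_on (dom_of c) (coord c)"
  and continuous_on_chart_inv: "c \<in> A \<Longrightarrow> continuous_on (img c) (chart_inv c)"
  using homeo[of c] unfolding homeomorphism_def by auto

lemma open_chart_preimage:
  assumes "c \<in> A" "open B"
  shows "open (dom_of c \<inter> coord c -` B)"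
  using continuous_open_preimage[OF continuous_on_coord open_dom] assms by blast

lemma open_chart_image:
  assumes c: "c \<in> A" and "open O'"
  shows "open (coord c ` (dom_of c \<inter> O'))"
proof -
  have "coord c ` (dom_of c \<inter> O') = img c \<inter> chart_inv c -` O'"
    using c by (auto simp: coord_chart_inv chart_inv_in_dom)
  then show ?thesis using continuous_open_preimage[OF continuous_on_chart_inv open_img] c assms(2) by simp
qed

definition C1_field :: "('m, 'e) vfield \<Rightarrow> bool" where
  "C1_field Y \<longleftrightarrow> (\<forall>c\<in>A. \<exists>f'. C1_deriv (img c) (local_rep Y c) f')"

lemma smooth_vfield_imp_C1_field: "smooth_vfield d A Y \<Longrightarrow> C1_field Y"
  unfolding C1_field_def smooth_vfield_def using smooth_on_imp_C1_deriv open_img by blast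

lemma C1_field_bounds:
  assumes "C1_field Y" "c \<in> A" "p \<in> dom_of c"
  obtains R f' L M where "R > 0" "cball (coord c p) R \<subseteq> img c" "C1_deriv (img c) (local_rep Y c) f'"
    "\<forall>y\<in>cball (coord c p) R. norm (f' y) \<le> L" "L \<ge> 0"
    "\<forall>y\<in>cball (coord c p) R. norm (local_rep Y c y) \<le> M" "M \<ge> 0"
proof -
  obtain f' where f': "C1_deriv (img c) (local_rep Y c) f'" using assms unfolding C1_field_def by blast
  obtain R where R: "R > 0" "cball (coord c p) R \<subseteq> img c"
    using open_img[OF assms(2)] assms(3) open_contains_cball by blast
  let ?K = "cball (coord c p) R"
  have "compact (f' ` ?K)" "compact (local_rep Y c ` ?K)"
    using compact_continuous_image[OF continuous_on_subset[OF C1_derivD(2)[OF f'] R(2)] compact_cball]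
      compact_continuous_image[OF continuous_on_subset[OF C1_deriv_imp_continuous_on[OF f'] R(2)] compact_cball]
    by auto
  then have "bounded (f' ` ?K)" "bounded (local_rep Y c ` ?K)" by (simp_all add: compact_imp_bounded)
  then obtain L M where LM: "\<forall>y\<in>?K. norm (f' y) \<le> L" "\<forall>y\<in>?K. norm (local_rep Y c y) \<le> M"
    unfolding bounded_iff by blast
  have "coord c p \<in> ?K" using R(1) by simp
  then have "L \<ge> 0" "M \<ge> 0" using LM norm_ge_zero order_trans by blast+
  then show ?thesis by (intro that[OF R f' LM(1) _ LM(2)])
qed

text \<open>This covers integral curves, with \<open>I = UNIV\<close> and no exceptional times, and trajectories, with
\<open>I = {0..}\<close>, where the equation is required only at positive times outside of a locally finite set.\<close>

definition solves :: "('m, 'e) vfield \<Rightarrow> real set \<Rightarrow> real set \<Rightarrow> (real \<Rightarrow> 'm) \<Rightarrow> bool" where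
  "solves Y I S \<gamma> \<longleftrightarrow> continuous_on I \<gamma> \<and>
    (\<forall>t\<in>interior I - S. \<forall>c\<in>A. \<gamma> t \<in> dom_of c \<longrightarrow>
      ((\<lambda>s. coord c (\<gamma> s)) has_vector_derivative Y (\<gamma> t) c) (at t))"

lemma curve_stays_near:
  fixes I :: "real set" and \<gamma> :: "real \<Rightarrow> 'm"
  assumes "continuous_on I \<gamma>" "s \<in> I" "\<gamma> s \<in> O'" "open O'"
  shows "\<exists>h>0. \<forall>t\<in>I. \<bar>t - s\<bar> < h \<longrightarrow> \<gamma> t \<in> O'"
proof -
  have "openin (top_of_set I) (I \<inter> \<gamma> -` O')"
    using assms by (simp add: continuous_openin_preimage_gen)
  then obtain h where "h > 0" "\<forall>t\<in>I. dist t s < h \<longrightarrow> t \<in> I \<inter> \<gamma> -` O'"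
    unfolding openin_euclidean_subtopology_iff using assms by (metis IntI vimageI)
  then show ?thesis by (auto simp: dist_real_def)
qed

text \<open>In a chart around the common point both curves stay in a ball on which the field has the Lipschitz
constant \<open>L\<close>. Their difference vanishes at the time \<open>s\<close>, so it vanishes as long as the estimate over
short times applies.\<close>

lemma solutions_agree_locally:
  assumes Y: "C1_field Y" and I: "is_interval I" and S: "\<And>a b. finite (S \<inter> {a..b})"
    and \<gamma>: "solves Y I S \<gamma>" and \<zeta>: "solves Y I S \<zeta>" and s: "s \<in> I" "\<gamma> s = \<zeta> s"
  shows "\<exists>h>0. \<forall>t\<in>I. \<bar>t - s\<bar> < h \<longrightarrow> \<gamma> t = \<zeta> t"
proof -
  obtain c where c: "c \<in> A" "\<gamma> s \<in> dom_of c" using chart_at by blast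
  let ?x0 = "coord c (\<gamma> s)" and ?f = "local_rep Y c"
  obtain R f' L where R: "R > 0" "cball ?x0 R \<subseteq> img c" and f': "C1_deriv (img c) ?f f'"
    and L: "\<forall>y\<in>cball ?x0 R. norm (f' y) \<le> L" "L \<ge> 0"
    using C1_field_bounds[OF Y c] by metis
  define O' where "O' = dom_of c \<inter> coord c -` ball ?x0 R"
  have O': "open O'" "\<gamma> s \<in> O'" "\<zeta> s \<in> O'"
    using open_chart_preimage[OF c(1)] c(2) R(1) s(2) by (auto simp: O'_def)
  have cont: "continuous_on I \<gamma>" "continuous_on I \<zeta>" using \<gamma> \<zeta> by (auto simp: solves_def)
  obtain h1 h2 where h1: "h1 > 0" "\<forall>t\<in>I. \<bar>t - s\<bar> < h1 \<longrightarrow> \<gamma> t \<in> O'" and h2: "h2 > 0" "\<forall>t\<in>I. \<bar>t - s\<bar> < h2 \<longrightarrow> \<zeta> t \<in> O'"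
    using curve_stays_near[OF cont(1) s(1) O'(2,1)] curve_stays_near[OF cont(2) s(1) O'(3,1)] by blast
  define h where "h = min (min h1 h2) (1 / (2 * (L + 1)))"
  have h: "h > 0" using h1 h2 L(2) by (simp add: h_def)
  have "\<gamma> t = \<zeta> t" if t: "t \<in> I" "\<bar>t - s\<bar> < h" for t
  proof -
    let ?a = "min s t" and ?b = "max s t"
    have sub: "r \<in> I" "\<bar>r - s\<bar> < h" if "r \<in> {?a..?b}" for r
    proof -
      show "r \<in> I" using that s(1) t(1) I unfolding is_interval_1 by (smt (verit) atLeastAtMost_iff)
      show "\<bar>r - s\<bar> < h" using that t(2) by auto
    qed
    have inO: "\<gamma> r \<in> O'" "\<zeta> r \<in> O'" if "r \<in> {?a..?b}" for r
      using h1(2) h2(2) sub[OF that] by (auto simp: h_def)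
    define w where "w r = coord c (\<gamma> r) - coord c (\<zeta> r)" for r
    define w' where "w' r = ?f (coord c (\<gamma> r)) - ?f (coord c (\<zeta> r))" for r
    have "norm (w t) \<le> 2 * norm (w s) + 2 * (?b - ?a) * 0"
    proof (rule short_time_bound[where S = "S \<inter> {?a..?b}" and L = L and w' = w'])
      have "continuous_on {?a..?b} (\<lambda>r. coord c (\<gamma> r))"
        by (rule continuous_on_compose2[OF continuous_on_coord[OF c(1)] continuous_on_subset[OF cont(1)]])
          (use sub inO in \<open>auto simp: O'_def\<close>)
      moreover have "continuous_on {?a..?b} (\<lambda>r. coord c (\<zeta> r))"
        by (rule continuous_on_compose2[OF continuous_on_coord[OF c(1)] continuous_on_subset[OF cont(2)]])
          (use sub inO in \<open>auto simp: O'_def\<close>)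
      ultimately show "continuous_on {?a..?b} w" unfolding w_def by (intro continuous_intros)
    next
      fix r assume r: "r \<in> {?a<..<?b} - S \<inter> {?a..?b}"
      then have r': "r \<in> {?a..?b}" "r \<notin> S" by auto
      have "{?a<..<?b} \<subseteq> interior I"
        using sub(1) by (intro interior_maximal) auto
      then have ri: "r \<in> interior I - S" using r r' by blast
      have dom: "\<gamma> r \<in> dom_of c" "\<zeta> r \<in> dom_of c" using inO[OF r'(1)] by (auto simp: O'_def)
      have Y_eq: "Y (\<gamma> r) c = ?f (coord c (\<gamma> r))" "Y (\<zeta> r) c = ?f (coord c (\<zeta> r))"
        using dom c(1) by (auto simp: local_rep_def)
      have "((\<lambda>s. coord c (\<gamma> s)) has_vector_derivative Y (\<gamma> r) c) (at r)"
        "((\<lambda>s. coord c (\<zeta> s)) has_vector_derivative Y (\<zeta> r) c) (at r)"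
        using \<gamma> \<zeta> ri c(1) dom unfolding solves_def by blast+
      then show "(w has_vector_derivative w' r) (at r)"
        unfolding w_def w'_def Y_eq by (rule has_vector_derivative_diff)
      have "norm (?f (coord c (\<gamma> r)) - ?f (coord c (\<zeta> r))) \<le> L * norm (coord c (\<gamma> r) - coord c (\<zeta> r))"
      proof (rule C1_lipschitz_on_convex[OF f' convex_cball R(2)])
        show "coord c (\<gamma> r) \<in> cball ?x0 R" "coord c (\<zeta> r) \<in> cball ?x0 R"
          using inO[OF r'(1)] by (auto simp: O'_def)
      qed (use L in blast)
      then show "norm (w' r) \<le> L * norm (w r) + 0" by (simp add: w_def w'_def)
    next
      have "L * (?b - ?a) \<le> L * (1 / (2 * (L + 1)))"
        using t(2) L(2) by (intro mult_left_mono) (auto simp: h_def)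
      also have "\<dots> \<le> 1/2" using L(2) by (simp add: field_simps)
      finally show "L * (?b - ?a) \<le> 1/2" .
    qed (use S L(2) in auto)
    then have eq: "coord c (\<gamma> t) = coord c (\<zeta> t)" using s(2) by (simp add: w_def)
    have "\<gamma> t \<in> dom_of c" "\<zeta> t \<in> dom_of c" using inO[of t] by (auto simp: O'_def)
    then show ?thesis using eq chart_inv_coord[OF c(1)] by metis
  qed
  then show ?thesis using h by blast
qed

text \<open>The set of times at which the curves agree is open by local uniqueness, closed by the Hausdorff
property, and nonempty.\<close>

lemma solutions_unique:
  assumes Y: "C1_field Y" and I: "is_interval I" and S: "\<And>a b. finite (S \<inter> {a..b})"
    and \<gamma>: "solves Y I S \<gamma>" and \<zeta>: "solves Y I S \<zeta>" and s: "s \<in> I" "\<gamma> s = \<zeta> s" and t: "t \<in> I"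
  shows "\<gamma> t = \<zeta> t"
proof -
  let ?E = "{t \<in> I. \<gamma> t = \<zeta> t}"
  have "openin (top_of_set I) ?E"
    unfolding openin_euclidean_subtopology_iff
  proof (intro conjI ballI)
    fix r assume "r \<in> ?E"
    then obtain h where "h > 0" "\<forall>t\<in>I. \<bar>t - r\<bar> < h \<longrightarrow> \<gamma> t = \<zeta> t"
      using solutions_agree_locally[OF Y I S \<gamma> \<zeta>] by blast
    then show "\<exists>e>0. \<forall>x'\<in>I. dist x' r < e \<longrightarrow> x' \<in> ?E" by (auto simp: dist_real_def)
  qed blast
  moreover have "closedin (top_of_set I) ?E"
  proof -
    have "continuous_on I (\<lambda>t. (\<gamma> t, \<zeta> t))"
      using \<gamma> \<zeta> by (intro continuous_on_Pair) (auto simp: solves_def)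
    then have "closedin (top_of_set I) (I \<inter> (\<lambda>t. (\<gamma> t, \<zeta> t)) -` {y. \<exists>x. y = (x, x)})"
      by (rule continuous_closedin_preimage[OF _ closed_diagonal])
    moreover have "I \<inter> (\<lambda>t. (\<gamma> t, \<zeta> t)) -` {y. \<exists>x. y = (x, x)} = ?E" by auto
    ultimately show ?thesis by simp
  qed
  moreover have "connected I" using I by (simp add: is_interval_connected)
  ultimately have "?E = {} \<or> ?E = I" unfolding connected_clopen by blast
  then show ?thesis using s t by blast
qed

section \<open>Flows\<close>

lemma integral_curve_iff_solves: "integral_curve A Y \<gamma> \<longleftrightarrow> solves Y UNIV {} \<gamma>"
  unfolding integral_curve_def solves_def by auto

lemma integral_curve_unique:
  assumes "C1_field Y" "integral_curve A Y \<gamma>" "integral_curve A Y \<zeta>" "\<gamma> 0 = \<zeta> 0"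
  shows "\<gamma> = \<zeta>"
proof
  fix t show "\<gamma> t = \<zeta> t"
    using assms unfolding integral_curve_iff_solves
    by (intro solutions_unique[of Y UNIV "{}" \<gamma> \<zeta> 0 t]) auto
qed

lemma flow_eq_integral_curve:
  assumes "C1_field Y" "integral_curve A Y \<gamma>" "\<gamma> 0 = p"
  shows "flow A Y t p = \<gamma> t"
proof -
  have "(THE \<gamma>. integral_curve A Y \<gamma> \<and> \<gamma> 0 = p) = \<gamma>"
    using assms integral_curve_unique[OF assms(1)] by (intro the_equality) auto
  then show ?thesis by (simp add: flow_def)
qed

definition flowing :: "('m, 'e) vfield \<Rightarrow> bool" where
  "flowing Y \<longleftrightarrow> C1_field Y \<and> complete_vfield A Y"

lemma integral_curve_flow:
  assumes "flowing Y"
  shows "integral_curve A Y (\<lambda>t. flow A Y t p)" "flow A Y 0 p = p"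
proof -
  obtain \<gamma> where \<gamma>: "integral_curve A Y \<gamma>" "\<gamma> 0 = p"
    using assms unfolding flowing_def complete_vfield_def by blast
  have "flow A Y t p = \<gamma> t" for t
    using assms \<gamma> flow_eq_integral_curve by (auto simp: flowing_def)
  then show "integral_curve A Y (\<lambda>t. flow A Y t p)" "flow A Y 0 p = p"
    using \<gamma> by simp_all
qed

lemma flow_add:
  assumes Y: "flowing Y"
  shows "flow A Y (s + t) p = flow A Y s (flow A Y t p)"
proof -
  let ?\<gamma> = "\<lambda>s. flow A Y (s + t) p"
  note * = integral_curve_flow[OF Y]
  have "integral_curve A Y ?\<gamma>"
    unfolding integral_curve_def
  proof (intro conjI allI ballI impI)
    have "continuous_on UNIV (\<lambda>t. flow A Y t p)" using *(1)[of p] by (simp add: integral_curve_def)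
    then show "continuous_on UNIV ?\<gamma>"
      by (rule continuous_on_compose2) (auto intro!: continuous_intros)
    fix r c assume c: "c \<in> A" "?\<gamma> r \<in> dom_of c"
    then have "((\<lambda>s. coord c (flow A Y s p)) has_vector_derivative Y (?\<gamma> r) c) (at (r + t))"
      using *(1)[of p] by (simp add: integral_curve_def)
    moreover have "((\<lambda>s. s + t) has_vector_derivative 1) (at r)"
      by (auto intro!: derivative_eq_intros)
    ultimately have "((\<lambda>s. coord c (flow A Y s p)) \<circ> (\<lambda>s. s + t) has_vector_derivative 1 *\<^sub>R Y (?\<gamma> r) c) (at r)"
      by (intro vector_diff_chain_at)
    then show "((\<lambda>s. coord c (?\<gamma> s)) has_vector_derivative Y (?\<gamma> r) c) (at r)"
      by (simp add: o_def)
  qed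
  then show ?thesis
    using flow_eq_integral_curve[of Y ?\<gamma> "flow A Y t p" s] Y by (simp add: flowing_def)
qed

text \<open>A curve of speed at most \<open>M\<close> that starts within \<open>R/2\<close> of the centre needs more than the time \<open>\<bar>t\<bar>\<close> to
leave the ball of radius \<open>R\<close>. Rescaling the time to \<open>{0..1}\<close> treats both signs of \<open>t\<close> at once.\<close>

lemma flow_stays_in_chart:
  assumes Y: "flowing Y" and c: "c \<in> A" "p0 \<in> dom_of c"
    and R: "R > 0" "cball (coord c p0) R \<subseteq> img c"
    and M: "\<forall>y\<in>cball (coord c p0) R. norm (local_rep Y c y) \<le> M"
    and x: "x \<in> ball (coord c p0) (R/2)" and t: "\<bar>t\<bar> * M < R/2"
  shows "flow A Y t (chart_inv c x) \<in> dom_of c" "coord c (flow A Y t (chart_inv c x)) \<in> ball (coord c p0) R"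
proof -
  let ?x0 = "coord c p0" and ?f = "local_rep Y c"
  define \<gamma> where "\<gamma> r = flow A Y (r * t) (chart_inv c x)" for r
  define O' where "O' = dom_of c \<inter> coord c -` ball ?x0 R"
  have O': "open O'" using open_chart_preimage[OF c(1)] by (simp add: O'_def)
  have flow_cont: "continuous_on UNIV (\<lambda>t. flow A Y t (chart_inv c x))"
    using integral_curve_flow(1)[OF Y] by (simp add: integral_curve_def)
  have cont: "continuous_on UNIV \<gamma>"
    unfolding \<gamma>_def by (rule continuous_on_compose2[OF flow_cont]) (auto intro!: continuous_intros)
  have x_img: "x \<in> img c" using x R by auto
  then have \<gamma>0: "\<gamma> 0 = chart_inv c x" using integral_curve_flow(2)[OF Y] by (simp add: \<gamma>_def)
  have y0: "coord c (\<gamma> 0) = x" unfolding \<gamma>0 using c(1) x_img by (rule coord_chart_inv)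
  have "\<gamma> 1 \<in> O'"
  proof (rule ccontr)
    assume bad: "\<gamma> 1 \<notin> O'"
    define S where "S = {0..1} \<inter> \<gamma> -` (- O')"
    have "closed (\<gamma> -` (- O'))" using cont O' by (intro closed_vimage) (auto simp: closed_Compl)
    then have S: "closed S" unfolding S_def by (intro closed_Int) auto
    have "1 \<in> S" using bad by (simp add: S_def)
    then have "S \<noteq> {}" by blast
    have "bdd_below S" by (rule bdd_belowI[of _ 0]) (simp add: S_def)
    \<comment> \<open>The first time at which the curve is outside of the chart ball.\<close>
    define r1 where "r1 = Inf S"
    have r1: "r1 \<in> S" unfolding r1_def using closed_contains_Inf[OF \<open>S \<noteq> {}\<close> \<open>bdd_below S\<close> S] .
    have before: "\<gamma> r \<in> O'" if "0 \<le> r" "r < r1" for r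
    proof (rule ccontr)
      assume "\<gamma> r \<notin> O'"
      then have "r \<in> S" using that r1 by (auto simp: S_def)
      then have "r1 \<le> r" unfolding r1_def using \<open>bdd_below S\<close> by (rule cInf_lower)
      then show False using that by simp
    qed
    have "\<gamma> 0 \<in> O'" using y0 x R c(1) x_img chart_inv_in_dom unfolding O'_def \<gamma>0 by auto
    then have "r1 \<noteq> 0" using r1 by (auto simp: S_def)
    then have r1_pos: "0 < r1" "r1 \<le> 1" using r1 by (auto simp: S_def)
    define K where "K = chart_inv c ` cball ?x0 R"
    have "compact K" unfolding K_def
      using continuous_on_subset[OF continuous_on_chart_inv[OF c(1)] R(2)] compact_cball by (rule compact_continuous_image)
    then have K: "closed K" by (rule compact_imp_closed)
    have O'K: "O' \<subseteq> K"
    proof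
      fix q assume "q \<in> O'"
      then have "coord c q \<in> cball ?x0 R" "q = chart_inv c (coord c q)" using c(1) by (auto simp: O'_def)
      then show "q \<in> K" unfolding K_def by blast
    qed
    have "closed (\<gamma> -` K)" using cont K by (intro closed_vimage)
    moreover have "{0..<r1} \<subseteq> \<gamma> -` K" using before O'K by (auto simp: subset_iff)
    ultimately have "closure {0..<r1} \<subseteq> \<gamma> -` K" by (rule closure_minimal[rotated])
    then have inK: "\<gamma> r \<in> K" if "r \<in> {0..r1}" for r
      using that r1_pos by auto
    have Kdom: "q \<in> dom_of c" "coord c q \<in> cball ?x0 R" if q: "q \<in> K" for q
    proof -
      obtain z where z: "z \<in> cball ?x0 R" "q = chart_inv c z" using q by (auto simp: K_def)
      then have "z \<in> img c" using R(2) by blast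
      then show "q \<in> dom_of c" "coord c q \<in> cball ?x0 R"
        using z c(1) by (simp_all only: chart_inv_in_dom coord_chart_inv)
    qed
    let ?y = "\<lambda>r. coord c (\<gamma> r)"
    have y_cont: "continuous_on {0..r1} ?y"
      by (rule continuous_on_compose2[OF continuous_on_coord[OF c(1)] continuous_on_subset[OF cont]])
        (use inK Kdom in auto)
    have y_der: "(?y has_derivative (\<lambda>h. h *\<^sub>R t *\<^sub>R ?f (?y r))) (at r)" if "r \<in> {0<..<r1}" for r
    proof -
      have dom: "\<gamma> r \<in> dom_of c" using that inK Kdom by auto
      then have "((\<lambda>s. coord c (flow A Y s (chart_inv c x))) has_vector_derivative Y (\<gamma> r) c) (at (r * t))"
        using integral_curve_flow(1)[OF Y, of "chart_inv c x"] c(1) by (simp add: integral_curve_def \<gamma>_def)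
      moreover have "((\<lambda>s. s * t) has_vector_derivative t) (at r)"
        by (auto intro!: derivative_eq_intros simp: has_vector_derivative_def)
      ultimately have "((\<lambda>s. coord c (flow A Y s (chart_inv c x))) \<circ> (\<lambda>s. s * t) has_vector_derivative t *\<^sub>R Y (\<gamma> r) c) (at r)"
        by (intro vector_diff_chain_at)
      moreover have "Y (\<gamma> r) c = ?f (?y r)" using dom c(1) by (simp add: local_rep_def)
      ultimately show ?thesis by (simp add: o_def \<gamma>_def has_vector_derivative_def)
    qed
    obtain r where r: "r \<in> {0<..<r1}" "norm (?y r1 - ?y 0) \<le> norm ((r1 - 0) *\<^sub>R t *\<^sub>R ?f (?y r))"
      using mvt_general[OF r1_pos(1) y_cont y_der] by auto
    have fM: "norm (?f (?y r)) \<le> M" using M Kdom(2)[OF inK[of r]] r(1) by auto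
    have "norm ((r1 - 0) *\<^sub>R t *\<^sub>R ?f (?y r)) = r1 * (\<bar>t\<bar> * norm (?f (?y r)))" using r1_pos by (simp add: abs_mult)
    also have "\<dots> \<le> 1 * (\<bar>t\<bar> * norm (?f (?y r)))" using r1_pos by (intro mult_right_mono) auto
    also have "\<dots> \<le> \<bar>t\<bar> * M" using mult_left_mono[OF fM, of "\<bar>t\<bar>"] by simp
    finally have "norm (?y r1 - x) < R/2" using r(2) t unfolding y0 by linarith
    then have "dist x (?y r1) < R/2" by (simp add: dist_norm norm_minus_commute)
    then have "dist ?x0 (?y r1) < R" using x dist_triangle[of ?x0 "?y r1" x] by simp
    moreover have "\<gamma> r1 \<in> dom_of c" using Kdom(1) inK r1_pos by simp
    ultimately have "\<gamma> r1 \<in> O'" by (simp add: O'_def)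
    then show False using r1 by (simp add: S_def)
  qed
  then show "flow A Y t (chart_inv c x) \<in> dom_of c" "coord c (flow A Y t (chart_inv c x)) \<in> ball ?x0 R"
    by (simp_all add: \<gamma>_def O'_def)
qed

lemma flow_C1_for_small_times:
  assumes Y: "flowing Y" and c: "c \<in> A" "p0 \<in> dom_of c"
  shows "\<exists>B \<delta> \<Phi>'. open B \<and> coord c p0 \<in> B \<and> B \<subseteq> img c \<and> \<delta> > 0 \<and>
    (\<forall>x\<in>B. \<forall>t. \<bar>t\<bar> < \<delta> \<longrightarrow> flow A Y t (chart_inv c x) \<in> dom_of c) \<and>
    C1_deriv (B \<times> {-\<delta><..<\<delta>}) (\<lambda>(x, t). coord c (flow A Y t (chart_inv c x))) \<Phi>' \<and>
    (\<forall>x\<in>B. \<forall>v s. blinfun_apply (\<Phi>' (x, 0)) (v, s) = v + s *\<^sub>R local_rep Y c x)"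
proof -
  let ?x0 = "coord c p0" and ?f = "local_rep Y c"
  have "C1_field Y" using Y by (simp add: flowing_def)
  obtain R f' L M where R: "R > 0" "cball ?x0 R \<subseteq> img c" and f': "C1_deriv (img c) ?f f'"
    and L: "\<forall>y\<in>cball ?x0 R. norm (f' y) \<le> L" "L \<ge> 0"
    and M: "\<forall>y\<in>cball ?x0 R. norm (?f y) \<le> M" "M \<ge> 0"
    using C1_field_bounds[OF \<open>C1_field Y\<close> c] by metis
  \<comment> \<open>The first bound keeps solutions from the smaller ball in the chart, the second makes the time short
    with respect to the Lipschitz constant.\<close>
  define \<delta> where "\<delta> = min (R / (2 * (M + 1))) (1 / (2 * (L + 1)))"
  have \<delta>: "\<delta> > 0" using R L(2) M(2) by (simp add: \<delta>_def)
  have tM: "\<bar>t\<bar> * M < R/2" if "\<bar>t\<bar> < \<delta>" for t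
  proof -
    have "\<bar>t\<bar> * M \<le> \<bar>t\<bar> * (M + 1)" by (intro mult_left_mono) auto
    also have "\<dots> < R / (2 * (M + 1)) * (M + 1)" using that M(2) by (intro mult_strict_right_mono) (auto simp: \<delta>_def)
    also have "\<dots> = R/2"
    proof -
      have "r / (2 * k) * k = r / 2" if "k > 0" for r k :: real using that by simp
      then show ?thesis using M(2) by (simp only: add_nonneg_pos zero_less_one)
    qed
    finally show ?thesis .
  qed
  let ?B = "ball ?x0 (R/2)" and ?\<phi> = "\<lambda>t x. coord c (flow A Y t (chart_inv c x))"
  note stays = flow_stays_in_chart[OF Y c R M(1) _ tM]
  have B_img: "?B \<subseteq> img c" using R by auto
  interpret short_flow "img c" "cball ?x0 R" ?B ?f f' ?\<phi> L \<delta>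
  proof
    have "L * \<delta> \<le> L * (1 / (2 * (L + 1)))" using L(2) by (intro mult_left_mono) (auto simp: \<delta>_def)
    also have "\<dots> \<le> 1/2" using L(2) by (simp add: field_simps)
    finally show "L * \<delta> \<le> 1/2" .
    fix x t assume x: "x \<in> ?B" and t: "\<bar>t\<bar> < \<delta>"
    show "?\<phi> t x \<in> cball ?x0 R" using stays(2)[OF x t] by simp
    have dom: "flow A Y t (chart_inv c x) \<in> dom_of c" by (rule stays(1)[OF x t])
    then have "((\<lambda>s. ?\<phi> s x) has_vector_derivative Y (flow A Y t (chart_inv c x)) c) (at t)"
      using integral_curve_flow(1)[OF Y, of "chart_inv c x"] c(1) by (simp add: integral_curve_def)
    then show "((\<lambda>s. ?\<phi> s x) has_vector_derivative ?f (?\<phi> t x)) (at t)"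
      using dom c(1) by (simp add: local_rep_def)
  next
    fix x assume "x \<in> ?B"
    then have "x \<in> img c" using B_img by blast
    then show "?\<phi> 0 x = x" using integral_curve_flow(2)[OF Y] coord_chart_inv[OF c(1)] by simp
  qed (use f' R L \<delta> in auto)
  obtain \<Phi>' where "C1_deriv (?B \<times> {-\<delta><..<\<delta>}) (\<lambda>(x, t). ?\<phi> t x) \<Phi>'"
    "\<forall>x\<in>?B. \<forall>v s. blinfun_apply (\<Phi>' (x, 0)) (v, s) = v + s *\<^sub>R ?f x"
    using C1_deriv_flow by blast
  moreover have "?x0 \<in> ?B" using R by simp
  ultimately show ?thesis
    using B_img \<delta> stays(1) by (intro exI[of _ ?B] exI[of _ \<delta>] exI[of _ \<Phi>']) simp
qed

section \<open>Differentiability of the flow maps on the manifold\<close>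

text \<open>The neighbourhood \<open>N\<close> is part of the statement because \<open>g\<close> need not map the whole domain of \<open>c\<close> into that
of \<open>c'\<close>.\<close>

definition C1_between :: "('m, 'e) chart \<Rightarrow> ('m, 'e) chart \<Rightarrow> ('m \<Rightarrow> 'm) \<Rightarrow> 'm \<Rightarrow> bool" where
  "C1_between c c' g p \<longleftrightarrow> (\<exists>N D. open N \<and> coord c p \<in> N \<and> N \<subseteq> img c \<and>
     (\<forall>x\<in>N. g (chart_inv c x) \<in> dom_of c') \<and> C1_deriv N (\<lambda>x. coord c' (g (chart_inv c x))) D)"

text \<open>Quantifying over all pairs of charts makes composition immediate; as transition maps are smooth, one
pair is enough to verify it (\<open>C1_at_if_between\<close>).\<close>

definition C1_at :: "('m \<Rightarrow> 'm) \<Rightarrow> 'm \<Rightarrow> bool" where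
  "C1_at g p \<longleftrightarrow> (\<forall>c\<in>A. p \<in> dom_of c \<longrightarrow> (\<forall>c'\<in>A. g p \<in> dom_of c' \<longrightarrow> C1_between c c' g p))"

lemma C1_between_compose:
  assumes c: "c \<in> A" "c' \<in> A" and g: "C1_between c c' g p" and h: "C1_between c' c'' h (g p)" and p: "p \<in> dom_of c"
  shows "C1_between c c'' (\<lambda>q. h (g q)) p"
proof -
  obtain N1 D1 where 1: "open N1" "coord c p \<in> N1" "N1 \<subseteq> img c" "\<forall>x\<in>N1. g (chart_inv c x) \<in> dom_of c'"
    "C1_deriv N1 (\<lambda>x. coord c' (g (chart_inv c x))) D1"
    using g unfolding C1_between_def by blast
  obtain N2 D2 where 2: "open N2" "coord c' (g p) \<in> N2" "N2 \<subseteq> img c'" "\<forall>x\<in>N2. h (chart_inv c' x) \<in> dom_of c''"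
    "C1_deriv N2 (\<lambda>x. coord c'' (h (chart_inv c' x))) D2"
    using h unfolding C1_between_def by blast
  let ?G = "\<lambda>x. coord c' (g (chart_inv c x))" and ?H = "\<lambda>x. coord c'' (h (chart_inv c' x))"
  define N where "N = N1 \<inter> ?G -` N2"
  have N: "open N" unfolding N_def
    using continuous_open_preimage[OF C1_deriv_imp_continuous_on[OF 1(5)] 1(1) 2(1)] .
  have eq: "chart_inv c' (?G x) = g (chart_inv c x)" if "x \<in> N" for x
    using that 1(4) c(2) by (auto simp: N_def)
  have "C1_deriv N (?H \<circ> ?G) (\<lambda>x. D2 (?G x) o\<^sub>L D1 x)"
    by (rule C1_deriv_compose[OF 2(5) C1_deriv_subset[OF 1(5)]]) (auto simp: N_def)
  then have "C1_deriv N (\<lambda>x. coord c'' (h (g (chart_inv c x)))) (\<lambda>x. D2 (?G x) o\<^sub>L D1 x)"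
    by (rule C1_deriv_cong[OF _ N]) (simp add: eq)
  moreover have "coord c p \<in> N" using 1(2) 2(2) c(1) p by (simp add: N_def)
  moreover have "N \<subseteq> img c" using 1(3) by (auto simp: N_def)
  moreover have "\<forall>x\<in>N. h (g (chart_inv c x)) \<in> dom_of c''"
  proof
    fix x assume x: "x \<in> N"
    then have "?G x \<in> N2" by (simp add: N_def)
    then show "h (g (chart_inv c x)) \<in> dom_of c''" using 2(4) eq[OF x] by metis
  qed
  ultimately show ?thesis unfolding C1_between_def using N by blast
qed

lemma open_overlap: "c \<in> A \<Longrightarrow> c' \<in> A \<Longrightarrow> open (coord c ` (dom_of c \<inter> dom_of c'))"
  using open_chart_image open_dom by blast

lemma smooth_on_transition: "c \<in> A \<Longrightarrow> c' \<in> A \<Longrightarrow> smooth_on (coord c ` (dom_of c \<inter> dom_of c')) (transition c c')"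
  using atlas unfolding smooth_atlas_def by blast

lemma C1_between_id:
  assumes c: "c \<in> A" "c' \<in> A" and p: "p \<in> dom_of c" "p \<in> dom_of c'"
  shows "C1_between c c' (\<lambda>q. q) p"
proof -
  let ?N = "coord c ` (dom_of c \<inter> dom_of c')"
  have "C1_deriv ?N (transition c c') (\<lambda>x. Blinfun (frechet_derivative (transition c c') (at x)))"
    by (rule smooth_on_imp_C1_deriv[OF smooth_on_transition[OF c] open_overlap[OF c]])
  then have "C1_deriv ?N (\<lambda>x. coord c' (chart_inv c x)) (\<lambda>x. Blinfun (frechet_derivative (transition c c') (at x)))"
    by (simp add: transition_def o_def)
  moreover have "\<forall>x\<in>?N. chart_inv c x \<in> dom_of c'" using c by auto
  moreover have "coord c p \<in> ?N" "?N \<subseteq> img c" using p by auto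
  ultimately show ?thesis unfolding C1_between_def using open_overlap[OF c] by blast
qed

lemma C1_at_if_between:
  assumes c: "c \<in> A" "c' \<in> A" and p: "p \<in> dom_of c" "g p \<in> dom_of c'" and g: "C1_between c c' g p"
  shows "C1_at g p"
  unfolding C1_at_def
proof (intro ballI impI)
  fix b b' assume b: "b \<in> A" "p \<in> dom_of b" "b' \<in> A" "g p \<in> dom_of b'"
  have "C1_between b c' (\<lambda>q. g q) p"
    by (rule C1_between_compose[OF b(1) c(1) C1_between_id g]) (use b c p in auto)
  then have "C1_between b b' (\<lambda>q. g q) p"
    by (rule C1_between_compose[OF b(1) c(2) _ C1_between_id, of g p b']) (use b c p in auto)
  then show "C1_between b b' g p" by simp
qed

lemma C1_at_compose:
  assumes g: "C1_at g p" and h: "C1_at h (g p)"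
  shows "C1_at (\<lambda>q. h (g q)) p"
proof -
  obtain c c' c'' where c: "c \<in> A" "p \<in> dom_of c" "c' \<in> A" "g p \<in> dom_of c'" "c'' \<in> A" "h (g p) \<in> dom_of c''"
    using chart_at by meson
  have "C1_between c c'' (\<lambda>q. h (g q)) p"
    by (rule C1_between_compose[OF c(1,3) _ _ c(2)]) (use g h c in \<open>auto simp: C1_at_def\<close>)
  then show ?thesis
    using C1_at_if_between[of c c'' p "\<lambda>q. h (g q)"] c by simp
qed

lemma C1_at_imp_isCont:
  assumes g: "C1_at g p"
  shows "isCont g p"
proof -
  obtain c c' where c: "c \<in> A" "p \<in> dom_of c" "c' \<in> A" "g p \<in> dom_of c'" using chart_at by meson
  then have "C1_between c c' g p" using g unfolding C1_at_def by blast
  then obtain N D where N: "open N" "coord c p \<in> N" "N \<subseteq> img c" "\<forall>x\<in>N. g (chart_inv c x) \<in> dom_of c'"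
    "C1_deriv N (\<lambda>x. coord c' (g (chart_inv c x))) D"
    unfolding C1_between_def by blast
  let ?O = "dom_of c \<inter> coord c -` N" and ?G = "\<lambda>x. coord c' (g (chart_inv c x))"
  have "continuous_on ?O (\<lambda>q. ?G (coord c q))"
    by (rule continuous_on_compose2[OF C1_deriv_imp_continuous_on[OF N(5)] continuous_on_subset[OF continuous_on_coord[OF c(1)]]]) auto
  then have "continuous_on ?O (\<lambda>q. chart_inv c' (?G (coord c q)))"
    by (rule continuous_on_compose2[OF continuous_on_chart_inv[OF c(3)]]) (use N(4) in auto)
  moreover have "chart_inv c' (?G (coord c q)) = g q" if "q \<in> ?O" for q
    using that N(4) c(1,3) by (metis IntD1 IntD2 chart_inv_coord vimageD)
  ultimately have "continuous_on ?O g" by (rule continuous_on_eq)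
  moreover have "open ?O" "p \<in> ?O" using open_chart_preimage[OF c(1) N(1)] c(2) N(2) by auto
  ultimately show ?thesis by (simp add: continuous_on_eq_continuous_at)
qed

lemma flow_C1_at_nearby:
  assumes Y: "flowing Y"
  shows "\<exists>O' \<delta>. open O' \<and> p0 \<in> O' \<and> \<delta> > 0 \<and> (\<forall>p\<in>O'. \<forall>t. \<bar>t\<bar> < \<delta> \<longrightarrow> C1_at (flow A Y t) p)"
proof -
  obtain c where c: "c \<in> A" "p0 \<in> dom_of c" using chart_at by blast
  obtain B \<delta> \<Phi>' where B: "open B" "coord c p0 \<in> B" "B \<subseteq> img c" "\<delta> > 0"
    "\<forall>x\<in>B. \<forall>t. \<bar>t\<bar> < \<delta> \<longrightarrow> flow A Y t (chart_inv c x) \<in> dom_of c"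
    and \<Phi>: "C1_deriv (B \<times> {-\<delta><..<\<delta>}) (\<lambda>(x, t). coord c (flow A Y t (chart_inv c x))) \<Phi>'"
    using flow_C1_for_small_times[OF Y c] by blast
  let ?O = "dom_of c \<inter> coord c -` B"
  have "C1_at (flow A Y t) p" if p: "p \<in> ?O" and t: "\<bar>t\<bar> < \<delta>" for p t
  proof -
    let ?i = "Blinfun (\<lambda>v::'e. (v, 0::real))"
    have i: "blinfun_apply ?i = (\<lambda>v. (v, 0))"
      by (intro bounded_linear_Blinfun_apply bounded_linear_intros)
    have "C1_deriv B (\<lambda>x. (x, t)) (\<lambda>x. ?i)"
      unfolding C1_deriv_def i by (auto intro!: derivative_eq_intros continuous_intros)
    moreover have "(\<lambda>x. (x, t)) ` B \<subseteq> B \<times> {-\<delta><..<\<delta>}" using t by auto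
    ultimately have "C1_deriv B ((\<lambda>(x, t). coord c (flow A Y t (chart_inv c x))) \<circ> (\<lambda>x. (x, t)))
        (\<lambda>x. \<Phi>' (x, t) o\<^sub>L ?i)"
      by (rule C1_deriv_compose[OF \<Phi>])
    then have "C1_deriv B (\<lambda>x. coord c (flow A Y t (chart_inv c x))) (\<lambda>x. \<Phi>' (x, t) o\<^sub>L ?i)"
      by (simp add: o_def)
    then have "C1_between c c (flow A Y t) p"
      unfolding C1_between_def using B t p by blast
    moreover have "flow A Y t p \<in> dom_of c" using B(5) p t c(1) by (metis IntD1 IntD2 chart_inv_coord vimageD)
    ultimately show ?thesis using c p by (intro C1_at_if_between[of c c]) auto
  qed
  moreover have "open ?O" "p0 \<in> ?O" using open_chart_preimage[OF c(1) B(1)] c(2) B(2) by auto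
  ultimately show ?thesis using B(4) by blast
qed

lemma flow_C1_at_short_times:
  assumes Y: "flowing Y" and comp: "compact (UNIV :: 'm set)"
  shows "\<exists>\<delta>>0. \<forall>p t. \<bar>t\<bar> < \<delta> \<longrightarrow> C1_at (flow A Y t) p"
proof -
  obtain O' \<delta> where O': "\<And>p0. open (O' p0)" "\<And>p0. p0 \<in> O' p0" "\<And>p0. \<delta> p0 > (0::real)"
    "\<And>p0 p t. p \<in> O' p0 \<Longrightarrow> \<bar>t\<bar> < \<delta> p0 \<Longrightarrow> C1_at (flow A Y t) p"
    using flow_C1_at_nearby[OF Y] by metis
  have cover: "UNIV \<subseteq> (\<Union>p0\<in>UNIV. O' p0)" using O'(2) by blast
  obtain I where I: "finite I" "UNIV \<subseteq> (\<Union>p0\<in>I. O' p0)"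
    using compactE_image[OF comp O'(1) cover] by metis
  have "I \<noteq> {}" using I(2) by auto
  define \<delta>' where "\<delta>' = Min (\<delta> ` I)"
  have "\<delta>' > 0" unfolding \<delta>'_def using I(1) \<open>I \<noteq> {}\<close> O'(3) by simp
  moreover have "C1_at (flow A Y t) p" if t: "\<bar>t\<bar> < \<delta>'" for p t
  proof -
    obtain p0 where p0: "p0 \<in> I" "p \<in> O' p0" using I(2) by blast
    have "\<delta>' \<le> \<delta> p0" unfolding \<delta>'_def using I(1) p0(1) by simp
    then show ?thesis using O'(4) p0(2) t by simp
  qed
  ultimately show ?thesis by blast
qed

text \<open>The flow over the time \<open>t\<close> is an iterate of the flow over \<open>t / n\<close>, which is short enough for large
\<open>n\<close>.\<close>

lemma flow_C1_at:
  assumes Y: "flowing Y" and comp: "compact (UNIV :: 'm set)"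
  shows "C1_at (flow A Y t) p"
proof -
  obtain \<delta> where \<delta>: "\<delta> > 0" "\<And>p t. \<bar>t\<bar> < \<delta> \<Longrightarrow> C1_at (flow A Y t) p"
    using flow_C1_at_short_times[OF Y comp] by blast
  obtain n :: nat where n: "\<bar>t\<bar> / \<delta> < real n" using reals_Archimedean2 by blast
  then have "n \<noteq> 0" using \<delta>(1) by (intro notI) (simp add: field_simps)
  define s where "s = t / real n"
  have s: "\<bar>s\<bar> < \<delta>" using n \<delta>(1) \<open>n \<noteq> 0\<close> by (simp add: s_def field_simps)
  have "C1_at (flow A Y (real k * s)) p" for k
  proof (induction k)
    case 0
    then show ?case using \<delta>(2)[of 0 p] \<delta>(1) by simp
  next
    case (Suc k)
    have "flow A Y (real (Suc k) * s) = (\<lambda>q. flow A Y s (flow A Y (real k * s) q))"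
      using flow_add[OF Y, of s "real k * s"] by (auto simp: algebra_simps)
    then show ?case using C1_at_compose[OF Suc \<delta>(2)[OF s]] by simp
  qed
  from this[of n] show ?thesis using \<open>n \<noteq> 0\<close> by (simp add: s_def)
qed

lemma continuous_on_flow:
  assumes "flowing Y" "compact (UNIV :: 'm set)"
  shows "continuous_on UNIV (flow A Y t)"
  using C1_at_imp_isCont[OF flow_C1_at[OF assms]] by (simp add: continuous_at_imp_continuous_on)

text \<open>The derivative is injective by the chain rule, because the flow over the time \<open>- T\<close> is an inverse.\<close>

lemma flow_in_charts:
  assumes Y: "flowing Y" and comp: "compact (UNIV :: 'm set)"
    and c: "c \<in> A" "p \<in> dom_of c" "c' \<in> A" "flow A Y T p \<in> dom_of c'"
  shows "\<exists>N D. open N \<and> coord c p \<in> N \<and> N \<subseteq> img c \<and> (\<forall>x\<in>N. flow A Y T (chart_inv c x) \<in> dom_of c') \<and>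
     C1_deriv N (\<lambda>x. coord c' (flow A Y T (chart_inv c x))) D \<and> inj (blinfun_apply (D (coord c p)))"
proof -
  have "C1_between c c' (flow A Y T) p" using flow_C1_at[OF Y comp] c by (auto simp: C1_at_def)
  then obtain N1 D1 where 1: "open N1" "coord c p \<in> N1" "N1 \<subseteq> img c" "\<forall>x\<in>N1. flow A Y T (chart_inv c x) \<in> dom_of c'"
    "C1_deriv N1 (\<lambda>x. coord c' (flow A Y T (chart_inv c x))) D1"
    unfolding C1_between_def by blast
  have inv: "flow A Y (- T) (flow A Y T q) = q" for q
    using flow_add[OF Y, of "-T" T q] integral_curve_flow(2)[OF Y] by simp
  have "C1_between c' c (flow A Y (- T)) (flow A Y T p)"
    using flow_C1_at[OF Y comp] c inv by (auto simp: C1_at_def)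
  then obtain N2 D2 where 2: "open N2" "coord c' (flow A Y T p) \<in> N2" "C1_deriv N2 (\<lambda>x. coord c (flow A Y (- T) (chart_inv c' x))) D2"
    unfolding C1_between_def by blast
  let ?G = "\<lambda>x. coord c' (flow A Y T (chart_inv c x))" and ?H = "\<lambda>x. coord c (flow A Y (- T) (chart_inv c' x))"
  let ?x = "coord c p"
  have Gx: "?G ?x \<in> N2" using 2(2) c(1,2) by simp
  define N where "N = N1 \<inter> ?G -` N2"
  have N: "open N" unfolding N_def
    using continuous_open_preimage[OF C1_deriv_imp_continuous_on[OF 1(5)] 1(1) 2(1)] .
  have "((?H \<circ> ?G) has_derivative (D2 (?G ?x) \<circ> D1 ?x)) (at ?x)"
    by (rule diff_chain_at[OF C1_derivD(1)[OF 1(5,2)] C1_derivD(1)[OF 2(3) Gx]])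
  then have "((\<lambda>x. x) has_derivative (D2 (?G ?x) \<circ> D1 ?x)) (at ?x)"
  proof (rule has_derivative_transform_within_open[OF _ N])
    show "?x \<in> N" using 1(2) Gx by (simp add: N_def)
    fix x assume "x \<in> N"
    then have x: "x \<in> N1" by (simp add: N_def)
    then show "(?H \<circ> ?G) x = x"
      using 1(3,4) c(1,3) inv coord_chart_inv by auto
  qed
  then have "D2 (?G ?x) \<circ> D1 ?x = (\<lambda>v. v)"
    using has_derivative_unique[OF _ has_derivative_ident] by blast
  then have "inj (D1 ?x)" by (metis inj_on_id2 inj_on_imageI2)
  then show ?thesis using 1 by blast
qed

section \<open>Maps of maximal rank into an invariant set\<close>

text \<open>Every map is defined on an open subset of the model space, whatever its rank. So maps of different
rank have the same type, and the ranks are bounded by its dimension.\<close>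

definition C1_map_into ::
  "'m set \<Rightarrow> ('m, 'e) chart \<Rightarrow> 'e set \<Rightarrow> ('e \<Rightarrow> 'e) \<Rightarrow> ('e \<Rightarrow> 'e \<Rightarrow>\<^sub>L 'e) \<Rightarrow> bool" where
  "C1_map_into Q c V \<Psi> D \<longleftrightarrow> c \<in> A \<and> open V \<and> C1_deriv V \<Psi> D \<and> \<Psi> ` V \<subseteq> img c \<and>
     (\<forall>x\<in>V. chart_inv c (\<Psi> x) \<in> Q)"

lemma linear_blinfun: "linear (blinfun_apply T)"
  by (simp add: blinfun.bounded_linear_right bounded_linear.linear)

text \<open>The new map sends \<open>x\<close> to the point reached from \<open>\<Psi> x\<close> along \<open>Y\<close> at the time \<open>T + l x\<close>, where \<open>T > \<tau>\<close> and
\<open>l\<close> is a linear form in \<open>x - x1\<close>. At \<open>x1\<close> its derivative is that of the flow over the time \<open>T\<close>, which is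
injective, composed with \<open>v \<mapsto> D x1 v + l v *\<^sub>R Y\<close>. If \<open>Y\<close> is transversal, then \<open>l\<close> can be chosen so that
this rank-one perturbation raises the rank.\<close>

lemma flowing_out_increases_rank:
  assumes comp: "compact (UNIV :: 'm set)" and Y: "flowing Y"
    and Q: "\<And>r t. r \<in> Q \<Longrightarrow> t \<ge> \<tau> \<Longrightarrow> flow A Y t r \<in> Q"
    and \<Psi>: "C1_map_into Q c V \<Psi> D" and x1: "x1 \<in> V" and transversal: "local_rep Y c (\<Psi> x1) \<notin> range (D x1)"
  shows "\<exists>c' V' \<Psi>' D'. C1_map_into Q c' V' \<Psi>' D' \<and> x1 \<in> V' \<and> dim (range (D x1)) < dim (range (D' x1))"
proof -
  have c: "c \<in> A" and V: "open V" and C1: "C1_deriv V \<Psi> D" and img: "\<Psi> ` V \<subseteq> img c"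
    and inQ: "\<And>x. x \<in> V \<Longrightarrow> chart_inv c (\<Psi> x) \<in> Q"
    using \<Psi> by (auto simp: C1_map_into_def)
  let ?v = "local_rep Y c (\<Psi> x1)"
  obtain w where w: "dim (range (D x1)) < dim (range (\<lambda>x. D x1 x + (x \<bullet> w) *\<^sub>R ?v))"
    using rank_one_perturbation_increases_rank[OF linear_blinfun transversal] by blast
  define p1 where "p1 = chart_inv c (\<Psi> x1)"
  have img1: "\<Psi> x1 \<in> img c" using img x1 by blast
  have p1: "p1 \<in> dom_of c" "coord c p1 = \<Psi> x1"
    unfolding p1_def using c img1 by (simp_all only: chart_inv_in_dom coord_chart_inv)
  obtain B \<delta> \<Phi>' where B: "open B" "coord c p1 \<in> B" "B \<subseteq> img c" "\<delta> > 0"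
    "\<forall>x\<in>B. \<forall>t. \<bar>t\<bar> < \<delta> \<longrightarrow> flow A Y t (chart_inv c x) \<in> dom_of c"
    and \<Phi>: "C1_deriv (B \<times> {-\<delta><..<\<delta>}) (\<lambda>(x, t). coord c (flow A Y t (chart_inv c x))) \<Phi>'"
    and \<Phi>': "\<forall>x\<in>B. \<forall>v s. blinfun_apply (\<Phi>' (x, 0)) (v, s) = v + s *\<^sub>R local_rep Y c x"
    using flow_C1_for_small_times[OF Y c p1(1)] by blast
  \<comment> \<open>The margin of 1 over the dwell time leaves room for \<open>l x\<close>, which is restricted to \<open>{-1<..<1}\<close>.\<close>
  define T where "T = \<tau> + 1"
  obtain c' where c': "c' \<in> A" "flow A Y T p1 \<in> dom_of c'" using chart_at by blast
  obtain N E where N: "open N" "coord c p1 \<in> N" "N \<subseteq> img c" "\<forall>x\<in>N. flow A Y T (chart_inv c x) \<in> dom_of c'"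
    and E: "C1_deriv N (\<lambda>x. coord c' (flow A Y T (chart_inv c x))) E" "inj (E (coord c p1))"
    using flow_in_charts[OF Y comp c p1(1) c'] by blast
  define l where "l x = (x - x1) \<bullet> w" for x
  define J where "J x = coord c (flow A Y (l x) (chart_inv c (\<Psi> x)))" for x
  let ?i = "Blinfun (\<lambda>v::'e. (v, 0::real))" and ?j = "Blinfun (\<lambda>v::'e. (0::'e, v \<bullet> w))"
  have i: "blinfun_apply ?i = (\<lambda>v. (v, 0))" and j: "blinfun_apply ?j = (\<lambda>v. (0, v \<bullet> w))"
    by (intro bounded_linear_Blinfun_apply bounded_linear_intros bounded_linear_inner_left)+
  define V1 where "V1 = V \<inter> \<Psi> -` B \<inter> l -` {- min \<delta> 1 <..< min \<delta> 1}"
  have l_cont: "continuous_on S l" for S unfolding l_def by (intro continuous_intros)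
  have "open (V \<inter> \<Psi> -` B)"
    using continuous_open_preimage[OF C1_deriv_imp_continuous_on[OF C1] V B(1)] .
  then have V1: "open V1" unfolding V1_def
    by (intro continuous_open_preimage[OF l_cont]) auto
  have x1V1: "x1 \<in> V1" using x1 B(2,4) p1(2) by (simp add: V1_def l_def)
  have lt: "\<bar>l x\<bar> < \<delta>" "\<bar>l x\<bar> < 1" if "x \<in> V1" for x using that by (auto simp: V1_def)
  define \<pi>' where "\<pi>' x = (?i o\<^sub>L D x) + ?j" for x
  have \<pi>: "C1_deriv V1 (\<lambda>x. (\<Psi> x, l x)) \<pi>'"
    unfolding C1_deriv_def
  proof (intro conjI ballI)
    have "V1 \<subseteq> V" by (auto simp: V1_def)
    then show "continuous_on V1 \<pi>'"
      unfolding \<pi>'_def using continuous_on_subset[OF C1_derivD(2)[OF C1]] by (intro continuous_intros)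
    fix x assume "x \<in> V1"
    then have "(\<Psi> has_derivative D x) (at x)" using C1_derivD(1)[OF C1] by (simp add: V1_def)
    moreover have "(l has_derivative (\<lambda>v. v \<bullet> w)) (at x)"
      unfolding l_def by (auto intro!: derivative_eq_intros)
    ultimately have "((\<lambda>x. (\<Psi> x, l x)) has_derivative (\<lambda>v. (D x v, v \<bullet> w))) (at x)"
      by (rule has_derivative_Pair)
    moreover have "blinfun_apply (\<pi>' x) = (\<lambda>v. (D x v, v \<bullet> w))"
      unfolding \<pi>'_def by (rule ext) (simp add: blinfun.add_left i j)
    ultimately show "((\<lambda>x. (\<Psi> x, l x)) has_derivative blinfun_apply (\<pi>' x)) (at x)" by simp
  qed
  have "(\<lambda>x. (\<Psi> x, l x)) ` V1 \<subseteq> B \<times> {-\<delta><..<\<delta>}" by (auto simp: V1_def)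
  from C1_deriv_compose[OF \<Phi> \<pi> this]
  have J: "C1_deriv V1 J (\<lambda>x. \<Phi>' (\<Psi> x, l x) o\<^sub>L \<pi>' x)" by (simp add: o_def J_def[abs_def])
  define V' where "V' = V1 \<inter> J -` N"
  have V': "open V'" unfolding V'_def
    using continuous_open_preimage[OF C1_deriv_imp_continuous_on[OF J] V1 N(1)] .
  have "l x1 = 0" by (simp add: l_def)
  then have J1: "J x1 = \<Psi> x1"
    using integral_curve_flow(2)[OF Y] p1 by (simp add: J_def p1_def)
  then have x1V': "x1 \<in> V'" using x1V1 N(2) p1(2) by (simp add: V'_def)
  let ?H = "\<lambda>x. coord c' (flow A Y T (chart_inv c x))"
  define D' where "D' x = E (J x) o\<^sub>L (\<Phi>' (\<Psi> x, l x) o\<^sub>L \<pi>' x)" for x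
  have "C1_deriv V' (?H \<circ> J) D'"
    unfolding D'_def by (rule C1_deriv_compose[OF E(1) C1_deriv_subset[OF J]]) (auto simp: V'_def)
  moreover have "(?H \<circ> J) ` V' \<subseteq> img c'" using N(4) by (auto simp: V'_def)
  moreover have "\<forall>x\<in>V'. chart_inv c' ((?H \<circ> J) x) \<in> Q"
  proof
    fix x assume x: "x \<in> V'"
    then have xV1: "x \<in> V1" and JN: "J x \<in> N" by (auto simp: V'_def)
    then have "x \<in> V" "\<Psi> x \<in> B" by (auto simp: V1_def)
    then have "flow A Y (l x) (chart_inv c (\<Psi> x)) \<in> dom_of c" using B(5) lt[OF xV1] by blast
    then have "chart_inv c (J x) = flow A Y (l x) (chart_inv c (\<Psi> x))" using c by (simp add: J_def)
    then have "flow A Y T (chart_inv c (J x)) = flow A Y (T + l x) (chart_inv c (\<Psi> x))"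
      using flow_add[OF Y] by simp
    moreover have "T + l x \<ge> \<tau>" using lt(2)[OF xV1] by (simp add: T_def)
    ultimately have "flow A Y T (chart_inv c (J x)) \<in> Q" using Q[OF inQ[OF \<open>x \<in> V\<close>]] by simp
    moreover have "flow A Y T (chart_inv c (J x)) \<in> dom_of c'" using N(4) JN by blast
    ultimately show "chart_inv c' ((?H \<circ> J) x) \<in> Q" using c'(1) by simp
  qed
  ultimately have "C1_map_into Q c' V' (?H \<circ> J) D'" using c'(1) V' by (simp add: C1_map_into_def)
  moreover have "dim (range (D x1)) < dim (range (D' x1))"
  proof -
    let ?R = "range (\<lambda>x. D x1 x + (x \<bullet> w) *\<^sub>R ?v)"
    have "\<Psi> x1 \<in> B" using B(2) p1(2) by simp
    then have "D' x1 v = E (coord c p1) (D x1 v + (v \<bullet> w) *\<^sub>R ?v)" for v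
      using \<Phi>' \<open>l x1 = 0\<close> J1 p1(2) by (simp add: D'_def \<pi>'_def blinfun.add_left i j)
    then have "range (D' x1) = E (coord c p1) ` ?R" by auto
    then have "dim (range (D' x1)) = dim ?R"
      using dim_image_eq[OF linear_blinfun inj_on_subset[OF E(2) subset_UNIV]] by metis
    then show ?thesis using w by simp
  qed
  ultimately show ?thesis using x1V' by blast
qed

text \<open>Constant maps belong to the class, and the dimension of the model space bounds the ranks.\<close>

lemma exists_C1_map_of_maximal_rank:
  assumes "Q \<noteq> {}"
  shows "\<exists>c V \<Psi> D x0. C1_map_into Q c V \<Psi> D \<and> x0 \<in> V \<and>
    (\<forall>c' V' \<Psi>' D' x. C1_map_into Q c' V' \<Psi>' D' \<and> x \<in> V' \<longrightarrow> dim (range (D' x)) \<le> dim (range (D x0)))"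
proof -
  define P where "P z = (case z of (c, V, \<Psi>, D, x) \<Rightarrow> C1_map_into Q c V \<Psi> D \<and> x \<in> V)" for z
  define rk where "rk z = (case z of (c, V, \<Psi>, D, x) \<Rightarrow> dim (range (blinfun_apply (D x))))"
    for z :: "('m, 'e) chart \<times> 'e set \<times> ('e \<Rightarrow> 'e) \<times> ('e \<Rightarrow> 'e \<Rightarrow>\<^sub>L 'e) \<times> 'e"
  obtain r where r: "r \<in> Q" using assms by blast
  obtain c where c: "c \<in> A" "r \<in> dom_of c" using chart_at by blast
  have "C1_deriv UNIV (\<lambda>x::'e. coord c r) (\<lambda>x. 0)"
    unfolding C1_deriv_def by (auto intro!: derivative_eq_intros)
  then have "P (c, UNIV, (\<lambda>x. coord c r), (\<lambda>x. 0), 0)"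
    using c r by (auto simp: P_def C1_map_into_def)
  moreover have "\<forall>z. P z \<longrightarrow> rk z \<le> DIM('e)"
    by (auto simp: rk_def dim_subset_UNIV)
  ultimately obtain z where z: "P z" "\<And>z'. P z' \<Longrightarrow> rk z' \<le> rk z"
    using ex_has_greatest_nat[of P _ rk "Suc (DIM('e))"] by (metis less_Suc_eq_le)
  obtain c V \<Psi> D x where z_eq: "z = (c, V, \<Psi>, D, x)" using prod_cases5 by blast
  show ?thesis
  proof (intro exI conjI allI impI)
    show "C1_map_into Q c V \<Psi> D" "x \<in> V" using z(1) by (auto simp: z_eq P_def)
    fix c' V' \<Psi>' D' x' assume "C1_map_into Q c' V' \<Psi>' D' \<and> x' \<in> V'"
    then show "dim (range (D' x')) \<le> dim (range (D x))"
      using z(2)[of "(c', V', \<Psi>', D', x')"] by (simp add: z_eq P_def rk_def)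
  qed
qed

section \<open>Bracket-generating families\<close>

lemma local_rep_lie_bracket:
  assumes c: "c \<in> A" and x: "x \<in> img c"
  shows "local_rep (lie_bracket A Y Z) c x =
    frechet_derivative (local_rep Z c) (at x) (local_rep Y c x) - frechet_derivative (local_rep Y c) (at x) (local_rep Z c x)"
proof -
  have "chart_inv c x \<in> dom_of c" "coord c (chart_inv c x) = x"
    using c x by (simp_all only: chart_inv_in_dom coord_chart_inv)
  then show ?thesis
    using c at_within_open[OF x open_img[OF c]] by (simp add: local_rep_def lie_bracket_def)
qed

text \<open>Tangency and smoothness are established in one induction, because the case of a bracket
differentiates its two fields.\<close>

lemma lie_algebra_smooth_and_tangent:
  assumes Z: "Z \<in> lie_algebra A F" and c: "c \<in> A"
    and F: "\<And>Y. Y \<in> F \<Longrightarrow> smooth_on (img c) (local_rep Y c)"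
    and V: "open V" and g: "C1_deriv V g D" "g ` V \<subseteq> img c" and P: "linear P"
    and PD: "\<And>y v. y \<in> V \<Longrightarrow> P (D y v) = P v" and DP: "\<And>y v. y \<in> V \<Longrightarrow> D y (P v) = D y v"
    and tangent: "\<And>Y y. Y \<in> F \<Longrightarrow> y \<in> V \<Longrightarrow> local_rep Y c (g y) \<in> range (D y)"
  shows "smooth_on (img c) (local_rep Z c) \<and> (\<forall>y\<in>V. local_rep Z c (g y) \<in> range (D y))"
  using Z
proof induction
  case (generator Y)
  then show ?case using F tangent by blast
next
  case zero
  have "0 \<in> range (blinfun_apply (D y))" for y by (rule range_eqI[of _ _ 0]) (simp add: blinfun.zero_right)
  then show ?case using smooth_on_const[OF open_img[OF c]] by (simp add: local_rep_def[abs_def])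
next
  case (add Y Z)
  have "local_rep (\<lambda>p c. Y p c + Z p c) c = (\<lambda>x. local_rep Y c x + local_rep Z c x)"
    by (rule ext) (simp add: local_rep_def)
  moreover have "u + v \<in> range (blinfun_apply (D y))" if "u \<in> range (D y)" "v \<in> range (D y)" for u v y
    using that by (auto simp: blinfun.add_right[symmetric])
  moreover have "smooth_on (img c) (\<lambda>x. local_rep Y c x + local_rep Z c x)"
    using add.IH by (intro smooth_on_add[OF open_img[OF c]]) simp_all
  ultimately show ?case using add.IH by simp
next
  case (scale Y r)
  have "local_rep (\<lambda>p c. r *\<^sub>R Y p c) c = (\<lambda>x. r *\<^sub>R local_rep Y c x)"
    by (rule ext) (simp add: local_rep_def)
  moreover have "r *\<^sub>R u \<in> range (blinfun_apply (D y))" if "u \<in> range (D y)" for u y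
    using that by (auto simp: blinfun.scaleR_right[symmetric])
  moreover have "smooth_on (img c) (\<lambda>x. r *\<^sub>R local_rep Y c x)"
    using scale.IH by (intro smooth_on_linear[OF open_img[OF c] _ bounded_linear_scaleR_right]) simp
  ultimately show ?case using scale.IH by simp
next
  case (bracket Y Z)
  note W = open_img[OF c]
  have sY: "smooth_on (img c) (local_rep Y c)" and sZ: "smooth_on (img c) (local_rep Z c)" using bracket.IH by auto
  have "smooth_on (img c) (\<lambda>x. frechet_derivative (local_rep Z c) (at x) (local_rep Y c x) +
      (- 1) *\<^sub>R frechet_derivative (local_rep Y c) (at x) (local_rep Z c x))"
    by (intro smooth_on_add smooth_on_linear[OF _ _ bounded_linear_scaleR_right] smooth_on_directional_derivative W sY sZ)
  then have "smooth_on (img c) (local_rep (lie_bracket A Y Z) c)"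
    by (rule smooth_on_cong[OF W, rotated]) (simp add: local_rep_lie_bracket[OF c])
  moreover have "local_rep (lie_bracket A Y Z) c (g y) \<in> range (D y)" if y: "y \<in> V" for y
  proof -
    have gy: "g y \<in> img c" using g(2) y by blast
    note C1_derivD(1)[OF smooth_on_imp_C1_deriv[OF _ W] gy]
    from bracket_tangent_to_constant_rank_map[OF V y g(1) P PD DP _ _ this[OF sY] this[OF sZ]]
    have "blinfun_apply (Blinfun (frechet_derivative (local_rep Z c) (at (g y)))) (local_rep Y c (g y)) -
        blinfun_apply (Blinfun (frechet_derivative (local_rep Y c) (at (g y)))) (local_rep Z c (g y)) \<in> range (D y)"
      using bracket.IH by blast
    moreover have "blinfun_apply (Blinfun (frechet_derivative f (at (g y)))) = frechet_derivative f (at (g y))"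
      if "smooth_on (img c) f" for f :: "'e \<Rightarrow> 'e"
      using smooth_on_has_derivative[OF that W gy] by (intro bounded_linear_Blinfun_apply has_derivative_bounded_linear)
    ultimately show ?thesis using sY sZ by (simp add: local_rep_lie_bracket[OF c gy])
  qed
  ultimately show ?case by blast
qed

end

section \<open>Trajectories of constant controls\<close>

lemma integral_curve_is_trajectory:
  assumes "integral_curve A (\<lambda>p. X p a) \<gamma>" "\<gamma> 0 = q"
  shows "is_trajectory A X q (\<lambda>_. a) \<gamma>"
proof -
  have "continuous_on {0..} \<gamma>" using assms(1) continuous_on_subset unfolding integral_curve_def by blast
  then show ?thesis
    unfolding is_trajectory_def using assms by (auto simp: integral_curve_def intro!: exI[of _ "{}"])
qed

lemma trajectory_eqI:
  assumes "is_trajectory A X q u \<gamma>" "\<And>\<xi>. is_trajectory A X q u \<xi> \<Longrightarrow> \<xi> t = \<gamma> t"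
  shows "trajectory A X t q u = \<gamma> t"
  unfolding trajectory_def
proof (rule the_equality)
  show "\<exists>\<xi>. is_trajectory A X q u \<xi> \<and> \<xi> t = \<gamma> t" using assms(1) by blast
qed (use assms(2) in blast)

context positive_dim_manifold
begin

text \<open>The vector is transported to the other charts by the Jacobians of the transition maps. Their cocycle
identity is the chain rule.\<close>

lemma exists_tangent_vector:
  assumes c: "c \<in> A" and p: "p \<in> dom_of c"
  shows "\<exists>w\<in>tangent_space d A p. w c = v"
proof -
  define w :: "('m, 'e) tangent" where "w c' = (if c' \<in> A \<and> p \<in> dom_of c' then frechet_derivative (transition c c') (at (coord c p)) v else 0)" for c'
  have der: "(transition b b' has_derivative frechet_derivative (transition b b') (at (coord b p))) (at (coord b p))"
    if "b \<in> A" "b' \<in> A" "p \<in> dom_of b" "p \<in> dom_of b'" for b b'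
    using that by (intro smooth_on_has_derivative[OF smooth_on_transition open_overlap]) auto
  have "w c = v"
  proof -
    have "(transition c c has_derivative (\<lambda>v. v)) (at (coord c p))"
      by (rule has_derivative_transform_within_open[OF has_derivative_ident open_img[OF c]])
        (use p coord_chart_inv[OF c] in \<open>auto simp: transition_def\<close>)
    then have "frechet_derivative (transition c c) (at (coord c p)) = (\<lambda>v. v)"
      by (rule frechet_derivative_at[symmetric])
    then show ?thesis using c p by (simp add: w_def)
  qed
  moreover have "w \<in> tangent_space d A p"
    unfolding tangent_space_def mem_Collect_eq
  proof (intro conjI allI ballI impI)
    show "w c' \<in> model_space d" for c' using pos by (simp add: model_space_def)
    show "w c' = 0" if "\<not> (c' \<in> A \<and> p \<in> dom_of c')" for c' using that by (auto simp: w_def)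
    fix b b' assume b: "b \<in> A" "b' \<in> A" and "p \<in> dom_of b \<inter> dom_of b'"
    then have pb: "p \<in> dom_of b" "p \<in> dom_of b'" by auto
    let ?N = "coord c ` (dom_of c \<inter> (dom_of b \<inter> dom_of b'))"
    have tr: "transition c b (coord c p) = coord b p" using c p by (simp add: transition_def)
    have "(transition b b' \<circ> transition c b has_derivative
        (frechet_derivative (transition b b') (at (coord b p)) \<circ> frechet_derivative (transition c b) (at (coord c p)))) (at (coord c p))"
      using diff_chain_at[OF der[OF c b(1) p pb(1)]] der[OF b pb] by (simp add: tr)
    then have "(transition c b' has_derivative
        (frechet_derivative (transition b b') (at (coord b p)) \<circ> frechet_derivative (transition c b) (at (coord c p)))) (at (coord c p))"
    proof (rule has_derivative_transform_within_open)
      show "open ?N" using open_chart_image[OF c] open_dom b by blast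
      show "coord c p \<in> ?N" using p pb by blast
      fix x assume "x \<in> ?N"
      then obtain q where "q \<in> dom_of c" "q \<in> dom_of b" "q \<in> dom_of b'" "x = coord c q" by blast
      then show "(transition b b' \<circ> transition c b) x = transition c b' x"
        using c b by (simp add: transition_def)
    qed
    then have "frechet_derivative (transition c b') (at (coord c p)) =
        frechet_derivative (transition b b') (at (coord b p)) \<circ> frechet_derivative (transition c b) (at (coord c p))"
      using frechet_derivative_at by metis
    then have "w b' = frechet_derivative (transition b b') (at (coord b p)) (w b)"
      using b pb by (simp add: w_def)
    moreover have "coord b p \<in> coord b ` (dom_of b \<inter> dom_of b')" using pb by blast
    ultimately show "w b' = frechet_derivative (transition b b') (at (coord b p) within coord b ` (dom_of b \<inter> dom_of b')) (w b)"
      using at_within_open[OF _ open_overlap[OF b]] by simp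
  qed
  ultimately show ?thesis by blast
qed

lemma smooth_vfield_imp_flowing:
  assumes "smooth_vfield d A Y" "complete_vfield A Y"
  shows "flowing Y"
  using assms smooth_vfield_imp_C1_field by (simp add: flowing_def)

text \<open>A map into \<open>Q\<close> of maximal rank is tangent to all fields of the family, hence to the Lie algebra that
they generate. If this spans the tangent spaces, the derivative is onto, and then the image of the map
is a neighbourhood of some of its points.\<close>

theorem interior_nonempty_if_bracket_generating:
  assumes comp: "compact (UNIV :: 'm set)"
    and F: "\<And>Y. Y \<in> F \<Longrightarrow> smooth_vfield d A Y" "\<And>Y. Y \<in> F \<Longrightarrow> complete_vfield A Y"
    and lie: "\<And>p. lie_at A F p = tangent_space d A p"
    and Q: "Q \<noteq> {}" "\<And>Y r t. Y \<in> F \<Longrightarrow> r \<in> Q \<Longrightarrow> t \<ge> \<tau> \<Longrightarrow> flow A Y t r \<in> Q"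
  shows "interior Q \<noteq> {}"
proof -
  obtain c V \<Psi> D x0 where \<Psi>: "C1_map_into Q c V \<Psi> D" "x0 \<in> V"
    and max: "\<forall>c' V' \<Psi>' D' x. C1_map_into Q c' V' \<Psi>' D' \<and> x \<in> V' \<longrightarrow> dim (range (D' x)) \<le> dim (range (D x0))"
    using exists_C1_map_of_maximal_rank[OF Q(1)] by blast
  have c: "c \<in> A" and V: "open V" and C1: "C1_deriv V \<Psi> D" and img: "\<Psi> ` V \<subseteq> img c"
    and inQ: "\<And>x. x \<in> V \<Longrightarrow> chart_inv c (\<Psi> x) \<in> Q"
    using \<Psi>(1) by (auto simp: C1_map_into_def)
  have "dim (range (D x)) \<le> dim (range (D x0))" if "x \<in> V" for x using max \<Psi>(1) that by blast
  from constant_rank_normal_form[OF V \<Psi>(2) C1 this]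
  obtain V' h E P where V': "open V'" "V' \<noteq> {}" "h ` V' \<subseteq> V" and E: "C1_deriv V' (\<Psi> \<circ> h) E" and P: "linear P"
    and PE: "\<forall>y\<in>V'. \<forall>v. P (E y v) = P v \<and> E y (P v) = E y v"
    and rank: "\<forall>y\<in>V'. dim (range (E y)) = dim (range (D x0))"
    by blast
  let ?g = "\<Psi> \<circ> h"
  have g_img: "?g ` V' \<subseteq> img c" using img V'(3) by (auto simp: image_subset_iff)
  have gQ: "C1_map_into Q c V' ?g E"
    unfolding C1_map_into_def using c V'(1) E g_img inQ V'(3) by (simp add: image_subset_iff)
  have tangent: "local_rep Y c (?g y) \<in> range (E y)" if Y: "Y \<in> F" and y: "y \<in> V'" for Y y
  proof (rule ccontr)
    assume "local_rep Y c (?g y) \<notin> range (E y)"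
    then obtain c' V'' \<Psi>' D' where "C1_map_into Q c' V'' \<Psi>' D'" "y \<in> V''" "dim (range (E y)) < dim (range (D' y))"
      using flowing_out_increases_rank[OF comp smooth_vfield_imp_flowing[OF F(1)[OF Y] F(2)[OF Y]] Q(2)[OF Y] gQ y]
      by blast
    then show False using max rank y by (metis leD)
  qed
  have smooth: "smooth_on (img c) (local_rep Y c)" if "Y \<in> F" for Y
    using F(1)[OF that] c by (simp add: smooth_vfield_def)
  obtain y where y: "y \<in> V'" using V'(2) by blast
  let ?p = "chart_inv c (?g y)"
  have gy: "?g y \<in> img c" using g_img y by blast
  have "v \<in> range (E y)" for v
  proof -
    have "?p \<in> dom_of c" using c gy by (rule chart_inv_in_dom)
    then obtain w where w: "w \<in> tangent_space d A ?p" "w c = v" using exists_tangent_vector[OF c] by blast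
    then have "w \<in> lie_at A F ?p" using lie[of ?p] by simp
    then obtain Z where Z: "Z \<in> lie_algebra A F" "Z ?p = w" unfolding lie_at_def by blast
    have PE': "P (E z u) = P u" "E z (P u) = E z u" if "z \<in> V'" for z u using PE that by auto
    have "local_rep Z c (?g y) \<in> range (E y)"
      using lie_algebra_smooth_and_tangent[OF Z(1) c smooth V'(1) E g_img P PE' tangent] y by simp
    then show ?thesis using Z(2) w(2) by (simp add: local_rep_def)
  qed
  then have "surj (E y)" by auto
  then obtain i where i: "linear i" "E y \<circ> i = id"
    using linear_surjective_right_inverse[OF linear_blinfun] by blast
  have "?g y \<in> interior (?g ` V')"
  proof (rule sussmann_open_mapping[OF V'(1) _ y C1_derivD(1)[OF E y] _ i(2) order_refl])
    show "continuous_on V' ?g" by (rule C1_deriv_imp_continuous_on[OF E])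
    show "bounded_linear i" using i(1) by (simp add: linear_linear)
    show "y \<in> interior V'" using y V'(1) by (simp add: interior_open)
  qed
  then have p: "?p \<in> dom_of c \<inter> coord c -` interior (?g ` V')"
    using c gy by (simp add: chart_inv_in_dom coord_chart_inv del: o_apply)
  have "dom_of c \<inter> coord c -` interior (?g ` V') \<subseteq> Q"
  proof
    fix r assume r: "r \<in> dom_of c \<inter> coord c -` interior (?g ` V')"
    then obtain z where z: "z \<in> V'" "coord c r = ?g z" using interior_subset by blast
    then have "r = chart_inv c (?g z)" using r c by (metis IntD1 chart_inv_coord)
    then show "r \<in> Q" using inQ V'(3) z(1) by auto
  qed
  then have "dom_of c \<inter> coord c -` interior (?g ` V') \<subseteq> interior Q"
    using open_chart_preimage[OF c open_interior] by (rule interior_maximal)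
  then show ?thesis using p by blast
qed

lemma trajectory_constant_control:
  assumes Y: "flowing (\<lambda>p. X p a)" and t: "t \<ge> 0"
  shows "trajectory A X t q (\<lambda>_. a) = flow A (\<lambda>p. X p a) t q"
proof -
  let ?Y = "\<lambda>p. X p a" and ?\<gamma> = "\<lambda>t. flow A (\<lambda>p. X p a) t q"
  have C1: "C1_field ?Y" using Y by (simp add: flowing_def)
  note \<gamma> = integral_curve_flow[OF Y, of q]
  have traj: "is_trajectory A X q (\<lambda>_. a) ?\<gamma>" by (rule integral_curve_is_trajectory) (rule \<gamma>)+
  have "\<xi> t = ?\<gamma> t" if \<xi>: "is_trajectory A X q (\<lambda>_. a) \<xi>" for \<xi>
  proof -
    obtain S where S: "\<forall>T. finite (S \<inter> {0..T})" "\<forall>t>0. t \<notin> S \<longrightarrow> (\<forall>c\<in>A. \<xi> t \<in> dom_of c \<longrightarrow>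
           ((\<lambda>s. coord c (\<xi> s)) has_vector_derivative X (\<xi> t) a c) (at t))"
      using \<xi> unfolding is_trajectory_def by blast
    define S' where "S' = S \<inter> {0..}"
    have fin: "finite (S' \<inter> {r..s})" for r s
      by (rule finite_subset[OF _ S(1)[rule_format, of s]]) (auto simp: S'_def)
    have int: "interior {0::real..} = {0<..}" by simp
    have "solves ?Y {0..} S' \<xi>"
      unfolding solves_def int using \<xi> S(2) by (auto simp: S'_def is_trajectory_def)
    moreover have "solves ?Y {0..} S' ?\<gamma>"
      unfolding solves_def int using traj \<gamma>(1) by (auto simp: is_trajectory_def integral_curve_def)
    moreover have "\<xi> 0 = ?\<gamma> 0" using \<xi> \<gamma>(2) by (simp add: is_trajectory_def)
    ultimately show ?thesis
      using t by (intro solutions_unique[where I = "{0..}" and Y = ?Y and S = S' and \<gamma> = \<xi> and \<zeta> = ?\<gamma> and s = 0 and t = t]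
          C1 is_interval_ci fin) auto
  qed
  then show ?thesis by (rule trajectory_eqI[where \<gamma> = ?\<gamma>, OF traj])
qed

end

section \<open>Dimension zero\<close>

text \<open>In a discrete space curves are constant. This replaces uniqueness of solutions in dimension 0.\<close>

lemma connected_subset_of_discrete:
  fixes S :: "'m::topological_space set"
  assumes "\<And>p::'m. open {p}" "connected S" "p \<in> S" "q \<in> S"
  shows "p = q"
proof -
  have op: "open T" for T :: "'m set"
    using open_Union[of "(\<lambda>p. {p}) ` T"] assms(1) by auto
  have "{p} \<inter> S = {} \<or> (- {p}) \<inter> S = {}"
    using assms(2) op by (intro connectedD) auto
  then show ?thesis using assms(3,4) by auto
qed

lemma zero_dim_atlas_discrete:
  fixes A :: "('m::{t2_space,second_countable_topology}, 'e::euclidean_space) chart set"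
  assumes "smooth_atlas 0 A"
  shows "open {p :: 'm}"
proof -
  have *: "(\<Union>c\<in>A. dom_of c) = UNIV" "\<forall>c\<in>A. open (dom_of c) \<and>
        openin (top_of_set (model_space 0)) (coord c ` dom_of c) \<and>
        homeomorphism (dom_of c) (coord c ` dom_of c) (coord c) (chart_inv c)"
    using assms unfolding smooth_atlas_def by auto
  then obtain c where c: "c \<in> A" "p \<in> dom_of c" by blast
  have zero: "coord c ` dom_of c \<subseteq> {0}"
    using *(2) c(1) openin_imp_subset by (fastforce simp: model_space_def)
  have inv: "chart_inv c (coord c q) = q" if "q \<in> dom_of c" for q
    using *(2) c(1) that by (auto simp: homeomorphism_def)
  have "dom_of c \<subseteq> {chart_inv c 0}"
  proof
    fix q assume q: "q \<in> dom_of c"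
    then have "coord c q = 0" using zero by blast
    then show "q \<in> {chart_inv c 0}" using inv[OF q] by simp
  qed
  then have "dom_of c = {p}" using c(2) by blast
  then show ?thesis using *(2) c(1) by metis
qed

lemma zero_dim_curve_constant:
  fixes \<gamma> :: "real \<Rightarrow> 'm::topological_space"
  assumes "\<And>p::'m. open {p}" "continuous_on I \<gamma>" "connected I" "s \<in> I" "t \<in> I"
  shows "\<gamma> s = \<gamma> t"
  using connected_subset_of_discrete[OF assms(1) connected_continuous_image[OF assms(2,3)]] assms(4,5) by blast

lemma zero_dim_flow:
  fixes A :: "('m::{t2_space,second_countable_topology}, 'e::euclidean_space) chart set"
  assumes A: "smooth_atlas 0 A" and Y: "complete_vfield A Y"
  shows "flow A Y t p = p"
proof -
  have const: "\<gamma> = (\<lambda>_. p)" if "integral_curve A Y \<gamma>" "\<gamma> 0 = p" for \<gamma>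
    using zero_dim_curve_constant[OF zero_dim_atlas_discrete[OF A], of UNIV \<gamma> _ 0] that
    by (auto simp: integral_curve_def)
  obtain \<gamma> where \<gamma>: "integral_curve A Y \<gamma>" "\<gamma> 0 = p" using Y unfolding complete_vfield_def by blast
  have "(THE \<gamma>. integral_curve A Y \<gamma> \<and> \<gamma> 0 = p) = (\<lambda>_. p)"
  proof (rule the_equality)
    show "integral_curve A Y (\<lambda>_. p) \<and> p = p" using \<gamma>(1) const[OF \<gamma>] by simp
  qed (use const in blast)
  then show ?thesis by (simp add: flow_def)
qed

lemma zero_dim_trajectory:
  fixes A :: "('m::{t2_space,second_countable_topology}, 'e::euclidean_space) chart set"
  assumes A: "smooth_atlas 0 A" and Y: "complete_vfield A (\<lambda>p. X p a)" and t: "t \<ge> 0"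
  shows "trajectory A X t q (\<lambda>_. a) = q"
proof -
  obtain \<gamma> where \<gamma>: "integral_curve A (\<lambda>p. X p a) \<gamma>" "\<gamma> 0 = q" using Y unfolding complete_vfield_def by blast
  have traj: "is_trajectory A X q (\<lambda>_. a) \<gamma>" by (rule integral_curve_is_trajectory) (rule \<gamma>)+
  have const: "\<xi> t = q" if "is_trajectory A X q (\<lambda>_. a) \<xi>" for \<xi>
    using zero_dim_curve_constant[OF zero_dim_atlas_discrete[OF A], of "{0..}" \<xi> t 0] that t
    by (auto simp: is_trajectory_def)
  then show ?thesis using trajectory_eqI[OF traj] const[OF traj] by metis
qed

section \<open>The dwell-time semigroup\<close>

lemma fold_flow_compose:
  fixes h :: "'m::topological_space \<Rightarrow> 'm"
  shows "fold (\<lambda>(t, Y) g. flow A Y t \<circ> g) ps h = fold (\<lambda>(t, Y) g. flow A Y t \<circ> g) ps id \<circ> h"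
proof (induction ps arbitrary: h)
  case (Cons p ps)
  obtain t Y where p: "p = (t, Y)" by (cases p)
  show ?case
    using Cons[of "flow A Y t \<circ> h"] Cons[of "flow A Y t"] by (simp add: p o_assoc)
qed simp

lemma dwell_semigroup_compose:
  assumes "g \<in> dwell_semigroup A F \<tau>" "h \<in> dwell_semigroup A F \<tau>"
  shows "g \<circ> h \<in> dwell_semigroup A F \<tau>"
proof -
  let ?f = "\<lambda>(t, Y) g. flow A Y t \<circ> g"
  obtain ps where ps: "g = fold ?f ps id" "ps \<noteq> []" "\<forall>(t, Y)\<in>set ps. Y \<in> F \<and> t \<ge> \<tau>"
    using assms(1) unfolding dwell_semigroup_def by blast
  obtain qs where qs: "h = fold ?f qs id" "qs \<noteq> []" "\<forall>(t, Y)\<in>set qs. Y \<in> F \<and> t \<ge> \<tau>"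
    using assms(2) unfolding dwell_semigroup_def by blast
  have "fold ?f (qs @ ps) id = g \<circ> h"
    using fold_flow_compose[of A ps h] by (simp add: ps(1) qs(1))
  moreover have "\<forall>(t, Y)\<in>set (qs @ ps). Y \<in> F \<and> t \<ge> \<tau>" using ps(3) qs(3) by auto
  ultimately show ?thesis
    unfolding dwell_semigroup_def using ps(2) by (intro CollectI exI[of _ "qs @ ps"]) simp
qed

lemma flow_in_dwell_semigroup:
  assumes "Y \<in> F" "t \<ge> \<tau>"
  shows "flow A Y t \<in> dwell_semigroup A F \<tau>"
  unfolding dwell_semigroup_def using assms by (intro CollectI exI[of _ "[(t, Y)]"]) simp

lemma continuous_on_dwell_semigroup:
  assumes "\<And>Y t. Y \<in> F \<Longrightarrow> continuous_on UNIV (flow A Y t)" and g: "g \<in> dwell_semigroup A F \<tau>"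
  shows "continuous_on UNIV g"
proof -
  let ?f = "\<lambda>(t, Y) g. flow A Y t \<circ> g"
  have fold: "continuous_on UNIV (fold ?f ps h)" if "\<forall>(t, Y)\<in>set ps. Y \<in> F \<and> t \<ge> \<tau>" "continuous_on UNIV h" for ps h
    using that
  proof (induction ps arbitrary: h)
    case (Cons p ps)
    obtain t Y where p: "p = (t, Y)" by (cases p)
    have "continuous_on UNIV (flow A Y t)" using Cons.prems(1) assms(1) by (simp add: p)
    then have "continuous_on UNIV (flow A Y t \<circ> h)"
      using Cons.prems(2) by (intro continuous_on_compose) (auto intro: continuous_on_subset)
    then show ?case using Cons.prems(1) Cons.IH by (simp add: p)
  qed simp
  obtain ps where ps: "g = fold ?f ps id" "\<forall>(t, Y)\<in>set ps. Y \<in> F \<and> t \<ge> \<tau>"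
    using g unfolding dwell_semigroup_def by blast
  have "continuous_on UNIV id" by (simp add: id_def)
  then show ?thesis unfolding ps(1) by (rule fold[OF ps(2)])
qed

section \<open>Invariant control sets\<close>

text \<open>A control has at least one piece. Hence the conditions on a weakly invariant set concern only times
\<open>t \<ge> \<tau>\<close>, at which a constant control has reached a point of the orbit.\<close>

lemma dwell_control_duration_ge:
  assumes "dwell_control U \<tau> T u"
  shows "\<tau> \<le> T"
proof -
  obtain m s where m: "m \<ge> (1::nat)" "s 0 = 0" "s m = T"
    and s: "\<And>i. i < m \<Longrightarrow> s i \<le> s (Suc i)" "\<And>i. i < m \<Longrightarrow> s (Suc i) - s i \<ge> \<tau>"
    using assms unfolding dwell_control_def by blast
  have "\<tau> \<le> s (Suc k)" if "k < m" for k
    using that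
  proof (induction k)
    case 0
    then show ?case using s(2)[of 0] m(2) by simp
  next
    case (Suc k)
    then show ?case using s(1)[of "Suc k"] by simp
  qed
  from this[of "m - 1"] show ?thesis using m(1,3) by simp
qed

lemma dwell_control_constant:
  assumes "a \<in> U" "0 \<le> T" "\<tau> \<le> T"
  shows "dwell_control U \<tau> T (\<lambda>_. a)"
  unfolding dwell_control_def
  using assms by (intro conjI exI[of _ 1] exI[of _ "\<lambda>i. if i = 0 then 0 else T"]) auto

lemma dwell_control_inf_constant:
  assumes "a \<in> U" "0 \<le> \<tau>"
  shows "dwell_control_inf U \<tau> (\<lambda>_. a)"
  unfolding dwell_control_inf_def
proof (intro exI conjI allI)
  show "filterlim (\<lambda>n. \<tau> + real n) at_top sequentially"
    by (intro filterlim_tendsto_add_at_top[OF tendsto_const] filterlim_real_sequentially)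
  show "dwell_control U \<tau> (\<tau> + real n) (\<lambda>_. a)" for n
    using assms by (intro dwell_control_constant) auto
qed

lemma exists_invariant_dwell_control_set:
  fixes A :: "('m::t2_space, 'e::euclidean_space) chart set"
  assumes \<tau>: "\<tau> \<ge> 0" and comp: "compact (UNIV :: 'm set)" and U: "U \<noteq> {}"
    and cont: "\<And>u t. u \<in> U \<Longrightarrow> continuous_on UNIV (flow A (\<lambda>p. X p u) t)"
    and traj: "\<And>u t q. u \<in> U \<Longrightarrow> t \<ge> 0 \<Longrightarrow> trajectory A X t q (\<lambda>_. u) = flow A (\<lambda>p. X p u) t q"
  shows "\<exists>D. D \<noteq> {} \<and> invariant_dwell_control_set A X U \<tau> D \<and>
    D \<subseteq> closure (dwell_orbit A (fields X U) \<tau> q) \<and>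
    (\<forall>p\<in>D. dwell_orbit A (fields X U) \<tau> p \<subseteq> D)"
proof -
  let ?F = "fields X U" and ?G = "dwell_semigroup A (fields X U) \<tau>"
  let ?K = "\<lambda>p. closure (dwell_orbit A ?F \<tau> p)"
  obtain u0 where u0: "u0 \<in> U" using U by blast
  have in_F: "(\<lambda>p. X p u) \<in> ?F" if "u \<in> U" for u using that by (auto simp: fields_def)
  have "flow A (\<lambda>p. X p u0) \<tau> \<in> ?G" using flow_in_dwell_semigroup[OF in_F[OF u0] order_refl] .
  then have "?G \<noteq> {}" by blast
  have "continuous_on UNIV (flow A Y t)" if "Y \<in> ?F" for Y t using that cont by (auto simp: fields_def)
  then have contG: "continuous_on UNIV g" if "g \<in> ?G" for g
    by (rule continuous_on_dwell_semigroup[OF _ that])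
  have "\<exists>C. closed C \<and> C \<noteq> {} \<and> C \<subseteq> ?K q \<and> (\<forall>p\<in>C. ?K p = C)"
    unfolding dwell_orbit_def
    by (rule exists_minimal_orbit_closure[OF comp \<open>?G \<noteq> {}\<close> contG dwell_semigroup_compose])
  then obtain C where C: "closed C" "C \<noteq> {}" "C \<subseteq> ?K q" "\<forall>p\<in>C. ?K p = C" by blast
  have orbit: "dwell_orbit A ?F \<tau> p \<subseteq> C" if "p \<in> C" for p using C(4) that closure_subset by blast
  have weak: "weakly_invariant A X U \<tau> C"
    unfolding weakly_invariant_def
  proof (intro ballI exI[of _ "\<lambda>_. u0"] conjI allI impI)
    show "dwell_control_inf U \<tau> (\<lambda>_. u0)" by (rule dwell_control_inf_constant[OF u0 \<tau>])
    fix p t assume p: "p \<in> C" and t: "0 < t"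
      "dwell_control U \<tau> t (\<lambda>_. u0) \<and> dwell_control_inf U \<tau> (\<lambda>s. u0)"
    then have "\<tau> \<le> t" using dwell_control_duration_ge by blast
    then have "flow A (\<lambda>p. X p u0) t p \<in> dwell_orbit A ?F \<tau> p"
      unfolding dwell_orbit_def using flow_in_dwell_semigroup[OF in_F[OF u0]] by blast
    then show "trajectory A X t p (\<lambda>_. u0) \<in> C"
      using orbit[OF p] traj[OF u0] t(1) by auto
  qed
  have approx: "approx_controllable A X U \<tau> C"
    unfolding approx_controllable_def using C(4) by blast
  have max: "D' = C" if D': "C \<subseteq> D'" "approx_controllable A X U \<tau> D'" for D'
  proof -
    obtain p where p: "p \<in> C" using C(2) by blast
    then have "D' \<subseteq> ?K p" using D' unfolding approx_controllable_def by blast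
    then show ?thesis using C(4) p D'(1) by blast
  qed
  have "invariant_dwell_control_set A X U \<tau> C"
    unfolding invariant_dwell_control_set_def dwell_control_set_def
    using weak approx max C(1,4) by (auto simp: closure_closed)
  then show ?thesis using C(2,3) orbit by blast
qed

theorem theorem14:
  fixes A :: "('m::{t2_space,second_countable_topology}, 'e::euclidean_space) chart set"
    and X :: "'m \<Rightarrow> 'u \<Rightarrow> ('m, 'e) tangent"
    and U :: "'u set" and \<tau> :: real and d :: nat and q :: 'm
  assumes "\<tau> \<ge> 0"
    and "compact (UNIV :: 'm set)"
    and "smooth_atlas d A"
    and "U \<noteq> {}"
    and "\<And>u. u \<in> U \<Longrightarrow> smooth_vfield d A (\<lambda>p. X p u)"
    and "\<And>u. u \<in> U \<Longrightarrow> complete_vfield A (\<lambda>p. X p u)"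
  shows "\<exists>D. D \<noteq> {} \<and> invariant_dwell_control_set A X U \<tau> D \<and>
           D \<subseteq> closure (dwell_orbit A (fields X U) \<tau> q) \<and>
           ((\<forall>p. lie_at A (fields X U) p = tangent_space d A p) \<longrightarrow> interior D \<noteq> {})"
proof (cases "d = 0")
  case True
  note A = assms(3)[unfolded True]
  have flow: "flow A (\<lambda>p. X p u) t p = p" if "u \<in> U" for u t p by (rule zero_dim_flow[OF A assms(6)[OF that]])
  then have "flow A (\<lambda>p. X p u) t = id" if "u \<in> U" for u t using that by auto
  then have cont: "continuous_on UNIV (flow A (\<lambda>p. X p u) t)" if "u \<in> U" for u t
    using that by (simp add: id_def)
  have traj: "trajectory A X t q (\<lambda>_. u) = flow A (\<lambda>p. X p u) t q" if "u \<in> U" "t \<ge> 0" for u t q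
    using zero_dim_trajectory[where X = X and a = u, OF A assms(6)[OF that(1)] that(2)] flow[OF that(1)] by simp
  obtain D where D: "D \<noteq> {}" "invariant_dwell_control_set A X U \<tau> D"
    "D \<subseteq> closure (dwell_orbit A (fields X U) \<tau> q)"
    using exists_invariant_dwell_control_set[where A = A and X = X and q = q, OF assms(1,2,4) cont traj] by blast
  obtain p where "p \<in> D" using D(1) by blast
  then have "{p} \<subseteq> interior D" using zero_dim_atlas_discrete[OF A] by (intro interior_maximal) auto
  then show ?thesis using D by blast
next
  case False
  interpret positive_dim_manifold d A by standard (use assms(3) False in auto)
  have Y: "flowing (\<lambda>p. X p u)" if "u \<in> U" for u using smooth_vfield_imp_flowing assms(5,6) that by blast
  have cont: "continuous_on UNIV (flow A (\<lambda>p. X p u) t)" if "u \<in> U" for u t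
    by (rule continuous_on_flow[OF Y[OF that] assms(2)])
  have traj: "trajectory A X t q (\<lambda>_. u) = flow A (\<lambda>p. X p u) t q" if "u \<in> U" "t \<ge> 0" for u t q
    by (rule trajectory_constant_control[where X = X and a = u, OF Y[OF that(1)] that(2)])
  obtain D where D: "D \<noteq> {}" "invariant_dwell_control_set A X U \<tau> D"
    "D \<subseteq> closure (dwell_orbit A (fields X U) \<tau> q)" "\<forall>p\<in>D. dwell_orbit A (fields X U) \<tau> p \<subseteq> D"
    using exists_invariant_dwell_control_set[where A = A and X = X and q = q, OF assms(1,2,4) cont traj] by blast
  have "interior D \<noteq> {}" if "\<forall>p. lie_at A (fields X U) p = tangent_space d A p"
  proof (rule interior_nonempty_if_bracket_generating[OF assms(2)])
    show "smooth_vfield d A Y" "complete_vfield A Y" if "Y \<in> fields X U" for Y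
      using that assms(5,6) by (auto simp: fields_def)
    show "flow A Y t r \<in> D" if "Y \<in> fields X U" "r \<in> D" "t \<ge> \<tau>" for Y r t
      using D(4) flow_in_dwell_semigroup[OF that(1,3)] that(2) by (auto simp: dwell_orbit_def)
  qed (use that D(1) in auto)
  then show ?thesis using D by blast
qed

end
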